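(* Let $(X,W)$ be a bivariate stationary Gaussian random field on $\mathbb R^d$ with matrix covariance function $C=(C_{k\ell})_{1\le k,\ell\le2}$ satisfying condition $\mathrm A_d$ (defined in the context) for some $L>0$ with constants $c_{k\ell}$ and exponents $\alpha_{k\ell}$ such that $\alpha_{11}<\alpha_{12}$ and $\alpha_{11}<\alpha_{22}+d$. Let $\beta\in\mathbb R$ and $Y(s)=X(s)\beta+W(s)$. Then $\beta$ is consistently estimable on the paths of $(X,Y)$ in $[0,L]^d$; moreover, if $m$ is an integer such that $\alpha_{11}<4m$, then $$\mathrm{LAP}_n^{(m)}(X,Y)=\frac{\sum_{s\in\mathcal G_n^{(m)}}\Delta_h^{(m)}X(s)\,\Delta_h^{(m)}Y(s)}{\sum_{s\in\mathcal G_n^{(m)}}\{\Delta_h^{(m)}X(s)\}^2}\;\longrightarrow\;\beta\quad\text{in probability as } n\to\infty .$$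
   Context: Index $1$ refers to $X$ and $2$ to $W$; $W$ is not observed. Condition $\mathrm A(L,c,\alpha)$ for a function $K$ on $\mathbb R$: $K(t)=A(t)+B(t)$, where $A$ is even and analytic and $B$ is even and continuous on $[-L,L]$; the $k$-th derivative $B^{(k)}$ on $(0,L]$ ($k\ge0$, $B^{(0)}=B$) satisfies, as $t\downarrow0$, $B^{(k)}(t)=(\alpha)_k\,c\,t^{\alpha-k}+o(t^{\alpha-k})$, where $c$ is a constant (non-zero for a covariance function, i.e. for $k=\ell$ below), $\alpha>0$ is not an even integer and $(\alpha)_k=\Gamma(\alpha+1)/\Gamma(\alpha+1-k)$. Condition $\mathrm A_d$ for a $2\times2$ matrix-valued stationary covariance function $C=(C_{k\ell})$ on $\mathbb R^d$: $C_{12}=C_{21}$ and, for all $k,\ell$, $C_{k\ell}(u)=K_{k\ell}(\|u\|)+r_{k\ell}(u)$, where $K_{k\ell}$, extended evenly to $\mathbb R$, satisfies $\mathrm A(L,c_{k\ell},\alpha_{k\ell})$, and the remainder satisfies $r_{k\ell}(u)=o(\|u\|^{\alpha_{k\ell}})$ and, for $u\ne0$, all $p$-th order mixed partial derivatives of $r_{k\ell}$ at $u$ are $o(\|u\|^{\alpha_{k\ell}-p})$ (as $u\to0$). Grid and Laplacians: $\mathcal G_n$ is the regular grid of $(n+1)^d$ points in $[0,L]^d$ with spacing $h=L/n$; $\mathcal G_n^{(1)}$ is the interior grid obtained by removing the outermost layer of points of $\mathcal G_n$, and $\mathcal G_n^{(m)}=(\mathcal G_n^{(m-1)})^{(1)}$.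 For $s\in\mathcal G_n^{(1)}$, $\Delta_hZ(s)=h^{-2}\sum_{g=1}^d\{Z(s+he_g)+Z(s-he_g)-2Z(s)\}$ with $e_g$ the $g$-th standard basis vector; $\Delta_h^{(1)}=\Delta_h$ and $\Delta_h^{(m)}Z=\Delta_h(\Delta_h^{(m-1)}Z)$, defined on $\mathcal G_n^{(m)}$. "Consistently estimable on the paths" means that there is a sequence of measurable functions of $\{(X(s),Y(s)):s\in[0,L]^d\}$ converging in probability to $\beta$. *)

theory Defs
  imports "HOL-Probability.Probability"
begin

subsection \<open>Covariance conditions\<close>

(* The product with rGamma, the entire reciprocal of Gamma, gives the value 0 at the poles of
   Gamma (a + 1 - k), i.e. for integer a < k. *)
definition falling :: "real \<Rightarrow> nat \<Rightarrow> real" where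
  "falling a k = Gamma (a + 1) * rGamma (a + 1 - real k)"

definition real_analytic_on :: "(real \<Rightarrow> real) \<Rightarrow> real set \<Rightarrow> bool" where
  "real_analytic_on f S \<longleftrightarrow> (\<forall>t\<in>S. \<exists>F. (\<lambda>x. f (t + x)) has_fps_expansion F)"

(* DB k is the k-th derivative of B on (0,L], one-sided at L. *)
definition condition_A :: "real \<Rightarrow> real \<Rightarrow> real \<Rightarrow> (real \<Rightarrow> real) \<Rightarrow> bool" where
  "condition_A L c a K \<longleftrightarrow>
     0 < a \<and> (\<nexists>j::int. a = 2 * of_int j) \<and>
     (\<exists>A B DB.
        (\<forall>t\<in>{-L..L}. K t = A t + B t) \<and>
        (\<forall>t\<in>{-L..L}. A (-t) = A t) \<and> real_analytic_on A {-L..L} \<and>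
        (\<forall>t\<in>{-L..L}. B (-t) = B t) \<and> continuous_on {-L..L} B \<and>
        (\<forall>t\<in>{0<..L}. DB 0 t = B t) \<and>
        (\<forall>k. \<forall>t\<in>{0<..L}.
           (DB k has_real_derivative DB (Suc k) t) (at t within {0<..L})) \<and>
        (\<forall>k. (\<lambda>t. DB k t - falling a k * c * t powr (a - real k))
           \<in> o[at_right 0](\<lambda>t. t powr (a - real k))))"

(* D gs is the iterated partial derivative along the directions in the list gs, taken on the
   complement of the origin; its order is the length of gs.  For r itself the filter is nhds 0
   instead of at 0: the point u = 0 is included, so that r 0 = 0 and C has no jump (nugget)
   at the origin. *)
definition remainder_cond :: "real \<Rightarrow> (real^'d \<Rightarrow> real) \<Rightarrow> bool" where
  "remainder_cond a r \<longleftrightarrow>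
     r \<in> o[nhds 0](\<lambda>u. norm u powr a) \<and>
     (\<exists>D :: 'd list \<Rightarrow> real^'d \<Rightarrow> real.
        (\<forall>u. u \<noteq> 0 \<longrightarrow> D [] u = r u) \<and>
        (\<forall>gs g u. u \<noteq> 0 \<longrightarrow>
           ((\<lambda>t. D gs (u + t *\<^sub>R axis g 1)) has_real_derivative D (g # gs) u) (at 0)) \<and>
        (\<forall>gs. D gs \<in> o[at 0](\<lambda>u. norm u powr (a - real (length gs)))))"

definition condition_Ad ::
  "real \<Rightarrow> (2 \<Rightarrow> 2 \<Rightarrow> real) \<Rightarrow> (2 \<Rightarrow> 2 \<Rightarrow> real) \<Rightarrow> (real^'d \<Rightarrow> real^2^2) \<Rightarrow> bool" where
  "condition_Ad L c \<alpha> C \<longleftrightarrow>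
     (\<forall>u. C u $ 1 $ 2 = C u $ 2 $ 1) \<and>
     (\<forall>k. c k k \<noteq> 0) \<and>
     (\<forall>k l. \<exists>K r.
        (\<forall>t. K (-t) = K t) \<and> condition_A L (c k l) (\<alpha> k l) K \<and>
        remainder_cond (\<alpha> k l) r \<and>
        (\<forall>u. C u $ k $ l = K (norm u) + r u))"

subsection \<open>Stationary Gaussian random fields\<close>

(* Degenerate (constant) Gaussian variables are admitted. *)
definition gaussian_rv :: "'a measure \<Rightarrow> ('a \<Rightarrow> real) \<Rightarrow> bool" where
  "gaussian_rv M V \<longleftrightarrow> V \<in> borel_measurable M \<and>
     ((\<exists>\<mu>. AE \<omega> in M. V \<omega> = \<mu>) \<or>
      (\<exists>\<mu> \<sigma>. 0 < \<sigma> \<and> distributed M lborel V (normal_density \<mu> \<sigma>)))"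

definition gaussian_field :: "'a measure \<Rightarrow> (real^'d \<Rightarrow> 'a \<Rightarrow> real^'k) \<Rightarrow> bool" where
  "gaussian_field M Z \<longleftrightarrow>
     (\<forall>S a. finite S \<longrightarrow> gaussian_rv M (\<lambda>\<omega>. \<Sum>s\<in>S. a s \<bullet> Z s \<omega>))"

definition covariance :: "'a measure \<Rightarrow> ('a \<Rightarrow> real) \<Rightarrow> ('a \<Rightarrow> real) \<Rightarrow> real" where
  "covariance M U V =
     (\<integral>\<omega>. (U \<omega> - (\<integral>\<omega>. U \<omega> \<partial>M)) * (V \<omega> - (\<integral>\<omega>. V \<omega> \<partial>M)) \<partial>M)"

definition stationary_gaussian_field ::
  "'a measure \<Rightarrow> (real^'d \<Rightarrow> 'a \<Rightarrow> real^'k) \<Rightarrow> (real^'d \<Rightarrow> real^'k^'k) \<Rightarrow> bool" where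
  "stationary_gaussian_field M Z C \<longleftrightarrow>
     gaussian_field M Z \<and>
     (\<exists>\<mu>::real^'k. \<forall>s k. (\<integral>\<omega>. Z s \<omega> $ k \<partial>M) = \<mu> $ k) \<and>
     (\<forall>s t k l. covariance M (\<lambda>\<omega>. Z s \<omega> $ k) (\<lambda>\<omega>. Z t \<omega> $ l) = C (s - t) $ k $ l)"

subsection \<open>Convergence in probability and estimability on the paths\<close>

definition tendsto_in_prob :: "'a measure \<Rightarrow> (nat \<Rightarrow> 'a \<Rightarrow> real) \<Rightarrow> real \<Rightarrow> bool" where
  "tendsto_in_prob M V b \<longleftrightarrow>
     (\<forall>\<epsilon>>0. (\<lambda>n. measure M {\<omega> \<in> space M. \<bar>V n \<omega> - b\<bar> > \<epsilon>}) \<longlonglongrightarrow> 0)"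

definition cube :: "real \<Rightarrow> (real^'d) set" where
  "cube L = cbox 0 (\<chi> i. L)"

(* Y b is the response field when the parameter equals b.  The estimators T n are chosen before
   b: they see the parameter only through the observed paths. *)
definition consistently_estimable_on_paths ::
  "'a measure \<Rightarrow> (real^'d) set \<Rightarrow> (real^'d \<Rightarrow> 'a \<Rightarrow> real) \<Rightarrow>
     (real \<Rightarrow> real^'d \<Rightarrow> 'a \<Rightarrow> real) \<Rightarrow> bool" where
  "consistently_estimable_on_paths M S X Y \<longleftrightarrow>
     (\<exists>T :: nat \<Rightarrow> (real^'d \<Rightarrow> real \<times> real) \<Rightarrow> real.
        (\<forall>n. T n \<in> borel_measurable (\<Pi>\<^sub>M s\<in>S. borel)) \<and>
        (\<forall>b. tendsto_in_prob M (\<lambda>n \<omega>. T n (\<lambda>s\<in>S. (X s \<omega>, Y b s \<omega>))) b))"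

subsection \<open>Grids and discrete Laplacians\<close>

definition grid :: "real \<Rightarrow> nat \<Rightarrow> (real^'d) set" where
  "grid L n = {s. \<forall>i. \<exists>k\<le>n. s $ i = real k * (L / real n)}"

(* The outermost layer of a grid G consists of the points with some coordinate that is minimal
   or maximal over G. *)
definition interior_grid :: "(real^'d) set \<Rightarrow> (real^'d) set" where
  "interior_grid G = {s\<in>G. \<forall>g. (\<exists>t\<in>G. t $ g < s $ g) \<and> (\<exists>t\<in>G. s $ g < t $ g)}"

definition igrid :: "real \<Rightarrow> nat \<Rightarrow> nat \<Rightarrow> (real^'d) set" where
  "igrid L n m = (interior_grid ^^ m) (grid L n)"

lemma interior_grid_box:
  fixes h :: real
  assumes h: "0 < h"
  defines "G \<equiv> \<lambda>m n. {s::real^'d. \<forall>i. \<exists>k. m \<le> k \<and> k + m \<le> n \<and> s $ i = real k * h}"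
  shows "interior_grid (G m n) = G (Suc m) n"
proof (intro set_eqI iffI)
  fix s assume s: "s \<in> interior_grid (G m n)"
  have G: "\<exists>k. m \<le> k \<and> k + m \<le> n \<and> t $ i = real k * h" if "t \<in> G m n" for t i
    using that unfolding G_def by blast
  have "\<exists>k. Suc m \<le> k \<and> k + Suc m \<le> n \<and> s $ i = real k * h" for i
  proof -
    obtain t t' where t: "s \<in> G m n" "t \<in> G m n" "t $ i < s $ i" "t' \<in> G m n" "s $ i < t' $ i"
      using s unfolding interior_grid_def by blast
    obtain k where k: "s $ i = real k * h" using G[OF t(1)] by blast
    obtain k1 where k1: "m \<le> k1" "t $ i = real k1 * h" using G[OF t(2)] by blast
    obtain k2 where k2: "k2 + m \<le> n" "t' $ i = real k2 * h" using G[OF t(4)] by blast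
    have "k1 < k" "k < k2" using t(3,5) h unfolding k k1 k2 by simp_all
    then show ?thesis using k1 k2 k by (intro exI[of _ k]) auto
  qed
  then show "s \<in> G (Suc m) n" unfolding G_def by blast
next
  fix s assume s: "s \<in> G (Suc m) n"
  have sG: "\<exists>k. m \<le> k \<and> k + m \<le> n \<and> s $ i = real k * h" for i
  proof -
    obtain k where "Suc m \<le> k" "k + Suc m \<le> n" "s $ i = real k * h"
      using s unfolding G_def by blast
    then show ?thesis by (intro exI[of _ k]) auto
  qed
  have "(\<exists>t\<in>G m n. t $ g < s $ g) \<and> (\<exists>t\<in>G m n. s $ g < t $ g)" for g
  proof -
    obtain k where k: "Suc m \<le> k" "k + Suc m \<le> n" "s $ g = real k * h"
      using s unfolding G_def by blast
    have *: "(\<chi> i. if i = g then real j * h else s $ i) \<in> G m n" if "m \<le> j" "j + m \<le> n" for j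
      using sG that unfolding G_def by auto
    have "real (k - 1) * h < s $ g" "s $ g < real (k + 1) * h"
      using h k(1) unfolding k(3) by (simp_all add: mult_less_cancel_right_pos)
    then show ?thesis
      using k by (intro conjI bexI[OF _ *[of "k - 1"]] bexI[OF _ *[of "k + 1"]]) auto
  qed
  moreover have "s \<in> G m n" using sG unfolding G_def by blast
  ultimately show "s \<in> interior_grid (G m n)" by (auto simp: interior_grid_def)
qed

lemma igrid_explicit:
  assumes "0 < L" "0 < n"
  shows "igrid L n m =
    {s::real^'d. \<forall>i. \<exists>k. m \<le> k \<and> k + m \<le> n \<and> s $ i = real k * (L / real n)}"
proof (induction m)
  case 0
  then show ?case by (simp add: igrid_def grid_def)
next
  case (Suc m)
  have "0 < L / real n" using assms by simp
  from interior_grid_box[OF this, of m n] show ?case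
    using Suc.IH by (simp add: igrid_def)
qed

definition laplacian :: "real \<Rightarrow> (real^'d \<Rightarrow> real) \<Rightarrow> real^'d \<Rightarrow> real" where
  "laplacian h z s =
     (\<Sum>g\<in>UNIV. z (s + h *\<^sub>R axis g 1) + z (s - h *\<^sub>R axis g 1) - 2 * z s) / h^2"

definition LAP :: "real \<Rightarrow> nat \<Rightarrow> nat \<Rightarrow> (real^'d \<Rightarrow> real) \<Rightarrow> (real^'d \<Rightarrow> real) \<Rightarrow> real" where
  "LAP L n m x y =
     (\<Sum>s\<in>igrid L n m. (laplacian (L / real n) ^^ m) x s * (laplacian (L / real n) ^^ m) y s) /
     (\<Sum>s\<in>igrid L n m. ((laplacian (L / real n) ^^ m) x s)^2)"

end

theory Submission
  imports Defs "HOL-Complex_Analysis.Complex_Analysis" "HOL-Real_Asymp.Real_Asymp"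
begin

text \<open>
  Write \<open>U = \<Delta>\<^sup>m X\<close> and \<open>V = \<Delta>\<^sup>m W\<close>, so that the estimation error is the ratio of \<open>\<Sum> U V\<close> and
  \<open>\<Sum> U\<^sup>2\<close>. The covariances of \<open>U\<close> and \<open>V\<close> are \<open>\<Delta>\<^sup>2\<^sup>m C\<close>, of which the even polynomial part of degree
  below \<open>4m\<close> is annihilated; the mean value theorem bounds the rest by \<open>(h + |u|)\<close> to the power
  \<open>min \<alpha> (4m) - 4m\<close>, and the variance of \<open>U\<close>, multiplied by \<open>h\<close> to the power \<open>4m - \<alpha>\<close>, tends to
  \<open>c \<Delta>\<^sup>2\<^sup>m |\<cdot>|\<^sup>\<alpha>\<close> at \<open>0\<close>. This is positive: otherwise, by Cauchy--Schwarz, \<open>\<Delta>\<^sup>2\<^sup>m |\<cdot>|\<^sup>\<alpha>\<close> would vanish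
  everywhere, whereas near \<open>0\<close> it is a nonzero multiple of \<open>|\<cdot>|\<^sup>\<alpha>\<close> plus an analytic function. By
  Isserlis' formula the variances of both sums are sums of products of two covariances, and the
  decay bounds make them negligible against \<open>(E \<Sum> U\<^sup>2)\<^sup>2\<close>. As the hypothesis only concerns the
  covariance near the origin, the cube is first cut into boundedly many small cells. Chebyshev's
  inequality concludes.
\<close>

subsection \<open>Moments of Gaussian variables\<close>

text \<open>The hypotheses leave even the sign of \<open>c 1 1\<close> open, so positivity of the
  limiting variance cannot be read off the expansion; it has to come from \<open>C\<close> being a
  covariance. The exponent conditions enter separately. \<open>\<alpha> 1 1 < 4 * real m\<close>
  makes the singular term dominate the analytic one, so that the mean of the denominator is of the
  order of the number of grid points times h^(\<alpha> 1 1 - 4m).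
  \<open>\<alpha> 1 1 < \<alpha> 1 2\<close> makes the mean of the numerator negligible against
  this. \<open>\<alpha> 1 1 < \<alpha> 2 2 + d\<close> concerns its fluctuation: V may be rougher
  than U, and it is the averaging over about n^d grid points, worth up to h^d in the variance, that
  compensates. Derivatives of the covariance may blow up at the origin, hence the \<open>h\<close>
  in the decay bound, which covers stencils that touch the origin and stencils that do not. The
  exponent is cut at 4m because a smoother field still has a differenced covariance that is only
  bounded. The number of cells multiplies the variance, so it must not grow with n.\<close>

lemma normal_density_shifted_moment_integrable:
  assumes "0 < \<sigma>"
  shows "integrable lborel (\<lambda>x. normal_density \<mu> \<sigma> x * x ^ k)"
proof -
  have "x ^ k = (\<Sum>i\<le>k. of_nat (k choose i) * (x - \<mu>) ^ i * \<mu> ^ (k - i))" for x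
    using binomial_ring[of "x - \<mu>" \<mu> k] by simp
  then have eq: "(\<lambda>x. normal_density \<mu> \<sigma> x * x ^ k) =
      (\<lambda>x. \<Sum>i\<le>k. (normal_density \<mu> \<sigma> x * (x - \<mu>) ^ i) * (of_nat (k choose i) * \<mu> ^ (k - i)))"
    by (simp add: sum_distrib_left mult_ac)
  show ?thesis
    unfolding eq using integrable_normal_moment[OF assms, of \<mu>]
    by (intro Bochner_Integration.integrable_sum integrable_mult_left) auto
qed

lemma gaussian_rv_power_integrable:
  assumes "prob_space M" "gaussian_rv M V"
  shows "integrable M (\<lambda>\<omega>. V \<omega> ^ k)"
proof -
  interpret prob_space M by fact
  have m[measurable]: "V \<in> borel_measurable M" using assms by (simp add: gaussian_rv_def)
  from assms(2) consider \<mu> where "AE \<omega> in M. V \<omega> = \<mu>"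
    | \<mu> \<sigma> where "0 < \<sigma>" "distributed M lborel V (normal_density \<mu> \<sigma>)"
    by (auto simp: gaussian_rv_def)
  then show ?thesis
  proof cases
    case 1
    have "integrable M (\<lambda>_. \<mu> ^ k)" by simp
    then show ?thesis
      by (rule Bochner_Integration.integrable_cong_AE_imp) (use 1 in auto)
  next
    case 2
    then show ?thesis
      using normal_density_shifted_moment_integrable[OF 2(1), of \<mu> k]
      by (subst distributed_integrable[OF 2(2), symmetric]) auto
  qed
qed

lemma gaussian_rv_fourth_moment:
  assumes "prob_space M" "gaussian_rv M V" "(\<integral>\<omega>. V \<omega> \<partial>M) = 0"
  shows "(\<integral>\<omega>. V \<omega> ^ 4 \<partial>M) = 3 * (\<integral>\<omega>. V \<omega> ^ 2 \<partial>M)\<^sup>2"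
proof -
  interpret prob_space M by fact
  have m[measurable]: "V \<in> borel_measurable M" using assms by (simp add: gaussian_rv_def)
  from assms(2) consider \<mu> where "AE \<omega> in M. V \<omega> = \<mu>"
    | \<mu> \<sigma> where "0 < \<sigma>" "distributed M lborel V (normal_density \<mu> \<sigma>)"
    by (auto simp: gaussian_rv_def)
  then show ?thesis
  proof cases
    case 1
    have "(\<integral>\<omega>. V \<omega> \<partial>M) = (\<integral>\<omega>. \<mu> \<partial>M)"
      by (intro integral_cong_AE) (use 1 in auto)
    then have "\<mu> = 0" using assms(3) by (simp add: prob_space)
    with 1 have z: "AE \<omega> in M. V \<omega> = 0" by simp
    have "(\<integral>\<omega>. V \<omega> ^ k \<partial>M) = 0" if "k > 0" for k
      by (rule integral_eq_zero_AE) (use z that in auto)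
    then show ?thesis by simp
  next
    case 2
    have "\<mu> = 0"
      using normal_distributed_expectation[OF 2(1,2)] assms(3) by simp
    have mom: "(\<integral>\<omega>. V \<omega> ^ k \<partial>M) = (\<integral>x. normal_density 0 \<sigma> x * x ^ k \<partial>lborel)" for k
      by (subst distributed_integral[OF 2(2), symmetric]) (auto simp: \<open>\<mu> = 0\<close>)
    \<comment> \<open>The even moment formula with 1 and 2 gives \<sigma>^2 and 3
      \<sigma>^4.\<close>
    show ?thesis
      using integral_normal_moment_even[OF 2(1), of 0 1] integral_normal_moment_even[OF 2(1), of 0 2]
      unfolding mom by (simp add: fact_numeral power2_eq_square power4_eq_xxxx field_simps)
  qed
qed

section \<open>An elementary inequality and the polarization identities\<close>

lemma abs_mult_le_half_sum_squares: "\<bar>x * y\<bar> \<le> (x\<^sup>2 + y\<^sup>2) / 2" for x y :: real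
  using zero_le_power2[of "x - y"] zero_le_power2[of "x + y"]
  unfolding power2_sum power2_diff by (simp add: abs_le_iff)

text \<open>A monomial of the fourth power survives the alternating sum over the signs of
  \<open>b\<close>, \<open>c\<close>, \<open>d\<close> only if it is odd in each of them, and
  \<open>a b c d\<close> is the only such monomial. Its coefficient is 24 in modulus in each of the
  eight powers, whence 192.\<close>

lemma polarization4:
  fixes a b c d :: real
  shows "a * b * (c * d) =
    ((a + 1 * b + 1 * c + 1 * d) ^ 4 - (a + (-1) * b + 1 * c + 1 * d) ^ 4
     - (a + 1 * b + (-1) * c + 1 * d) ^ 4 - (a + 1 * b + 1 * c + (-1) * d) ^ 4
     + (a + (-1) * b + (-1) * c + 1 * d) ^ 4 + (a + (-1) * b + 1 * c + (-1) * d) ^ 4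
     + (a + 1 * b + (-1) * c + (-1) * d) ^ 4 - (a + (-1) * b + (-1) * c + (-1) * d) ^ 4) / 192"
  by (simp add: power4_eq_xxxx algebra_simps)

text \<open>\<open>Q\<close> stands for the second moment of the signed sum, \<open>A\<close>,
  \<open>B\<close>, \<open>C\<close>, \<open>D\<close> for the moments of the squares, and
  \<open>x\<close>, \<open>y\<close>, \<open>z\<close>, \<open>u\<close>, \<open>v'\<close>,
  \<open>w\<close> for those of the products ab, ac, ad, bc, bd, cd. Since all signs have square 1,
  the first four enter only through their sum and cancel; what remains is the right-hand side of
  Isserlis' formula.\<close>

lemma polarization_square:
  fixes Q :: "real \<Rightarrow> real \<Rightarrow> real \<Rightarrow> real"
  assumes "\<And>p q r. Q p q r = A + p^2 * B + q^2 * C + r^2 * D + 2 * p * x + 2 * q * y + 2 * r * z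
    + 2 * p * q * u + 2 * p * r * v' + 2 * q * r * w"
  shows "(3 * (Q 1 1 1)\<^sup>2 - 3 * (Q (-1) 1 1)\<^sup>2 - 3 * (Q 1 (-1) 1)\<^sup>2 - 3 * (Q 1 1 (-1))\<^sup>2
    + 3 * (Q (-1) (-1) 1)\<^sup>2 + 3 * (Q (-1) 1 (-1))\<^sup>2 + 3 * (Q 1 (-1) (-1))\<^sup>2
    - 3 * (Q (-1) (-1) (-1))\<^sup>2) / 192 = x * w + y * v' + z * u"
proof -
  define S where "S = A + B + C + D"
  \<comment> \<open>Patterns that differ only in the sign of \<open>p\<close> are paired into a
    difference of squares: one factor is free of \<open>p\<close>, the other collects exactly the
    terms containing \<open>p\<close>.\<close>
  have diff: "(Q 1 q r)\<^sup>2 - (Q (-1) q r)\<^sup>2 =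
      8 * ((S + 2 * q * y + 2 * r * z + 2 * q * r * w) * (x + q * u + r * v'))"
    if "q\<^sup>2 = 1" "r\<^sup>2 = 1" for q r
  proof -
    have "(Q 1 q r)\<^sup>2 - (Q (-1) q r)\<^sup>2 = (Q 1 q r + Q (-1) q r) * (Q 1 q r - Q (-1) q r)"
      by (simp add: power2_eq_square algebra_simps)
    also have "Q 1 q r + Q (-1) q r = 2 * (S + 2 * q * y + 2 * r * z + 2 * q * r * w)"
      unfolding assms that by (simp add: S_def)
    also have "Q 1 q r - Q (-1) q r = 4 * (x + q * u + r * v')"
      unfolding assms that by simp
    finally show ?thesis by (simp add: algebra_simps)
  qed
  have "((Q 1 1 1)\<^sup>2 - (Q (-1) 1 1)\<^sup>2) - ((Q 1 (-1) 1)\<^sup>2 - (Q (-1) (-1) 1)\<^sup>2)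
      - ((Q 1 1 (-1))\<^sup>2 - (Q (-1) 1 (-1))\<^sup>2) + ((Q 1 (-1) (-1))\<^sup>2 - (Q (-1) (-1) (-1))\<^sup>2)
      = 64 * (x * w + y * v' + z * u)"
    by (subst diff, simp, simp)+ (simp add: algebra_simps)
  then show ?thesis by (simp add: field_simps)
qed

text \<open>Closure under sums and multiples makes every signed combination in the polarization a
  centred Gaussian variable again; joint normality enters in this form.\<close>

locale centered_gaussian_space = prob_space M for M :: "'a measure" +
  fixes G :: "('a \<Rightarrow> real) set"
  assumes gaussian: "V \<in> G \<Longrightarrow> gaussian_rv M V"
    and centered: "V \<in> G \<Longrightarrow> (\<integral>\<omega>. V \<omega> \<partial>M) = 0"
    and add_closed: "U \<in> G \<Longrightarrow> V \<in> G \<Longrightarrow> (\<lambda>\<omega>. U \<omega> + V \<omega>) \<in> G"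
    and scale_closed: "V \<in> G \<Longrightarrow> (\<lambda>\<omega>. r * V \<omega>) \<in> G"
begin

lemma measurable_G: "V \<in> G \<Longrightarrow> V \<in> borel_measurable M"
  using gaussian gaussian_rv_def by blast

lemma integrable_power: "V \<in> G \<Longrightarrow> integrable M (\<lambda>\<omega>. V \<omega> ^ k)"
  using gaussian_rv_power_integrable[OF prob_space_axioms] gaussian by blast

lemma integrable_mult2:
  assumes "a \<in> G" "b \<in> G"
  shows "integrable M (\<lambda>\<omega>. a \<omega> * b \<omega>)"
proof (rule Bochner_Integration.integrable_bound[of M "\<lambda>\<omega>. a \<omega> ^ 2 + b \<omega> ^ 2"])
  show "integrable M (\<lambda>\<omega>. a \<omega> ^ 2 + b \<omega> ^ 2)" using assms by (intro Bochner_Integration.integrable_add integrable_power)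
  show "(\<lambda>\<omega>. a \<omega> * b \<omega>) \<in> borel_measurable M" using assms measurable_G by auto
  have "\<bar>x * y\<bar> \<le> x^2 + y^2" for x y :: real
    by (rule order_trans[OF abs_mult_le_half_sum_squares]) simp
  then show "AE \<omega> in M. norm (a \<omega> * b \<omega>) \<le> norm (a \<omega> ^ 2 + b \<omega> ^ 2)" by simp
qed

lemma integrable_mult4:
  assumes "a \<in> G" "b \<in> G" "c \<in> G" "d \<in> G"
  shows "integrable M (\<lambda>\<omega>. a \<omega> * b \<omega> * (c \<omega> * d \<omega>))"
proof (rule Bochner_Integration.integrable_bound[of M "\<lambda>\<omega>. (a \<omega> ^ 4 + b \<omega> ^ 4) + (c \<omega> ^ 4 + d \<omega> ^ 4)"])
  show "integrable M (\<lambda>\<omega>. (a \<omega> ^ 4 + b \<omega> ^ 4) + (c \<omega> ^ 4 + d \<omega> ^ 4))"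
    using assms by (intro Bochner_Integration.integrable_add integrable_power)
  show "(\<lambda>\<omega>. a \<omega> * b \<omega> * (c \<omega> * d \<omega>)) \<in> borel_measurable M" using assms measurable_G by auto
  note two = abs_mult_le_half_sum_squares
  have four: "\<bar>x * y * (z * w)\<bar> \<le> (x^4 + y^4) + (z^4 + w^4)" for x y z w :: real
  proof -
    have "\<bar>x * y * (z * w)\<bar> \<le> ((x * y)^2 + (z * w)^2) / 2" by (rule two)
    moreover have "(x * y)^2 \<le> (x^4 + y^4) / 2" "(z * w)^2 \<le> (z^4 + w^4) / 2"
      using two[of "x^2" "y^2"] two[of "z^2" "w^2"]
      by (simp_all add: power_mult_distrib flip: power_mult)
    moreover have "0 \<le> x^4 + y^4" "0 \<le> z^4 + w^4" by simp_all
    ultimately show ?thesis by (auto simp: abs_le_iff)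
  qed
  then show "AE \<omega> in M. norm (a \<omega> * b \<omega> * (c \<omega> * d \<omega>)) \<le> norm ((a \<omega> ^ 4 + b \<omega> ^ 4) + (c \<omega> ^ 4 + d \<omega> ^ 4))"
    by simp
qed

lemma combination4_closed:
  assumes "a \<in> G" "b \<in> G" "c \<in> G" "d \<in> G"
  shows "(\<lambda>\<omega>. a \<omega> + p * b \<omega> + q * c \<omega> + r * d \<omega>) \<in> G"
  using assms by (intro add_closed scale_closed)

text \<open>Isserlis' formula, by polarization of \<open>E V\<^sup>4 = 3 (E V\<^sup>2)\<^sup>2\<close>: the alternating sum of
  \<open>(a \<plusminus> b \<plusminus> c \<plusminus> d)\<^sup>4\<close> over the eight sign patterns is \<open>192 a b c d\<close>.\<close>
lemma isserlis:
  assumes G: "a \<in> G" "b \<in> G" "c \<in> G" "d \<in> G"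
  shows "(\<integral>\<omega>. a \<omega> * b \<omega> * (c \<omega> * d \<omega>) \<partial>M) =
    (\<integral>\<omega>. a \<omega> * b \<omega> \<partial>M) * (\<integral>\<omega>. c \<omega> * d \<omega> \<partial>M) +
    (\<integral>\<omega>. a \<omega> * c \<omega> \<partial>M) * (\<integral>\<omega>. b \<omega> * d \<omega> \<partial>M) +
    (\<integral>\<omega>. a \<omega> * d \<omega> \<partial>M) * (\<integral>\<omega>. b \<omega> * c \<omega> \<partial>M)"
proof -
  let ?E = "\<lambda>f. integral\<^sup>L M f"
  define V where "V p q r \<omega> = a \<omega> + p * b \<omega> + q * c \<omega> + r * d \<omega>" for p q r \<omega>
  have VG: "V p q r \<in> G" for p q r
    using combination4_closed[OF G, of p q r] by (simp add: V_def[abs_def])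
  have int2: "integrable M (\<lambda>\<omega>. V p q r \<omega> ^ k)" for p q r k by (rule integrable_power[OF VG])
  have quad: "?E (\<lambda>\<omega>. V p q r \<omega> ^ 2) =
    ?E (\<lambda>\<omega>. a \<omega> * a \<omega>) + p^2 * ?E (\<lambda>\<omega>. b \<omega> * b \<omega>) + q^2 * ?E (\<lambda>\<omega>. c \<omega> * c \<omega>) + r^2 * ?E (\<lambda>\<omega>. d \<omega> * d \<omega>)
    + 2 * p * ?E (\<lambda>\<omega>. a \<omega> * b \<omega>) + 2 * q * ?E (\<lambda>\<omega>. a \<omega> * c \<omega>) + 2 * r * ?E (\<lambda>\<omega>. a \<omega> * d \<omega>)
    + 2 * p * q * ?E (\<lambda>\<omega>. b \<omega> * c \<omega>) + 2 * p * r * ?E (\<lambda>\<omega>. b \<omega> * d \<omega>) + 2 * q * r * ?E (\<lambda>\<omega>. c \<omega> * d \<omega>)" for p q r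
  proof -
    have "V p q r \<omega> ^ 2 = a \<omega> * a \<omega> + p^2 * (b \<omega> * b \<omega>) + q^2 * (c \<omega> * c \<omega>) + r^2 * (d \<omega> * d \<omega>)
    + 2 * p * (a \<omega> * b \<omega>) + 2 * q * (a \<omega> * c \<omega>) + 2 * r * (a \<omega> * d \<omega>)
    + 2 * p * q * (b \<omega> * c \<omega>) + 2 * p * r * (b \<omega> * d \<omega>) + 2 * q * r * (c \<omega> * d \<omega>)" for \<omega>
      unfolding V_def by (simp add: power2_eq_square algebra_simps)
    then show ?thesis using G by (simp add: integrable_mult2)
  qed
  have fourth: "?E (\<lambda>\<omega>. V p q r \<omega> ^ 4) = 3 * (?E (\<lambda>\<omega>. V p q r \<omega> ^ 2))\<^sup>2" for p q r
    by (rule gaussian_rv_fourth_moment[OF prob_space_axioms gaussian[OF VG] centered[OF VG]])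
  have pol: "a \<omega> * b \<omega> * (c \<omega> * d \<omega>) = (V 1 1 1 \<omega> ^ 4 - V (-1) 1 1 \<omega> ^ 4 - V 1 (-1) 1 \<omega> ^ 4 - V 1 1 (-1) \<omega> ^ 4
      + V (-1) (-1) 1 \<omega> ^ 4 + V (-1) 1 (-1) \<omega> ^ 4 + V 1 (-1) (-1) \<omega> ^ 4 - V (-1) (-1) (-1) \<omega> ^ 4) / 192" for \<omega>
    unfolding V_def by (rule polarization4)
  have "?E (\<lambda>\<omega>. a \<omega> * b \<omega> * (c \<omega> * d \<omega>)) =
     (?E (\<lambda>\<omega>. V 1 1 1 \<omega> ^ 4) - ?E (\<lambda>\<omega>. V (-1) 1 1 \<omega> ^ 4) - ?E (\<lambda>\<omega>. V 1 (-1) 1 \<omega> ^ 4) - ?E (\<lambda>\<omega>. V 1 1 (-1) \<omega> ^ 4)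
      + ?E (\<lambda>\<omega>. V (-1) (-1) 1 \<omega> ^ 4) + ?E (\<lambda>\<omega>. V (-1) 1 (-1) \<omega> ^ 4) + ?E (\<lambda>\<omega>. V 1 (-1) (-1) \<omega> ^ 4)
      - ?E (\<lambda>\<omega>. V (-1) (-1) (-1) \<omega> ^ 4)) / 192"
    unfolding pol by (simp add: int2)
  also have "\<dots> = ?E (\<lambda>\<omega>. a \<omega> * b \<omega>) * ?E (\<lambda>\<omega>. c \<omega> * d \<omega>) +
    ?E (\<lambda>\<omega>. a \<omega> * c \<omega>) * ?E (\<lambda>\<omega>. b \<omega> * d \<omega>) + ?E (\<lambda>\<omega>. a \<omega> * d \<omega>) * ?E (\<lambda>\<omega>. b \<omega> * c \<omega>)"
    unfolding fourth by (rule polarization_square[OF quad])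
  finally show ?thesis .
qed

end

text \<open>Only covariances of pairs in the same cell of the partition \<open>q\<close> enter; this is how a purely
  local hypothesis on the covariance controls sums over the whole cube.\<close>
lemma (in prob_space) second_moment_cell_sum:
  fixes Z :: "'b \<Rightarrow> 'a \<Rightarrow> real"
  assumes "finite S" "finite Q" "q ` S \<subseteq> Q"
    and int: "\<And>s t. s \<in> S \<Longrightarrow> t \<in> S \<Longrightarrow> integrable M (\<lambda>\<omega>. Z s \<omega> * Z t \<omega>)"
  shows "(\<integral>\<omega>. (\<Sum>s\<in>S. Z s \<omega>)\<^sup>2 \<partial>M) \<le>
    card Q * (\<Sum>s\<in>S. \<Sum>t\<in>{t\<in>S. q t = q s}. \<bar>\<integral>\<omega>. Z s \<omega> * Z t \<omega> \<partial>M\<bar>)"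
proof -
  let ?S = "\<lambda>i. {s\<in>S. q s = i}"
  have fin: "finite (?S i)" for i using assms by simp
  have split: "(\<Sum>s\<in>S. f s) = (\<Sum>i\<in>Q. \<Sum>s\<in>?S i. f s)" for f :: "'b \<Rightarrow> real"
    by (rule sum.group[OF assms(1-3), symmetric])
  have sq: "(\<Sum>s\<in>A. Z s \<omega>)\<^sup>2 = (\<Sum>s\<in>A. \<Sum>t\<in>A. Z s \<omega> * Z t \<omega>)" for A \<omega>
    by (simp add: power2_eq_square sum_product)
  have intA: "integrable M (\<lambda>\<omega>. (\<Sum>s\<in>A. Z s \<omega>)\<^sup>2)" if "A \<subseteq> S" for A
    using that by (subst sq) (intro Bochner_Integration.integrable_sum int, auto)
  \<comment> \<open>Cauchy--Schwarz for the sum of the \<open>card Q\<close> cell sums, so that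
    products across different cells are never evaluated.\<close>
  have bound: "(\<Sum>s\<in>S. Z s \<omega>)\<^sup>2 \<le> card Q * (\<Sum>i\<in>Q. (\<Sum>s\<in>?S i. Z s \<omega>)\<^sup>2)" for \<omega>
    by (subst split, subst mult.commute) (rule sum_squared_le_sum_of_squares)
  have "(\<integral>\<omega>. (\<Sum>s\<in>S. Z s \<omega>)\<^sup>2 \<partial>M) \<le> (\<integral>\<omega>. card Q * (\<Sum>i\<in>Q. (\<Sum>s\<in>?S i. Z s \<omega>)\<^sup>2) \<partial>M)"
    by (intro integral_mono bound integrable_mult_right Bochner_Integration.integrable_sum intA) auto
  also have "\<dots> = card Q * (\<Sum>i\<in>Q. (\<integral>\<omega>. (\<Sum>s\<in>?S i. Z s \<omega>)\<^sup>2 \<partial>M))"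
    by (subst integral_mult_right_zero, subst Bochner_Integration.integral_sum) (auto intro: intA)
  also have "\<dots> \<le> card Q * (\<Sum>s\<in>S. \<Sum>t\<in>?S (q s). \<bar>\<integral>\<omega>. Z s \<omega> * Z t \<omega> \<partial>M\<bar>)"
  proof (rule mult_left_mono)
    have "(\<integral>\<omega>. (\<Sum>s\<in>?S i. Z s \<omega>)\<^sup>2 \<partial>M) = (\<Sum>s\<in>?S i. \<Sum>t\<in>?S i. \<integral>\<omega>. Z s \<omega> * Z t \<omega> \<partial>M)" for i
    proof -
      have "(\<integral>\<omega>. (\<Sum>s\<in>?S i. Z s \<omega>)\<^sup>2 \<partial>M) = (\<Sum>s\<in>?S i. \<integral>\<omega>. (\<Sum>t\<in>?S i. Z s \<omega> * Z t \<omega>) \<partial>M)"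
        by (subst sq, rule Bochner_Integration.integral_sum) (auto intro: int)
      also have "\<dots> = (\<Sum>s\<in>?S i. \<Sum>t\<in>?S i. \<integral>\<omega>. Z s \<omega> * Z t \<omega> \<partial>M)"
        by (rule sum.cong[OF refl], rule Bochner_Integration.integral_sum) (auto intro: int)
      finally show ?thesis .
    qed
    then have "(\<Sum>i\<in>Q. (\<integral>\<omega>. (\<Sum>s\<in>?S i. Z s \<omega>)\<^sup>2 \<partial>M)) =
        (\<Sum>i\<in>Q. \<Sum>s\<in>?S i. \<Sum>t\<in>?S i. \<integral>\<omega>. Z s \<omega> * Z t \<omega> \<partial>M)"
      by (simp only:)
    also have "\<dots> = (\<Sum>i\<in>Q. \<Sum>s\<in>?S i. \<Sum>t\<in>?S (q s). \<integral>\<omega>. Z s \<omega> * Z t \<omega> \<partial>M)"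
      by (intro sum.cong) auto
    also have "\<dots> = (\<Sum>s\<in>S. \<Sum>t\<in>?S (q s). \<integral>\<omega>. Z s \<omega> * Z t \<omega> \<partial>M)"
      by (rule split[symmetric])
    also have "\<dots> \<le> (\<Sum>s\<in>S. \<Sum>t\<in>?S (q s). \<bar>\<integral>\<omega>. Z s \<omega> * Z t \<omega> \<partial>M\<bar>)"
      by (intro sum_mono abs_ge_self)
    finally show "(\<Sum>i\<in>Q. (\<integral>\<omega>. (\<Sum>s\<in>?S i. Z s \<omega>)\<^sup>2 \<partial>M)) \<le>
      (\<Sum>s\<in>S. \<Sum>t\<in>?S (q s). \<bar>\<integral>\<omega>. Z s \<omega> * Z t \<omega> \<partial>M\<bar>)" .
  qed simp
  finally show ?thesis .
qed

subsection \<open>Powers of the discrete Laplacian\<close>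

text \<open>Derivatives along coordinate lines: the form in which \<open>remainder_cond\<close>
  supplies them and the mean value theorem consumes them.\<close>

definition has_partial :: "(real^'d \<Rightarrow> real) \<Rightarrow> 'd \<Rightarrow> real \<Rightarrow> real^'d \<Rightarrow> bool" where
  "has_partial f g D u \<longleftrightarrow> ((\<lambda>t. f (u + t *\<^sub>R axis g 1)) has_real_derivative D) (at 0)"

text \<open>Indexing the coefficients by the points themselves merges coinciding shifts, so that the
  central coefficient of a power of the Laplacian is meaningful.\<close>

definition finite_stencil :: "('b \<Rightarrow> bool) \<Rightarrow> (('b \<Rightarrow> real) \<Rightarrow> real) \<Rightarrow> bool" where
  "finite_stencil P \<Lambda> \<longleftrightarrow>
     (\<exists>J a. finite J \<and> (\<forall>v\<in>J. P v) \<and> (\<forall>F. \<Lambda> F = (\<Sum>v\<in>J. a v * F v)))"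

lemma finite_stencilE:
  assumes "finite_stencil P \<Lambda>"
  obtains J a where "finite J" "\<And>v. v \<in> J \<Longrightarrow> P v" "\<And>F. \<Lambda> F = (\<Sum>v\<in>J. a v * F v)"
  using assms unfolding finite_stencil_def by blast

lemma finite_stencilI:
  assumes "finite J" "\<And>v. v \<in> J \<Longrightarrow> P v" "\<And>F. \<Lambda> F = (\<Sum>v\<in>J. a v * F v)"
  shows "finite_stencil P \<Lambda>"
  using assms unfolding finite_stencil_def by blast

lemma finite_stencil_add:
  assumes "finite_stencil P \<Lambda>" "finite_stencil P \<Lambda>'"
  shows "finite_stencil P (\<lambda>F. \<Lambda> F + \<Lambda>' F)"
proof -
  obtain J a where J: "finite J" "\<And>v. v \<in> J \<Longrightarrow> P v" "\<And>F. \<Lambda> F = (\<Sum>v\<in>J. a v * F v)"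
    using finite_stencilE[OF assms(1)] by metis
  obtain J' a' where J': "finite J'" "\<And>v. v \<in> J' \<Longrightarrow> P v" "\<And>F. \<Lambda>' F = (\<Sum>v\<in>J'. a' v * F v)"
    using finite_stencilE[OF assms(2)] by metis
  let ?b = "\<lambda>v. (if v \<in> J then a v else 0) + (if v \<in> J' then a' v else 0)"
  have "\<Lambda> F + \<Lambda>' F = (\<Sum>v\<in>J\<union>J'. ?b v * F v)" for F
  proof -
    have "\<Lambda> F = (\<Sum>v\<in>J\<union>J'. (if v \<in> J then a v else 0) * F v)"
      unfolding J(3) using J(1) J'(1) by (intro sum.mono_neutral_cong_left) auto
    moreover have "\<Lambda>' F = (\<Sum>v\<in>J\<union>J'. (if v \<in> J' then a' v else 0) * F v)"
      unfolding J'(3) using J(1) J'(1) by (intro sum.mono_neutral_cong_left) auto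
    ultimately show ?thesis by (simp add: distrib_right sum.distrib)
  qed
  then show ?thesis using J(1,2) J'(1,2) by (intro finite_stencilI[of "J \<union> J'"]) auto
qed

lemma finite_stencil_scale:
  assumes "finite_stencil P \<Lambda>"
  shows "finite_stencil P (\<lambda>F. r * \<Lambda> F)"
proof -
  obtain J a where J: "finite J" "\<And>v. v \<in> J \<Longrightarrow> P v" "\<And>F. \<Lambda> F = (\<Sum>v\<in>J. a v * F v)"
    using finite_stencilE[OF assms] by metis
  have "r * \<Lambda> F = (\<Sum>v\<in>J. (r * a v) * F v)" for F
    unfolding J(3) by (simp add: sum_distrib_left mult.assoc)
  then show ?thesis using J(1,2) by (intro finite_stencilI)
qed

lemma finite_stencil_point: "P w \<Longrightarrow> finite_stencil P (\<lambda>F. F w)"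
  by (rule finite_stencilI[of "{w}" _ _ "\<lambda>_. 1"]) auto

lemma finite_stencil_sum:
  assumes "\<And>i. i \<in> I \<Longrightarrow> finite_stencil P (\<Lambda> i)"
  shows "finite_stencil P (\<lambda>F. \<Sum>i\<in>I. \<Lambda> i F)"
  using assms
proof (induction I rule: infinite_finite_induct)
  case (insert x I)
  then show ?case using finite_stencil_add[of P "\<Lambda> x" "\<lambda>F. \<Sum>i\<in>I. \<Lambda> i F"] by simp
qed (auto intro: finite_stencilI[of "{}"])

text \<open>One stencil serves all meshes, functions and base points. Hence expectations,
  derivatives and the limit of small mesh all pass through a fixed finite sum.\<close>

lemma laplacian_power_stencil:
  obtains J :: "(real^'d) set" and a
  where "finite J" "\<And>v. v \<in> J \<Longrightarrow> norm v \<le> real k" "\<And>v i. v \<in> J \<Longrightarrow> v $ i \<in> \<int>"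
    "\<And>h f u. (laplacian h ^^ k) f u = (\<Sum>v\<in>J. a v * f (u + h *\<^sub>R v)) / h ^ (2 * k)"
proof -
  have "\<exists>J a. finite J \<and> (\<forall>v\<in>J. norm v \<le> real k \<and> (\<forall>i. v $ i \<in> \<int>)) \<and>
     (\<forall>h f. \<forall>u::real^'d. (laplacian h ^^ k) f u = (\<Sum>v\<in>J. a v * f (u + h *\<^sub>R v)) / h ^ (2 * k))"
  proof (induction k)
    case 0
    show ?case by (intro exI[of _ "{0}"] exI[of _ "\<lambda>_. 1"]) auto
  next
    case (Suc k)
    then obtain J :: "(real^'d) set" and a
      where J: "finite J" "\<And>v. v \<in> J \<Longrightarrow> norm v \<le> real k" "\<And>v i. v \<in> J \<Longrightarrow> v $ i \<in> \<int>"
      and eq: "\<And>h f u. (laplacian h ^^ k) f u = (\<Sum>v\<in>J. a v * f (u + h *\<^sub>R v)) / h ^ (2 * k)"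
      by blast
    let ?P = "\<lambda>v::real^'d. norm v \<le> real (Suc k) \<and> (\<forall>i. v $ i \<in> \<int>)"
    let ?\<Lambda> = "\<lambda>F. \<Sum>v\<in>J. a v * (\<Sum>g\<in>UNIV. F (v + axis g 1) + F (v - axis g 1) + (- 2) * F v)"
    have "finite_stencil ?P ?\<Lambda>"
    proof (intro finite_stencil_sum finite_stencil_scale finite_stencil_add finite_stencil_point)
      fix v and g :: 'd assume v: "v \<in> J"
      have "norm (v + axis g 1) \<le> real (Suc k)"
        using J(2)[OF v] norm_triangle_ineq[of v "axis g 1"] by (simp add: norm_axis_1)
      moreover have "norm (v - axis g 1) \<le> real (Suc k)"
        using J(2)[OF v] norm_triangle_ineq4[of v "axis g 1"] by (simp add: norm_axis_1)
      ultimately show "?P (v + axis g 1)" "?P (v - axis g 1)" "?P v"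
        using J(2)[OF v] J(3)[OF v] by (auto simp: axis_def)
    qed
    then obtain J' a' where J': "finite J'" "\<And>v. v \<in> J' \<Longrightarrow> ?P v" "\<And>F. ?\<Lambda> F = (\<Sum>v\<in>J'. a' v * F v)"
      by (rule finite_stencilE) blast
    have "(laplacian h ^^ Suc k) f u = (\<Sum>v\<in>J'. a' v * f (u + h *\<^sub>R v)) / h ^ (2 * Suc k)" for h f u
    proof -
      have "(laplacian h ^^ Suc k) f u = (\<Sum>v\<in>J. a v * laplacian h f (u + h *\<^sub>R v)) / h ^ (2 * k)"
        by (simp only: funpow_Suc_right o_apply eq)
      also have "\<dots> = ?\<Lambda> (\<lambda>v. f (u + h *\<^sub>R v)) / h\<^sup>2 / h ^ (2 * k)"
      proof -
        have "laplacian h f (u + h *\<^sub>R v) = (\<Sum>g\<in>UNIV. f (u + h *\<^sub>R (v + axis g 1)) +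
            f (u + h *\<^sub>R (v - axis g 1)) + (- 2) * f (u + h *\<^sub>R v)) / h\<^sup>2" for v
          unfolding laplacian_def by (simp add: scaleR_add_right scaleR_diff_right add_diff_eq add.assoc)
        then have "(\<Sum>v\<in>J. a v * laplacian h f (u + h *\<^sub>R v)) = ?\<Lambda> (\<lambda>v. f (u + h *\<^sub>R v)) / h\<^sup>2"
          by (simp only: times_divide_eq_right flip: sum_divide_distrib)
        then show ?thesis by (simp only:)
      qed
      also have "\<dots> = ?\<Lambda> (\<lambda>v. f (u + h *\<^sub>R v)) / h ^ (2 * Suc k)"
        by (simp add: power2_eq_square)
      also have "?\<Lambda> (\<lambda>v. f (u + h *\<^sub>R v)) = (\<Sum>v\<in>J'. a' v * f (u + h *\<^sub>R v))"
        by (rule J'(3))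
      finally show ?thesis .
    qed
    with J'(1,2) show ?case by blast
  qed
  then show thesis using that by blast
qed

lemma laplacian_power_add:
  fixes u :: "real^'d"
  shows "(laplacian h ^^ k) (\<lambda>x. f x + g x) u = (laplacian h ^^ k) f u + (laplacian h ^^ k) g u"
proof -
  obtain J :: "(real^'d) set" and a
    where J: "finite J" "\<And>v. v \<in> J \<Longrightarrow> norm v \<le> real k" "\<And>v i. v \<in> J \<Longrightarrow> v $ i \<in> \<int>"
    and eq: "\<And>h f u. (laplacian h ^^ k) f u = (\<Sum>v\<in>J. a v * f (u + h *\<^sub>R v)) / h ^ (2 * k)"
    by (rule laplacian_power_stencil) (rule that)
  show ?thesis unfolding eq by (simp add: algebra_simps sum.distrib add_divide_distrib)
qed

lemma laplacian_power_cmult: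
  fixes u :: "real^'d"
  shows "(laplacian h ^^ k) (\<lambda>x. r * f x) u = r * (laplacian h ^^ k) f u"
proof -
  obtain J :: "(real^'d) set" and a
    where J: "finite J" "\<And>v. v \<in> J \<Longrightarrow> norm v \<le> real k" "\<And>v i. v \<in> J \<Longrightarrow> v $ i \<in> \<int>"
    and eq: "\<And>h f u. (laplacian h ^^ k) f u = (\<Sum>v\<in>J. a v * f (u + h *\<^sub>R v)) / h ^ (2 * k)"
    by (rule laplacian_power_stencil) (rule that)
  show ?thesis unfolding eq by (simp add: sum_distrib_left mult_ac)
qed

lemma laplacian_power_const:
  fixes u :: "real^'d"
  assumes "0 < k"
  shows "(laplacian h ^^ k) (\<lambda>_. r) u = 0"
proof -
  have "laplacian h (\<lambda>_::real^'d. r) = (\<lambda>_. 0)" by (auto simp: laplacian_def)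
  moreover obtain j where "k = Suc j" using assms gr0_implies_Suc by blast
  moreover have "(laplacian h ^^ j) (\<lambda>_. 0 * 0) u = 0 * (laplacian h ^^ j) (\<lambda>_. 0) u"
    by (rule laplacian_power_cmult)
  ultimately show ?thesis by (simp only: funpow_Suc_right o_apply) simp
qed

text \<open>The stencil is symmetric about its centre. Needed because the second argument enters a
  stationary covariance with a minus sign.\<close>

lemma laplacian_power_reflect:
  "(laplacian h ^^ k) (\<lambda>t. f (s - t)) u = (laplacian h ^^ k) f (s - u)"
proof -
  have one: "laplacian h (\<lambda>t. f (s - t)) = (\<lambda>t. laplacian h f (s - t))" for f
    by (auto simp: laplacian_def algebra_simps)
  have "(laplacian h ^^ k) (\<lambda>t. f (s - t)) = (\<lambda>t. (laplacian h ^^ k) f (s - t))"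
    by (induction k) (auto simp: one)
  then show ?thesis by metis
qed

lemma laplacian_power_translate:
  "(laplacian h ^^ k) (\<lambda>t. f (t - s)) u = (laplacian h ^^ k) f (u - s)"
proof -
  have one: "laplacian h (\<lambda>t. f (t - s)) = (\<lambda>t. laplacian h f (t - s))" for f
    by (auto simp: laplacian_def algebra_simps)
  have "(laplacian h ^^ k) (\<lambda>t. f (t - s)) = (\<lambda>t. (laplacian h ^^ k) f (t - s))"
    by (induction k) (auto simp: one)
  then show ?thesis by metis
qed

text \<open>The reach \<open>k * h\<close> of the stencil is what makes assumptions on a small ball,
  or on the observed cube, sufficient.\<close>

lemma laplacian_power_cong:
  fixes u :: "real^'d"
  assumes "0 \<le> h" "\<And>v. norm (v - u) \<le> real k * h \<Longrightarrow> f v = g v"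
  shows "(laplacian h ^^ k) f u = (laplacian h ^^ k) g u"
proof -
  obtain J :: "(real^'d) set" and a
    where J: "finite J" "\<And>v. v \<in> J \<Longrightarrow> norm v \<le> real k" "\<And>v i. v \<in> J \<Longrightarrow> v $ i \<in> \<int>"
    and eq: "\<And>h f u. (laplacian h ^^ k) f u = (\<Sum>v\<in>J. a v * f (u + h *\<^sub>R v)) / h ^ (2 * k)"
    by (rule laplacian_power_stencil) (rule that)
  have "f (u + h *\<^sub>R v) = g (u + h *\<^sub>R v)" if "v \<in> J" for v
    using J(2) that assms(1) by (intro assms(2)) (simp add: mult.commute mult_left_mono)
  then show ?thesis unfolding eq by simp
qed

text \<open>The crude estimate for stencils close to the origin, where derivatives are not
  controlled uniformly. The constant depends on \<open>k\<close> and the dimension only.\<close>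

lemma laplacian_power_sup_bound:
  "\<exists>A\<ge>0. \<forall>h>0. \<forall>f u. \<forall>B\<ge>0. (\<forall>v. norm (v - u) \<le> real k * h \<longrightarrow> \<bar>f v\<bar> \<le> B) \<longrightarrow>
     \<bar>(laplacian h ^^ k) f (u::real^'d)\<bar> \<le> A * B / h ^ (2 * k)"
proof -
  obtain J :: "(real^'d) set" and a
    where J: "finite J" "\<And>v. v \<in> J \<Longrightarrow> norm v \<le> real k" "\<And>v i. v \<in> J \<Longrightarrow> v $ i \<in> \<int>"
    and eq: "\<And>h f u. (laplacian h ^^ k) f u = (\<Sum>v\<in>J. a v * f (u + h *\<^sub>R v)) / h ^ (2 * k)"
    by (rule laplacian_power_stencil) (rule that)
  show ?thesis
  proof (intro exI[of _ "\<Sum>v\<in>J. \<bar>a v\<bar>"] conjI allI impI sum_nonneg abs_ge_zero)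
    fix h B :: real and f and u :: "real^'d" assume h: "0 < h" and B: "\<forall>v. norm (v - u) \<le> real k * h \<longrightarrow> \<bar>f v\<bar> \<le> B"
    have "\<bar>\<Sum>v\<in>J. a v * f (u + h *\<^sub>R v)\<bar> \<le> (\<Sum>v\<in>J. \<bar>a v\<bar> * B)"
    proof (rule order_trans[OF sum_abs sum_mono])
      fix v assume "v \<in> J"
      then have "\<bar>f (u + h *\<^sub>R v)\<bar> \<le> B"
        using J(2) h by (intro B[rule_format]) (simp add: mult.commute mult_left_mono)
      then show "\<bar>a v * f (u + h *\<^sub>R v)\<bar> \<le> \<bar>a v\<bar> * B" by (simp add: abs_mult mult_left_mono)
    qed
    then show "\<bar>(laplacian h ^^ k) f u\<bar> \<le> (\<Sum>v\<in>J. \<bar>a v\<bar>) * B / h ^ (2 * k)"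
      unfolding eq using h by (simp add: abs_divide sum_distrib_right divide_right_mono)
  qed
qed

section \<open>Mean value bounds for powers of the Laplacian\<close>

lemma laplacian_power_has_partial:
  fixes u :: "real^'d"
  assumes "0 \<le> h" "\<And>v. norm (v - u) \<le> real k * h \<Longrightarrow> has_partial f g (f' v) v"
  shows "has_partial ((laplacian h ^^ k) f) g ((laplacian h ^^ k) f' u) u"
proof -
  obtain J :: "(real^'d) set" and a
    where J: "finite J" "\<And>v. v \<in> J \<Longrightarrow> norm v \<le> real k" "\<And>v i. v \<in> J \<Longrightarrow> v $ i \<in> \<int>"
    and eq: "\<And>h f u. (laplacian h ^^ k) f u = (\<Sum>v\<in>J. a v * f (u + h *\<^sub>R v)) / h ^ (2 * k)"
    by (rule laplacian_power_stencil) (rule that)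
  have "((\<lambda>t. f (u + t *\<^sub>R axis g 1 + h *\<^sub>R v)) has_real_derivative f' (u + h *\<^sub>R v)) (at 0)" if "v \<in> J" for v
  proof -
    have "has_partial f g (f' (u + h *\<^sub>R v)) (u + h *\<^sub>R v)"
      using J(2) that assms(1) by (intro assms(2)) (simp add: mult.commute mult_left_mono)
    then show ?thesis by (simp add: has_partial_def add_ac)
  qed
  then show ?thesis
    unfolding eq has_partial_def
    by (intro DERIV_cdivide DERIV_sum DERIV_cmult) auto
qed

text \<open>The mean value theorem is applied to the symmetrized function
  \<open>\<phi> t + \<phi> (- t)\<close> and then to \<open>\<phi>'\<close> on the resulting
  symmetric interval, whose length below \<open>2 * h\<close> is the source of the factor 2.\<close>

lemma second_difference_bound:
  fixes \<phi> \<phi>' \<phi>'' :: "real \<Rightarrow> real"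
  assumes h: "0 < h"
    and d1: "\<And>t. \<bar>t\<bar> \<le> h \<Longrightarrow> (\<phi> has_real_derivative \<phi>' t) (at t)"
    and d2: "\<And>t. \<bar>t\<bar> \<le> h \<Longrightarrow> (\<phi>' has_real_derivative \<phi>'' t) (at t)"
    and M: "\<And>t. \<bar>t\<bar> \<le> h \<Longrightarrow> \<bar>\<phi>'' t\<bar> \<le> B"
  shows "\<bar>\<phi> h + \<phi> (- h) - 2 * \<phi> 0\<bar> \<le> 2 * h\<^sup>2 * B"
proof -
  have B: "0 \<le> B" using M[of 0] h by auto
  have "((\<lambda>t. \<phi> t + \<phi> (- t)) has_real_derivative \<phi>' t - \<phi>' (- t)) (at t)" if "\<bar>t\<bar> \<le> h" for t
    using DERIV_add[OF d1[OF that] DERIV_chain2[where g = uminus, OF d1 DERIV_minus[OF DERIV_ident]]] that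
    by simp
  with MVT2[of 0 h "\<lambda>t. \<phi> t + \<phi> (- t)" "\<lambda>t. \<phi>' t - \<phi>' (- t)"] h
  obtain \<xi> where \<xi>: "0 < \<xi>" "\<xi> < h" "\<phi> h + \<phi> (- h) - 2 * \<phi> 0 = h * (\<phi>' \<xi> - \<phi>' (- \<xi>))"
    by auto
  with MVT2[of "-\<xi>" \<xi> \<phi>' \<phi>''] d2
  obtain \<eta> where \<eta>: "- \<xi> < \<eta>" "\<eta> < \<xi>" "\<phi>' \<xi> - \<phi>' (- \<xi>) = (\<xi> - - \<xi>) * \<phi>'' \<eta>"
    by auto
  have "\<bar>\<phi> h + \<phi> (- h) - 2 * \<phi> 0\<bar> = h * (2 * \<xi> * \<bar>\<phi>'' \<eta>\<bar>)"
    using \<xi> h by (simp add: \<eta>(3) abs_mult)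
  also have "\<dots> \<le> h * (2 * h * B)"
    using \<xi> \<eta> h B by (intro mult_left_mono mult_mono M) auto
  finally show ?thesis by (simp add: power2_eq_square mult_ac)
qed

text \<open>Recursion over one derivative at a time replaces multi-indices. The weight
  \<open>b\<close> bounds the derivatives of order exactly \<open>n\<close>; the lower ones merely
  exist.\<close>

fun partials_bounded :: "nat \<Rightarrow> (real^'d) set \<Rightarrow> (real^'d \<Rightarrow> real) \<Rightarrow> (real^'d \<Rightarrow> real) \<Rightarrow> bool" where
  "partials_bounded 0 U b f \<longleftrightarrow> (\<forall>u\<in>U. \<bar>f u\<bar> \<le> b u)"
| "partials_bounded (Suc n) U b f \<longleftrightarrow>
     (\<forall>g. \<exists>f'. (\<forall>u\<in>U. has_partial f g (f' u) u) \<and> partials_bounded n U b f')"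

lemma partials_bounded_mono:
  "partials_bounded n U b f \<Longrightarrow> (\<And>u. u \<in> U \<Longrightarrow> b u \<le> b' u) \<Longrightarrow> partials_bounded n U b' f"
proof (induction n arbitrary: f)
  case 0
  then show ?case by force
next
  case (Suc n)
  have "\<exists>f'. (\<forall>u\<in>U. has_partial f g (f' u) u) \<and> partials_bounded n U b' f'" for g
    using Suc.prems(1) Suc.IH[OF _ Suc.prems(2)] by (simp only: partials_bounded.simps) blast
  then show ?case by simp
qed

text \<open>Powers of the Laplacian commute with partial derivatives, so a second difference of
  \<open>laplacian h ^^ k\<close> applied to \<open>f\<close> is controlled by the same operator
  applied to a second partial of \<open>f\<close>, to which the induction hypothesis applies. Each
  step contributes 2 for every direction, and its \<open>h\<^sup>2\<close> cancels the
  normalization.\<close>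

lemma laplacian_power_partials_bound:
  fixes f :: "real^'d \<Rightarrow> real"
  assumes "0 < h" "partials_bounded (2 * k) U b f"
    and "\<And>v. norm (v - u) \<le> real k * h \<Longrightarrow> v \<in> U \<and> b v \<le> B"
  shows "\<bar>(laplacian h ^^ k) f u\<bar> \<le> (2 * real CARD('d)) ^ k * B"
  using assms(2,3)
proof (induction k arbitrary: f u)
  case 0
  from 0(2)[of u] 0(1) show ?case by (auto intro: order_trans)
next
  case (Suc k)
  let ?L = "laplacian h ^^ k" and ?M = "(2 * real CARD('d)) ^ k * B"
  have "\<bar>?L f (u + h *\<^sub>R axis g 1) + ?L f (u - h *\<^sub>R axis g 1) - 2 * ?L f u\<bar> \<le> 2 * h\<^sup>2 * ?M" for g
  proof -
    from Suc.prems(1) obtain f1 f2 where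
      f1: "\<And>u. u \<in> U \<Longrightarrow> has_partial f g (f1 u) u" and
      f2: "\<And>u. u \<in> U \<Longrightarrow> has_partial f1 g (f2 u) u" and bf2: "partials_bounded (2 * k) U b f2"
      unfolding mult_Suc_right partials_bounded.simps add_2_eq_Suc by metis
    \<comment> \<open>The outermost Laplacian moves the base point by at most \<open>h\<close>,
      which uses up one unit of the radius \<open>Suc k * h\<close>.\<close>
    have near: "v \<in> U \<and> b v \<le> B" if "\<bar>t\<bar> \<le> h" "norm (v - (u + t *\<^sub>R axis g 1)) \<le> real k * h" for t v
    proof (rule Suc.prems(2))
      have "norm (v - u) \<le> norm (v - (u + t *\<^sub>R axis g 1)) + norm (t *\<^sub>R axis g 1 :: real^'d)"
        using norm_triangle_ineq[of "v - (u + t *\<^sub>R axis g 1)" "t *\<^sub>R axis g 1"] by simp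
      then show "norm (v - u) \<le> real (Suc k) * h" using that by (simp add: norm_axis_1 algebra_simps)
    qed
    have line: "((\<lambda>t. F (u + t *\<^sub>R axis g 1)) has_real_derivative D) (at t)"
      if "has_partial F g D (u + t *\<^sub>R axis g 1)" for F D t
    proof -
      have "((\<lambda>s. F (u + (s + t) *\<^sub>R axis g 1)) has_real_derivative D) (at 0)"
        using that by (simp add: has_partial_def algebra_simps)
      then show ?thesis using DERIV_shift[of "\<lambda>t. F (u + t *\<^sub>R axis g 1)" D 0 t] by simp
    qed
    have "\<bar>?L f (u + h *\<^sub>R axis g 1) + ?L f (u + (- h) *\<^sub>R axis g 1) - 2 * ?L f (u + 0 *\<^sub>R axis g 1)\<bar>
        \<le> 2 * h\<^sup>2 * ?M"
    proof (rule second_difference_bound[OF assms(1), where \<phi> = "\<lambda>t. ?L f (u + t *\<^sub>R axis g 1)"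
          and \<phi>' = "\<lambda>t. ?L f1 (u + t *\<^sub>R axis g 1)" and \<phi>'' = "\<lambda>t. ?L f2 (u + t *\<^sub>R axis g 1)"])
      fix t assume t: "\<bar>t\<bar> \<le> h"
      show "((\<lambda>t. ?L f (u + t *\<^sub>R axis g 1)) has_real_derivative ?L f1 (u + t *\<^sub>R axis g 1)) (at t)"
        by (intro line laplacian_power_has_partial f1) (use assms(1) near[OF t] in auto)
      show "((\<lambda>t. ?L f1 (u + t *\<^sub>R axis g 1)) has_real_derivative ?L f2 (u + t *\<^sub>R axis g 1)) (at t)"
        by (intro line laplacian_power_has_partial f2) (use assms(1) near[OF t] in auto)
      show "\<bar>?L f2 (u + t *\<^sub>R axis g 1)\<bar> \<le> ?M"
        by (rule Suc.IH[OF bf2 near[OF t]])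
    qed
    then show ?thesis by simp
  qed
  then have "\<bar>\<Sum>g\<in>UNIV. ?L f (u + h *\<^sub>R axis g 1) + ?L f (u - h *\<^sub>R axis g 1) - 2 * ?L f u\<bar>
      \<le> (\<Sum>g\<in>(UNIV::'d set). 2 * h\<^sup>2 * ?M)"
    by (intro order_trans[OF sum_abs sum_mono]) auto
  then have "\<bar>laplacian h (?L f) u\<bar> \<le> real CARD('d) * (2 * h\<^sup>2 * ?M) / h\<^sup>2"
    unfolding laplacian_def[of h "?L f"] abs_divide abs_power2 sum_constant
    by (rule divide_right_mono) simp
  then show ?case using assms(1) by (simp add: mult_ac)
qed

subsection \<open>Functions with homogeneously bounded derivatives\<close>

lemma has_partial_cong:
  assumes "open U" "u \<in> U" "\<And>v. v \<in> U \<Longrightarrow> f v = f' v"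
  shows "has_partial f g D u \<longleftrightarrow> has_partial f' g D u"
proof -
  have "((\<lambda>t. u + t *\<^sub>R axis g 1) \<longlongrightarrow> u + 0 *\<^sub>R axis g 1) (nhds (0::real))"
    by (intro tendsto_intros filterlim_ident)
  then have "\<forall>\<^sub>F t in nhds (0::real). u + t *\<^sub>R axis g 1 \<in> U"
    using assms(1,2) by (intro topological_tendstoD[where S = U]) auto
  then have "\<forall>\<^sub>F t in nhds 0. f (u + t *\<^sub>R axis g 1) = f' (u + t *\<^sub>R axis g 1)"
    by eventually_elim (rule assms(3))
  then show ?thesis unfolding has_partial_def by (intro DERIV_cong_ev) auto
qed

lemma has_partial_add:
  "has_partial f g D u \<Longrightarrow> has_partial f' g D' u \<Longrightarrow> has_partial (\<lambda>u. f u + f' u) g (D + D') u"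
  unfolding has_partial_def by (rule DERIV_add)

lemma has_partial_mult:
  "has_partial f g D u \<Longrightarrow> has_partial f' g D' u \<Longrightarrow>
    has_partial (\<lambda>u. f u * f' u) g (D * f' u + f u * D') u"
  unfolding has_partial_def by (drule (1) DERIV_mult) (simp add: mult.commute)

lemma has_partial_const: "has_partial (\<lambda>_. r) g 0 u"
  unfolding has_partial_def by simp

lemma has_partial_coord: "has_partial (\<lambda>u. u $ i) g (if i = g then 1 else 0) u"
  unfolding has_partial_def by (auto intro!: derivative_eq_intros simp: axis_def)

text \<open>The factor u_g / |u| is written with \<open>powr - 1\<close> so that it fits the
  calculus of homogeneous bounds below.\<close>

lemma has_partial_radial:
  assumes "u \<noteq> 0" "(\<phi> has_real_derivative D) (at (norm u))"
  shows "has_partial (\<lambda>u. \<phi> (norm u)) g (D * (u $ g * norm u powr - 1)) u"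
proof -
  have "((\<lambda>t. norm (u + t *\<^sub>R axis g 1)) has_derivative (\<lambda>t. (t *\<^sub>R axis g 1) \<bullet> sgn u)) (at 0)"
    by (rule has_derivative_eq_rhs, rule has_derivative_norm[THEN has_derivative_compose[rotated]])
       (use assms(1) in \<open>auto intro!: derivative_eq_intros\<close>)
  moreover have "(\<lambda>t. (t *\<^sub>R axis g 1) \<bullet> sgn u) = (*) (u $ g * norm u powr - 1)"
    using assms(1) by (auto simp: sgn_vec_def inner_axis' powr_minus sgn_div_norm fun_eq_iff)
  ultimately have "((\<lambda>t. norm (u + t *\<^sub>R axis g 1)) has_real_derivative u $ g * norm u powr - 1) (at 0)"
    by (simp add: has_field_derivative_def)
  from DERIV_chain2[where f = \<phi>, OF _ this] assms(2) show ?thesis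
    unfolding has_partial_def by simp
qed

definition punctured_ball :: "real \<Rightarrow> (real^'d) set" where
  "punctured_ball \<rho> = {u. u \<noteq> 0 \<and> norm u < \<rho>}"

lemma open_punctured_ball: "open (punctured_ball \<rho> :: (real^'d) set)"
proof -
  have "(punctured_ball \<rho> :: (real^'d) set) = ball 0 \<rho> - {0}" by (auto simp: punctured_ball_def)
  then show ?thesis by (simp add: open_delete)
qed

text \<open>Derivatives up to order \<open>n\<close> near the origin behave like those of a function homogeneous of
  degree \<open>a\<close>.\<close>
fun homogeneous_bounded :: "nat \<Rightarrow> real \<Rightarrow> real \<Rightarrow> (real^'d \<Rightarrow> real) \<Rightarrow> bool" where
  "homogeneous_bounded 0 \<rho> a f \<longleftrightarrow> (\<exists>C. \<forall>u\<in>punctured_ball \<rho>. \<bar>f u\<bar> \<le> C * norm u powr a)"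
| "homogeneous_bounded (Suc n) \<rho> a f \<longleftrightarrow> (\<exists>C. \<forall>u\<in>punctured_ball \<rho>. \<bar>f u\<bar> \<le> C * norm u powr a) \<and>
     (\<forall>g. \<exists>f'. (\<forall>u\<in>punctured_ball \<rho>. has_partial f g (f' u) u) \<and> homogeneous_bounded n \<rho> (a - 1) f')"

lemma homogeneous_boundedI:
  fixes f :: "real^'d \<Rightarrow> real"
  assumes "\<And>u. u \<in> punctured_ball \<rho> \<Longrightarrow> \<bar>f u\<bar> \<le> C * norm u powr a"
    and "\<And>j g. n = Suc j \<Longrightarrow>
      \<exists>f'. (\<forall>u\<in>punctured_ball \<rho>. has_partial f g (f' u) u) \<and> homogeneous_bounded j \<rho> (a - 1) f'"
  shows "homogeneous_bounded n \<rho> a f"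
proof -
  have "\<exists>C. \<forall>u\<in>punctured_ball \<rho>. \<bar>f u\<bar> \<le> C * norm u powr a" using assms(1) by blast
  then show ?thesis using assms(2) by (cases n) simp_all
qed

lemma homogeneous_bounded_bound:
  fixes f :: "real^'d \<Rightarrow> real"
  assumes "homogeneous_bounded n \<rho> a f"
  obtains C where "0 \<le> C" "\<And>u. u \<in> punctured_ball \<rho> \<Longrightarrow> \<bar>f u\<bar> \<le> C * norm u powr a"
proof -
  obtain C where C: "\<forall>u\<in>punctured_ball \<rho>. \<bar>f u\<bar> \<le> C * norm u powr a"
    using assms by (cases n) auto
  show thesis
  proof (rule that[of "\<bar>C\<bar>"])
    fix u :: "real^'d" assume "u \<in> punctured_ball \<rho>"
    then have "\<bar>f u\<bar> \<le> C * norm u powr a" using C by blast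
    also have "\<dots> \<le> \<bar>C\<bar> * norm u powr a" by (intro mult_right_mono) auto
    finally show "\<bar>f u\<bar> \<le> \<bar>C\<bar> * norm u powr a" .
  qed simp
qed

lemma homogeneous_bounded_SucD:
  fixes f :: "real^'d \<Rightarrow> real"
  shows "homogeneous_bounded (Suc n) \<rho> a f \<Longrightarrow> homogeneous_bounded n \<rho> a f"
proof (induction n arbitrary: f a)
  case (Suc n)
  have "\<exists>f'. (\<forall>u\<in>punctured_ball \<rho>. has_partial f g (f' u) u) \<and> homogeneous_bounded n \<rho> (a - 1) f'" for g
    using Suc.prems Suc.IH by (simp only: homogeneous_bounded.simps(2)[of "Suc n"]) blast
  then show ?case using Suc.prems by simp
qed simp

lemma homogeneous_bounded_cong:
  fixes f f' :: "real^'d \<Rightarrow> real"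
  assumes "\<And>u. u \<in> punctured_ball \<rho> \<Longrightarrow> f u = f' u" "homogeneous_bounded n \<rho> a f"
  shows "homogeneous_bounded n \<rho> a f'"
proof -
  have "has_partial f' g D u" if "has_partial f g D u" "u \<in> punctured_ball \<rho>" for g D u
    using that has_partial_cong[of "punctured_ball \<rho>" u f f' g D] open_punctured_ball assms(1) by blast
  then show ?thesis using assms by (cases n) (simp, simp, blast)
qed

lemma homogeneous_bounded_add:
  fixes f f' :: "real^'d \<Rightarrow> real"
  shows "homogeneous_bounded n \<rho> a f \<Longrightarrow> homogeneous_bounded n \<rho> a f' \<Longrightarrow>
    homogeneous_bounded n \<rho> a (\<lambda>u. f u + f' u)"
proof -
  have bound: "\<exists>C. \<forall>u\<in>punctured_ball \<rho>. \<bar>f u + f' u\<bar> \<le> C * norm u powr a"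
    if f: "homogeneous_bounded n \<rho> a f" "homogeneous_bounded n \<rho> a f'"
    for n a and f f' :: "real^'d \<Rightarrow> real"
  proof -
    obtain C where C: "\<And>u. u \<in> punctured_ball \<rho> \<Longrightarrow> \<bar>f u\<bar> \<le> C * norm u powr a"
      using homogeneous_bounded_bound[OF f(1)] by blast
    obtain C' where C': "\<And>u. u \<in> punctured_ball \<rho> \<Longrightarrow> \<bar>f' u\<bar> \<le> C' * norm u powr a"
      using homogeneous_bounded_bound[OF f(2)] by blast
    have "\<bar>f u + f' u\<bar> \<le> (C + C') * norm u powr a" if "u \<in> punctured_ball \<rho>" for u
      using C[OF that] C'[OF that] unfolding distrib_right by linarith
    then show ?thesis by blast
  qed
  show "homogeneous_bounded n \<rho> a f \<Longrightarrow> homogeneous_bounded n \<rho> a f' \<Longrightarrow>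
      homogeneous_bounded n \<rho> a (\<lambda>u. f u + f' u)"
  proof (induction n arbitrary: f f' a)
    case 0
    then show ?case using bound[OF 0] by simp
  next
    case (Suc n)
    have "\<exists>D. (\<forall>u\<in>punctured_ball \<rho>. has_partial (\<lambda>u. f u + f' u) g (D u) u) \<and>
        homogeneous_bounded n \<rho> (a - 1) D" for g
    proof -
      obtain D where D: "\<forall>u\<in>punctured_ball \<rho>. has_partial f g (D u) u" "homogeneous_bounded n \<rho> (a - 1) D"
        using Suc.prems(1) unfolding homogeneous_bounded.simps by blast
      obtain D' where D': "\<forall>u\<in>punctured_ball \<rho>. has_partial f' g (D' u) u" "homogeneous_bounded n \<rho> (a - 1) D'"
        using Suc.prems(2) unfolding homogeneous_bounded.simps by blast
      show ?thesis
        by (rule exI[of _ "\<lambda>u. D u + D' u"])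
          (use D(1) D'(1) Suc.IH[OF D(2) D'(2)] in \<open>auto intro: has_partial_add\<close>)
    qed
    then show ?case using bound[OF Suc.prems] by simp
  qed
qed

lemma homogeneous_bounded_mult:
  fixes f f' :: "real^'d \<Rightarrow> real"
  shows "homogeneous_bounded n \<rho> a f \<Longrightarrow> homogeneous_bounded n \<rho> b f' \<Longrightarrow>
    homogeneous_bounded n \<rho> (a + b) (\<lambda>u. f u * f' u)"
proof -
  have bound: "\<exists>C. \<forall>u\<in>punctured_ball \<rho>. \<bar>f u * f' u\<bar> \<le> C * norm u powr (a + b)"
    if f: "homogeneous_bounded n \<rho> a f" "homogeneous_bounded n \<rho> b f'"
    for n a b and f f' :: "real^'d \<Rightarrow> real"
  proof -
    obtain C where C: "0 \<le> C" "\<And>u. u \<in> punctured_ball \<rho> \<Longrightarrow> \<bar>f u\<bar> \<le> C * norm u powr a"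
      using homogeneous_bounded_bound[OF f(1)] by blast
    obtain C' where C': "\<And>u. u \<in> punctured_ball \<rho> \<Longrightarrow> \<bar>f' u\<bar> \<le> C' * norm u powr b"
      using homogeneous_bounded_bound[OF f(2)] by blast
    have "\<bar>f u * f' u\<bar> \<le> (C * C') * norm u powr (a + b)" if "u \<in> punctured_ball \<rho>" for u
    proof -
      have "\<bar>f u * f' u\<bar> \<le> (C * norm u powr a) * (C' * norm u powr b)"
        unfolding abs_mult using C C' that by (intro mult_mono) auto
      then show ?thesis by (simp add: powr_add mult_ac)
    qed
    then show ?thesis by blast
  qed
  show "homogeneous_bounded n \<rho> a f \<Longrightarrow> homogeneous_bounded n \<rho> b f' \<Longrightarrow>
      homogeneous_bounded n \<rho> (a + b) (\<lambda>u. f u * f' u)"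
  proof (induction n arbitrary: f f' a b)
    case 0
    then show ?case using bound[OF 0] by simp
  next
    case (Suc n)
    have "\<exists>D. (\<forall>u\<in>punctured_ball \<rho>. has_partial (\<lambda>u. f u * f' u) g (D u) u) \<and>
        homogeneous_bounded n \<rho> (a + b - 1) D" for g
    proof -
      obtain D where D: "\<forall>u\<in>punctured_ball \<rho>. has_partial f g (D u) u" "homogeneous_bounded n \<rho> (a - 1) D"
        using Suc.prems(1) unfolding homogeneous_bounded.simps by blast
      obtain D' where D': "\<forall>u\<in>punctured_ball \<rho>. has_partial f' g (D' u) u" "homogeneous_bounded n \<rho> (b - 1) D'"
        using Suc.prems(2) unfolding homogeneous_bounded.simps by blast
      have "homogeneous_bounded n \<rho> (a - 1 + b) (\<lambda>u. D u * f' u)"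
        using Suc.IH[OF D(2) homogeneous_bounded_SucD[OF Suc.prems(2)]] .
      moreover have "homogeneous_bounded n \<rho> (a + (b - 1)) (\<lambda>u. f u * D' u)"
        using Suc.IH[OF homogeneous_bounded_SucD[OF Suc.prems(1)] D'(2)] .
      ultimately have "homogeneous_bounded n \<rho> (a + b - 1) (\<lambda>u. D u * f' u + f u * D' u)"
        by (intro homogeneous_bounded_add) (simp_all add: algebra_simps)
      then show ?thesis
        by (intro exI[of _ "\<lambda>u. D u * f' u + f u * D' u"])
          (use D(1) D'(1) in \<open>auto intro: has_partial_mult\<close>)
    qed
    then show ?case using bound[OF Suc.prems] by simp
  qed
qed

lemma homogeneous_bounded_zero: "homogeneous_bounded n \<rho> a (\<lambda>_. 0)"
proof (induction n arbitrary: a)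
  case 0
  show ?case by (auto intro: exI[of _ 0])
next
  case (Suc n)
  then show ?case using has_partial_const[of 0] by (auto intro!: exI[of _ 0] exI[of _ "\<lambda>_. 0"])
qed

lemma homogeneous_bounded_const: "homogeneous_bounded n \<rho> 0 (\<lambda>_. r)"
proof (rule homogeneous_boundedI[where C = "\<bar>r\<bar>"])
  show "\<bar>r\<bar> \<le> \<bar>r\<bar> * norm u powr 0" if "u \<in> punctured_ball \<rho>" for u :: "real^'a"
    using that by (simp add: punctured_ball_def)
qed (auto intro: has_partial_const homogeneous_bounded_zero)

lemma homogeneous_bounded_coord: "homogeneous_bounded n \<rho> 1 (\<lambda>u. u $ i)"
proof (rule homogeneous_boundedI[where C = 1])
  show "\<bar>u $ i\<bar> \<le> 1 * norm u powr 1" for u :: "real^'a"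
    using component_le_norm_cart[of u i] by simp
  show "\<exists>f'. (\<forall>u\<in>punctured_ball \<rho>. has_partial (\<lambda>u. u $ i) g (f' u) u) \<and>
      homogeneous_bounded j \<rho> (1 - 1) f'" for j g
    by (rule exI[of _ "\<lambda>_. if i = g then 1 else 0"])
       (simp add: has_partial_coord homogeneous_bounded_const)
qed

lemma homogeneous_bounded_norm_powr: "homogeneous_bounded n \<rho> q (\<lambda>u::real^'d. norm u powr q)"
proof (induction n arbitrary: q)
  case 0
  show ?case by (auto intro: exI[of _ 1])
next
  case (Suc n)
  have "has_partial (\<lambda>u. norm u powr q) g (q * (norm u powr (q - 2) * u $ g)) u"
    if "u \<in> punctured_ball \<rho>" for u :: "real^'d" and g
  proof -
    have u: "u \<noteq> 0" using that by (simp add: punctured_ball_def)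
    have "has_partial (\<lambda>u. norm u powr q) g ((q * norm u powr (q - 1)) * (u $ g * norm u powr - 1)) u"
      using u by (intro has_partial_radial) (auto intro!: derivative_eq_intros simp: powr_diff)
    moreover have "norm u powr (q - 2) = norm u powr (q - 1) * norm u powr - 1"
      using powr_add[of "norm u" "q - 1" "- 1"] by simp
    ultimately show ?thesis by (simp add: mult_ac)
  qed
  moreover have "homogeneous_bounded n \<rho> (q - 1) (\<lambda>u::real^'d. q * (norm u powr (q - 2) * u $ g))" for g
    using homogeneous_bounded_mult[OF homogeneous_bounded_const[of n \<rho> q] homogeneous_bounded_mult[OF
        Suc.IH[of "q - 2"] homogeneous_bounded_coord[of n \<rho> g]]]
    by (simp add: algebra_simps)
  ultimately have "\<exists>f'. (\<forall>u\<in>punctured_ball \<rho>. has_partial (\<lambda>u::real^'d. norm u powr q) g (f' u) u) \<and>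
      homogeneous_bounded n \<rho> (q - 1) f'" for g
    by (intro exI[of _ "\<lambda>u. q * (norm u powr (q - 2) * u $ g)"]) blast
  then show ?case by (intro homogeneous_boundedI[where C = 1]) auto
qed

text \<open>Differentiating \<open>E k (norm u)\<close> produces \<open>E (Suc k) (norm u)\<close>
  times the direction cosine, which is homogeneous of degree 0. The induction therefore runs along
  the whole chain of radial derivatives.\<close>

lemma homogeneous_bounded_radial:
  fixes E :: "nat \<Rightarrow> real \<Rightarrow> real"
  assumes "\<And>j t. j < N \<Longrightarrow> 0 < t \<Longrightarrow> t < \<rho> \<Longrightarrow> (E j has_real_derivative E (Suc j) t) (at t)"
    and "\<And>j. j \<le> N \<Longrightarrow> \<exists>C. \<forall>t. 0 < t \<and> t < \<rho> \<longrightarrow> \<bar>E j t\<bar> \<le> C * t powr (a - real j)"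
    and "k + n \<le> N"
  shows "homogeneous_bounded n \<rho> (a - real k) (\<lambda>u::real^'d. E k (norm u))"
proof -
  have bound: "\<exists>C. \<forall>u\<in>punctured_ball \<rho> :: (real^'d) set. \<bar>E k (norm u)\<bar> \<le> C * norm u powr (a - real k)" if k: "k \<le> N" for k
  proof -
    obtain C where "\<forall>t. 0 < t \<and> t < \<rho> \<longrightarrow> \<bar>E k t\<bar> \<le> C * t powr (a - real k)"
      using assms(2)[OF k] by blast
    then show ?thesis by (intro exI[of _ C]) (auto simp: punctured_ball_def)
  qed
  show ?thesis using assms(3)
  proof (induction n arbitrary: k)
    case 0
    then show ?case using bound[of k] by simp
  next
    case (Suc n)
    have "has_partial (\<lambda>u. E k (norm u)) g (E (Suc k) (norm u) * (u $ g * norm u powr - 1)) u"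
      if "u \<in> punctured_ball \<rho>" for u :: "real^'d" and g
      using that Suc.prems by (intro has_partial_radial assms(1)) (auto simp: punctured_ball_def)
    moreover have "homogeneous_bounded n \<rho> (a - real k - 1)
        (\<lambda>u::real^'d. E (Suc k) (norm u) * (u $ g * norm u powr - 1))" for g
    proof -
      have "homogeneous_bounded n \<rho> (a - real (Suc k) + (1 + - 1))
          (\<lambda>u::real^'d. E (Suc k) (norm u) * (u $ g * norm u powr - 1))"
        using Suc.prems by (intro homogeneous_bounded_mult Suc.IH homogeneous_bounded_coord
            homogeneous_bounded_norm_powr) simp
      then show ?thesis by (simp add: algebra_simps)
    qed
    ultimately have "\<exists>f'. (\<forall>u\<in>punctured_ball \<rho>. has_partial (\<lambda>u::real^'d. E k (norm u)) g (f' u) u) \<and>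
        homogeneous_bounded n \<rho> (a - real k - 1) f'" for g
      by (intro exI[of _ "\<lambda>u. E (Suc k) (norm u) * (u $ g * norm u powr - 1)"]) blast
    then show ?case using bound[of k] Suc.prems by simp
  qed
qed

text \<open>Translates derivatives indexed by lists of directions, the form of the hypothesis on the
  remainder, into the recursive form.\<close>

lemma homogeneous_bounded_iterated_partials:
  fixes D :: "'d list \<Rightarrow> real^'d \<Rightarrow> real"
  assumes "\<And>gs g u. u \<noteq> 0 \<Longrightarrow> has_partial (D gs) g (D (g # gs) u) u"
    and "\<And>gs. length gs \<le> N \<Longrightarrow>
      \<exists>C. \<forall>u\<in>punctured_ball \<rho>. \<bar>D gs u\<bar> \<le> C * norm u powr (a - real (length gs))"
    and "length gs + n \<le> N"
  shows "homogeneous_bounded n \<rho> (a - real (length gs)) (D gs)"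
  using assms(3)
proof (induction n arbitrary: gs)
  case 0
  then show ?case using assms(2)[of gs] by simp
next
  case (Suc n)
  have "homogeneous_bounded n \<rho> (a - real (length gs) - 1) (D (g # gs))" for g
    using Suc.IH[of "g # gs"] Suc.prems by (simp add: algebra_simps)
  moreover have "\<forall>u\<in>punctured_ball \<rho>. has_partial (D gs) g (D (g # gs) u) u" for g
    using assms(1) by (auto simp: punctured_ball_def)
  ultimately have "\<exists>f'. (\<forall>u\<in>punctured_ball \<rho>. has_partial (D gs) g (f' u) u) \<and>
      homogeneous_bounded n \<rho> (a - real (length gs) - 1) f'" for g
    by blast
  then show ?case using assms(2)[of gs] Suc.prems by simp
qed

lemma homogeneous_bounded_imp_partials_bounded:
  fixes f :: "real^'d \<Rightarrow> real"
  assumes "homogeneous_bounded n \<rho> a f"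
  shows "\<exists>C\<ge>0. partials_bounded n (punctured_ball \<rho>) (\<lambda>u. C * norm u powr (a - real n)) f"
  using assms
proof (induction n arbitrary: f a)
  case 0
  then obtain C where "0 \<le> C" "\<And>u. u \<in> punctured_ball \<rho> \<Longrightarrow> \<bar>f u\<bar> \<le> C * norm u powr a"
    by (rule homogeneous_bounded_bound) (rule that)
  then show ?case by auto
next
  case (Suc n)
  have "\<exists>f' C. (\<forall>u\<in>punctured_ball \<rho>. has_partial f g (f' u) u) \<and> 0 \<le> C \<and>
      partials_bounded n (punctured_ball \<rho>) (\<lambda>u. C * norm u powr (a - real (Suc n))) f'" for g
  proof -
    obtain f' where f': "\<forall>u\<in>punctured_ball \<rho>. has_partial f g (f' u) u"
      "homogeneous_bounded n \<rho> (a - 1) f'" using Suc.prems unfolding homogeneous_bounded.simps by blast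
    moreover have "a - 1 - real n = a - real (Suc n)" by simp
    ultimately show ?thesis using Suc.IH[OF f'(2)] by metis
  qed
  then obtain f' C where *: "\<And>g. \<forall>u\<in>punctured_ball \<rho>. has_partial f g (f' g u) u" "\<And>g. 0 \<le> C g"
    "\<And>g. partials_bounded n (punctured_ball \<rho>) (\<lambda>u. C g * norm u powr (a - real (Suc n))) (f' g)"
    by metis
  \<comment> \<open>The constants for the finitely many directions are replaced by their sum, which
    serves all of them.\<close>
  have "partials_bounded n (punctured_ball \<rho>) (\<lambda>u. (\<Sum>g\<in>UNIV. C g) * norm u powr (a - real (Suc n))) (f' g)" for g
    by (rule partials_bounded_mono[OF *(3)], intro mult_right_mono)
       (auto intro!: member_le_sum *(2))
  then have "partials_bounded (Suc n) (punctured_ball \<rho>)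
      (\<lambda>u. (\<Sum>g\<in>UNIV. C g) * norm u powr (a - real (Suc n))) f"
    using *(1) by (simp only: partials_bounded.simps) blast
  then show ?case using *(2) by (blast intro: sum_nonneg)
qed

text \<open>With bound \<open>0\<close> on the whole space, \<open>partials_bounded n\<close> says that \<open>f\<close> is a polynomial of degree
  below \<open>n\<close>.\<close>
lemma partials_bounded_zero_SucI:
  "partials_bounded n UNIV (\<lambda>_. 0) f \<Longrightarrow> partials_bounded (Suc n) UNIV (\<lambda>_. 0) f"
proof (induction n arbitrary: f)
  case 0
  then have "f = (\<lambda>_. 0)" by auto
  then show ?case using has_partial_const[of 0] by (auto intro!: exI[of _ "\<lambda>_. 0"])
next
  case (Suc n)
  then show ?case by (metis partials_bounded.simps(2))
qed

lemma partials_bounded_zero_le: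
  "n \<le> k \<Longrightarrow> partials_bounded n UNIV (\<lambda>_. 0) f \<Longrightarrow> partials_bounded k UNIV (\<lambda>_. 0) f"
  by (induction k rule: dec_induct) (auto intro: partials_bounded_zero_SucI simp del: partials_bounded.simps)

lemma partials_bounded_zero_add:
  "partials_bounded n UNIV (\<lambda>_. 0) f \<Longrightarrow> partials_bounded n UNIV (\<lambda>_. 0) f' \<Longrightarrow>
    partials_bounded n UNIV (\<lambda>_. 0) (\<lambda>u. f u + f' u)"
proof (induction n arbitrary: f f')
  case (Suc n)
  have "\<exists>D. (\<forall>u\<in>UNIV. has_partial (\<lambda>u. f u + f' u) g (D u) u) \<and> partials_bounded n UNIV (\<lambda>_. 0) D" for g
  proof -
    obtain D D' where "\<forall>u. has_partial f g (D u) u" "\<forall>u. has_partial f' g (D' u) u"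
      and D: "partials_bounded n UNIV (\<lambda>_. 0) D" "partials_bounded n UNIV (\<lambda>_. 0) D'"
      using Suc.prems unfolding partials_bounded.simps by blast
    then show ?thesis using Suc.IH[OF D]
      by (intro exI[of _ "\<lambda>u. D u + D' u"]) (auto intro: has_partial_add)
  qed
  then show ?case by simp
qed auto

lemma partials_bounded_zero_coord_mult:
  "partials_bounded n UNIV (\<lambda>_. 0) f \<Longrightarrow> partials_bounded (Suc n) UNIV (\<lambda>_. 0) (\<lambda>u. u $ i * f u)"
proof (induction n arbitrary: f)
  case 0
  then have "f = (\<lambda>_. 0)" by auto
  then show ?case using has_partial_const[of 0] by (auto intro!: exI[of _ "\<lambda>_. 0"])
next
  case (Suc n)
  have "\<exists>D. (\<forall>u\<in>UNIV. has_partial (\<lambda>u. u $ i * f u) g (D u) u) \<and>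
      partials_bounded (Suc n) UNIV (\<lambda>_. 0) D" for g
  proof -
    obtain D where D: "\<forall>u. has_partial f g (D u) u" "partials_bounded n UNIV (\<lambda>_. 0) D"
      using Suc.prems unfolding partials_bounded.simps by blast
    have "has_partial (\<lambda>u. u $ i * f u) g ((if i = g then 1 else 0) * f u + u $ i * D u) u" for u
      by (intro has_partial_mult has_partial_coord) (use D in auto)
    moreover have "partials_bounded (Suc n) UNIV (\<lambda>_. 0) (\<lambda>u. (if i = g then 1 else 0) * f u + u $ i * D u)"
    proof (rule partials_bounded_zero_add[OF _ Suc.IH[OF D(2)]])
      have "partials_bounded (Suc n) UNIV (\<lambda>_. 0) (\<lambda>_. 0)"
        by (rule partials_bounded_zero_le[of 0]) auto
      then show "partials_bounded (Suc n) UNIV (\<lambda>_. 0) (\<lambda>u. (if i = g then 1 else 0) * f u)"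
        using Suc.prems by (cases "i = g") (simp_all del: partials_bounded.simps)
    qed
    ultimately show ?thesis
      by (intro exI[of _ "\<lambda>u. (if i = g then 1 else 0) * f u + u $ i * D u"]) blast
  qed
  then show ?case unfolding partials_bounded.simps(2)[of "Suc n"] by blast
qed

lemma partials_bounded_zero_sum:
  assumes "\<And>i. i \<in> I \<Longrightarrow> partials_bounded n UNIV (\<lambda>_. 0) (f i)"
  shows "partials_bounded n UNIV (\<lambda>_. 0) (\<lambda>u. \<Sum>i\<in>I. f i u)"
proof -
  have "partials_bounded n UNIV (\<lambda>_. 0) (\<lambda>_. 0)" by (rule partials_bounded_zero_le[of 0]) auto
  then show ?thesis using assms
    by (induction I rule: infinite_finite_induct) (auto intro: partials_bounded_zero_add simp del: partials_bounded.simps)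
qed

lemma partials_bounded_zero_norm_power:
  "partials_bounded (Suc (2 * i)) UNIV (\<lambda>_. 0) (\<lambda>u::real^'d. r * norm u ^ (2 * i))"
proof (induction i)
  case 0
  show ?case using has_partial_const[of r] by (auto intro!: exI[of _ "\<lambda>_. 0"])
next
  case (Suc i)
  have "r * norm u ^ (2 * Suc i) = (\<Sum>g\<in>UNIV. u $ g * (u $ g * (r * norm u ^ (2 * i))))" for u :: "real^'d"
  proof -
    have "norm u ^ 2 = (\<Sum>g\<in>UNIV. u $ g * u $ g)"
      unfolding power2_norm_eq_inner inner_vec_def by simp
    then have "r * norm u ^ (2 * Suc i) = r * norm u ^ (2 * i) * (\<Sum>g\<in>UNIV. u $ g * u $ g)"
      by (simp add: power2_eq_square mult_ac)
    also have "\<dots> = (\<Sum>g\<in>UNIV. u $ g * (u $ g * (r * norm u ^ (2 * i))))"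
      unfolding sum_distrib_left by (intro sum.cong refl) (simp only: mult_ac)
    finally show ?thesis .
  qed
  moreover have "partials_bounded (Suc (2 * Suc i)) UNIV (\<lambda>_. 0)
      (\<lambda>u::real^'d. \<Sum>g\<in>UNIV. u $ g * (u $ g * (r * norm u ^ (2 * i))))"
    unfolding mult_Suc_right add_2_eq_Suc
    by (intro partials_bounded_zero_sum partials_bounded_zero_coord_mult Suc.IH)
  ultimately show ?case by (simp only:)
qed

text \<open>Even powers of the norm are polynomials, here of degree at most 4m - 2. All partials of
  order 4m vanish, and the mean value bound holds with bound 0.\<close>

lemma laplacian_power_norm_poly:
  fixes u :: "real^'d"
  assumes "0 < h"
  shows "(laplacian h ^^ (2 * m)) (\<lambda>u. \<Sum>i<2*m. p i * norm u ^ (2 * i)) u = 0"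
proof -
  have "partials_bounded (2 * (2 * m)) UNIV (\<lambda>_. 0) (\<lambda>u::real^'d. \<Sum>i<2*m. p i * norm u ^ (2 * i))"
    by (intro partials_bounded_zero_sum partials_bounded_zero_le[OF _ partials_bounded_zero_norm_power]) auto
  from laplacian_power_partials_bound[OF assms this, of u 0] show ?thesis by simp
qed

subsection \<open>Local structure of the covariance\<close>

lemma fps_deriv_power_nth_eq_0:
  fixes G :: "real fps"
  assumes "\<And>n. n < N \<Longrightarrow> fps_nth G n = 0" "n + k < N"
  shows "fps_nth ((fps_deriv ^^ k) G) n = 0"
  using assms(2)
proof (induction k arbitrary: n)
  case (Suc k)
  then show ?case using Suc.IH[of "Suc n"] by simp
qed (use assms(1) in auto)

text \<open>Dividing by t^p leaves a power series with the same radius of convergence, which is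
  continuous and hence bounded near 0.\<close>

lemma eval_fps_eventually_le_power:
  fixes G :: "real fps"
  assumes "0 < fps_conv_radius G" "\<And>n. n < p \<Longrightarrow> fps_nth G n = 0"
  shows "\<exists>C. \<forall>\<^sub>F t in at_right 0. \<bar>eval_fps G t\<bar> \<le> C * t ^ p"
proof (cases "G = 0")
  case False
  define H where "H = fps_shift p G"
  have sub: "p \<le> subdegree G" using assms(2) False by (metis nth_subdegree_nonzero not_le)
  have rad: "fps_conv_radius H = fps_conv_radius G"
    unfolding H_def by (simp add: fps_conv_radius_shift)
  have "isCont (eval_fps H) 0"
    using assms(1) rad by (intro continuous_eval_fps) (auto simp: zero_ereal_def eball_def)
  then have "((\<lambda>t. eval_fps H t) \<longlongrightarrow> eval_fps H 0) (at_right 0)"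
    by (simp add: isCont_def filterlim_at_split)
  then have "\<forall>\<^sub>F t in at_right 0. dist (eval_fps H t) (eval_fps H 0) < 1"
    by (rule tendstoD) simp
  moreover have "\<forall>\<^sub>F t in nhds (0::real). ereal (norm t) < fps_conv_radius G"
  proof -
    have "\<forall>\<^sub>F t in nhds (0::real). t \<in> eball 0 (fps_conv_radius G)"
      using assms(1) by (intro eventually_nhds_in_open open_eball) (auto simp: zero_ereal_def eball_def)
    then show ?thesis by eventually_elim (simp add: eball_def dist_norm)
  qed
  then have "\<forall>\<^sub>F t in at_right (0::real). ereal (norm t) < fps_conv_radius G"
    by (simp add: eventually_nhds_conv_at eventually_at_split)
  moreover have "\<forall>\<^sub>F t in at_right (0::real). 0 < t" by (simp add: eventually_at_right_less)
  ultimately have "\<forall>\<^sub>F t in at_right 0. \<bar>eval_fps G t\<bar> \<le> (\<bar>eval_fps H 0\<bar> + 1) * t ^ p"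
  proof eventually_elim
    case (elim t)
    have "eval_fps H t = eval_fps G t / t ^ p"
      unfolding H_def using elim by (subst eval_fps_shift[OF sub]) auto
    then have "\<bar>eval_fps G t\<bar> = \<bar>eval_fps H t\<bar> * t ^ p" using elim by (simp add: abs_mult)
    also have "\<dots> \<le> (\<bar>eval_fps H 0\<bar> + 1) * t ^ p"
      using elim by (intro mult_right_mono) (auto simp: dist_real_def)
    finally show ?case .
  qed
  then show ?thesis by blast
qed (auto intro!: exI[of _ 0])

text \<open>Uniqueness of the expansion: the difference divided by its lowest power would be
  continuous and vanish near 0 away from 0, yet take the nonzero leading coefficient as its value at
  0.\<close>

lemma real_eval_fps_eqD:
  fixes F G :: "real fps"
  assumes "0 < fps_conv_radius F" "0 < fps_conv_radius G"
    and "\<forall>\<^sub>F t in nhds 0. eval_fps F t = eval_fps G t"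
  shows "F = G"
proof (rule ccontr)
  assume ne: "F \<noteq> G"
  define k where "k = subdegree (F - G)"
  define H where "H = fps_shift k (F - G)"
  have rad: "0 < fps_conv_radius (F - G)"
    using assms(1,2) fps_conv_radius_diff[of F G] by (auto simp: min_def split: if_splits)
  have "isCont (eval_fps H) 0"
    using rad unfolding H_def
    by (intro continuous_eval_fps) (auto simp: zero_ereal_def eball_def fps_conv_radius_shift)
  then have "(eval_fps H \<longlongrightarrow> eval_fps H 0) (at 0)" by (simp add: isCont_def)
  moreover have "\<forall>\<^sub>F t in at 0. eval_fps H t = 0"
  proof -
    have "0 < min (fps_conv_radius F) (min (fps_conv_radius G) (fps_conv_radius (F - G)))" (is "0 < ?r")
      using assms rad by simp
    then have "\<forall>\<^sub>F t in nhds (0::real). t \<in> eball 0 ?r"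
      by (intro eventually_nhds_in_open open_eball) (auto simp: zero_ereal_def eball_def)
    then have "\<forall>\<^sub>F t in at (0::real). t \<in> eball 0 ?r \<and> eval_fps F t = eval_fps G t \<and> t \<noteq> 0"
      using assms(3) by (auto simp: eventually_at_filter elim: eventually_elim2)
    then show ?thesis
    proof eventually_elim
      case (elim t)
      then have t: "ereal (norm t) < fps_conv_radius F" "ereal (norm t) < fps_conv_radius G"
        "ereal (norm t) < fps_conv_radius (F - G)"
        by (auto simp: eball_def dist_norm)
      have "eval_fps H t = eval_fps (F - G) t / t ^ k"
        unfolding H_def k_def using elim t by (subst eval_fps_shift) auto
      then show ?case using elim t by (simp add: eval_fps_diff)
    qed
  qed
  then have "(eval_fps H \<longlongrightarrow> 0) (at 0)" by (simp add: tendsto_eventually)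
  ultimately have "eval_fps H 0 = 0" by (intro tendsto_unique[of "at 0"]) auto
  then have "fps_nth (F - G) k = 0" by (simp add: eval_fps_at_0 H_def)
  then show False using ne nth_subdegree_nonzero[of "F - G"] by (simp add: k_def)
qed

text \<open>The series of \<open>A (- t)\<close> has the coefficients of \<open>F\<close> with
  alternating signs; by uniqueness of the expansion the two series agree.\<close>

lemma even_fps_expansion_odd_nth:
  fixes A :: "real \<Rightarrow> real"
  assumes F: "A has_fps_expansion F" and even: "\<forall>\<^sub>F t in nhds 0. A (- t) = A t" and "odd n"
  shows "fps_nth F n = 0"
proof -
  define G where "G = Abs_fps (\<lambda>n. (- 1) ^ n * fps_nth F n)"
  have rad: "fps_conv_radius G = fps_conv_radius F"
  proof -
    have "conv_radius (\<lambda>n. norm (fps_nth G n)) = conv_radius (\<lambda>n. norm (fps_nth F n))"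
      by (simp add: G_def abs_mult)
    then show ?thesis by (simp only: fps_conv_radius_def conv_radius_norm)
  qed
  have ev: "eval_fps G t = eval_fps F (- t)" for t
    unfolding eval_fps_def G_def by (simp add: power_minus[of t] mult_ac)
  have F': "0 < fps_conv_radius F" "\<forall>\<^sub>F t in nhds 0. eval_fps F t = A t"
    using F by (auto simp: has_fps_expansion_def)
  have "filterlim uminus (nhds (- 0)) (nhds (0::real))" by (intro tendsto_minus filterlim_ident)
  then have "\<forall>\<^sub>F t in nhds 0. eval_fps F (- t) = A (- t)"
    using F'(2) by (auto simp: filterlim_iff)
  with F'(2) even have "\<forall>\<^sub>F t in nhds 0. eval_fps F t = eval_fps G t"
    by eventually_elim (simp add: ev)
  then have "F = G" using F'(1) rad by (intro real_eval_fps_eqD) auto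
  then have "fps_nth F n = (- 1) ^ n * fps_nth F n" by (metis G_def fps_nth_Abs_fps)
  then show ?thesis using \<open>odd n\<close> by simp
qed

text \<open>\<open>R k\<close> is the \<open>k\<close>-th derivative of the Taylor remainder of order \<open>4m\<close>.\<close>
lemma even_analytic_expansion:
  fixes A :: "real \<Rightarrow> real"
  assumes F: "A has_fps_expansion F" and even: "\<forall>\<^sub>F t in nhds 0. A (- t) = A t"
  shows "\<exists>p R. (\<forall>\<^sub>F t in nhds 0. A t = (\<Sum>i<2*m. p i * t ^ (2 * i)) + R 0 t) \<and>
      (\<exists>\<rho>>0. \<forall>k t. \<bar>t\<bar> < \<rho> \<longrightarrow> (R k has_real_derivative R (Suc k) t) (at t)) \<and>
      (\<forall>k\<le>4*m. \<exists>C. \<forall>\<^sub>F t in at_right 0. \<bar>R k t\<bar> \<le> C * t ^ (4 * m - k)) \<and>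
      (0 < m \<longrightarrow> R 0 0 = 0)"
proof -
  \<comment> \<open>Cutting the series makes every \<open>R k\<close> a power series again, so that
    derivatives and orders of vanishing are read off from the coefficients.\<close>
  define G where "G = Abs_fps (\<lambda>n. if n < 4 * m then 0 else fps_nth F n)"
  define R where "R k = eval_fps ((fps_deriv ^^ k) G)" for k
  have F': "0 < fps_conv_radius F" "\<forall>\<^sub>F t in nhds 0. eval_fps F t = A t"
    using F by (auto simp: has_fps_expansion_def)
  have rad: "fps_conv_radius G = fps_conv_radius F"
    unfolding fps_conv_radius_def G_def
    by (intro conv_radius_cong') (auto intro!: eventually_mono[OF eventually_ge_at_top[of "4*m"]])
  have radk: "fps_conv_radius F \<le> fps_conv_radius ((fps_deriv ^^ k) G)" for k
    by (induction k) (auto simp: rad intro: order_trans fps_conv_radius_deriv)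
  have expand: "eval_fps F t = (\<Sum>i<2*m. fps_nth F (2 * i) * t ^ (2 * i)) + R 0 t"
    if t: "ereal (norm t) < fps_conv_radius F" for t
  proof -
    have "(\<lambda>n. fps_nth F n * t ^ n) sums eval_fps F t" by (rule sums_eval_fps[OF t])
    moreover have "(\<lambda>n. if n \<in> {..<4*m} then fps_nth F n * t ^ n else 0) sums (\<Sum>n<4*m. fps_nth F n * t ^ n)"
      by (rule sums_If_finite_set) simp
    ultimately have "(\<lambda>n. fps_nth F n * t ^ n - (if n \<in> {..<4*m} then fps_nth F n * t ^ n else 0))
        sums (eval_fps F t - (\<Sum>n<4*m. fps_nth F n * t ^ n))"
      by (rule sums_diff)
    also have "(\<lambda>n. fps_nth F n * t ^ n - (if n \<in> {..<4*m} then fps_nth F n * t ^ n else 0)) =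
        (\<lambda>n. fps_nth G n * t ^ n)" by (auto simp: G_def)
    finally have "eval_fps F t - (\<Sum>n<4*m. fps_nth F n * t ^ n) = R 0 t"
      unfolding R_def eval_fps_def using sums_unique by fastforce
    moreover have "(\<Sum>n<4*m. fps_nth F n * t ^ n) = (\<Sum>i<2*m. fps_nth F (2 * i) * t ^ (2 * i))"
    proof (rule sum.mono_neutral_cong_right[THEN trans])
      show "(\<Sum>n\<in>(*) 2 ` {..<2*m}. fps_nth F n * t ^ n) = (\<Sum>i<2*m. fps_nth F (2 * i) * t ^ (2 * i))"
        by (subst sum.reindex) (auto simp: inj_on_def)
      show "\<forall>n\<in>{..<4*m} - (*) 2 ` {..<2*m}. fps_nth F n * t ^ n = 0"
      proof
        fix n assume n: "n \<in> {..<4*m} - (*) 2 ` {..<2*m}"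
        then have "odd n" by (auto elim!: evenE)
        then show "fps_nth F n * t ^ n = 0" using even_fps_expansion_odd_nth[OF F even] by simp
      qed
    qed auto
    ultimately show ?thesis by simp
  qed
  have "\<forall>\<^sub>F t in nhds (0::real). t \<in> eball 0 (fps_conv_radius F)"
    using F'(1) by (intro eventually_nhds_in_open open_eball) (auto simp: zero_ereal_def eball_def)
  then have near: "\<forall>\<^sub>F t in nhds (0::real). ereal (norm t) < fps_conv_radius F"
    by eventually_elim (simp add: eball_def dist_norm)
  have 1: "\<forall>\<^sub>F t in nhds 0. A t = (\<Sum>i<2*m. fps_nth F (2 * i) * t ^ (2 * i)) + R 0 t"
    using F'(2) near by eventually_elim (simp add: expand)
  obtain \<rho> where \<rho>: "0 < \<rho>" "\<And>t::real. \<bar>t\<bar> < \<rho> \<Longrightarrow> ereal (norm t) < fps_conv_radius F"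
    using near by (auto simp: eventually_nhds_metric dist_real_def)
  have 2: "(R k has_real_derivative R (Suc k) t) (at t)" if "\<bar>t\<bar> < \<rho>" for k t
    unfolding R_def using has_field_derivative_eval_fps[of t "(fps_deriv ^^ k) G" UNIV]
      \<rho>(2)[OF that] radk[of k] by (simp add: order_less_le_trans)
  have 3: "\<exists>C. \<forall>\<^sub>F t in at_right 0. \<bar>R k t\<bar> \<le> C * t ^ (4 * m - k)" if "k \<le> 4 * m" for k
    unfolding R_def
  proof (rule eval_fps_eventually_le_power)
    show "0 < fps_conv_radius ((fps_deriv ^^ k) G)" using radk[of k] F'(1) by simp
    show "fps_nth ((fps_deriv ^^ k) G) n = 0" if "n < 4 * m - k" for n
      by (rule fps_deriv_power_nth_eq_0[of "4*m"]) (use that in \<open>auto simp: G_def\<close>)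
  qed
  have 4: "0 < m \<longrightarrow> R 0 0 = 0" by (simp add: R_def eval_fps_at_0 G_def)
  show "\<exists>p R. (\<forall>\<^sub>F t in nhds 0. A t = (\<Sum>i<2*m. p i * t ^ (2 * i)) + R 0 t) \<and>
      (\<exists>\<rho>>0. \<forall>k t. \<bar>t\<bar> < \<rho> \<longrightarrow> (R k has_real_derivative R (Suc k) t) (at t)) \<and>
      (\<forall>k\<le>4*m. \<exists>C. \<forall>\<^sub>F t in at_right 0. \<bar>R k t\<bar> \<le> C * t ^ (4 * m - k)) \<and>
      (0 < m \<longrightarrow> R 0 0 = 0)"
    using 1 2 3 4 \<rho>(1) by (intro exI[of _ "\<lambda>i. fps_nth F (2 * i)"] exI[of _ R]) blast
qed

text \<open>Near the origin, a covariance satisfying condition A is an even polynomial of degree below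
  \<open>4m\<close>, annihilated by \<open>\<Delta>\<^sup>2\<^sup>m\<close>, plus a function \<open>f\<close> homogeneously bounded of degree
  \<open>min a (4m)\<close>; the terms of degree at least \<open>4m\<close> of the analytic part are put into \<open>f\<close>.\<close>
lemma covariance_local_structure:
  fixes r :: "real^'d \<Rightarrow> real"
  assumes "0 < L" "condition_A L c a K" "remainder_cond a r" "0 < m"
  obtains \<rho> p f where "0 < \<rho>"
    "\<And>u. norm u < \<rho> \<Longrightarrow> K (norm u) + r u = (\<Sum>i<2*m. p i * norm u ^ (2 * i)) + f u"
    "homogeneous_bounded (4 * m) \<rho> (min a (4 * real m)) f" "f 0 = 0"
    "\<And>\<epsilon>. a < 4 * real m \<Longrightarrow> 0 < \<epsilon> \<Longrightarrow>
      \<exists>\<delta>>0. \<forall>u. norm u < \<delta> \<longrightarrow> \<bar>f u - c * norm u powr a\<bar> \<le> \<epsilon> * norm u powr a"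
proof -
  let ?N = "4 * m" and ?\<gamma> = "min a (4 * real m)"
  from assms(2) obtain A B DB where a: "0 < a"
    and K: "\<And>t. t \<in> {-L..L} \<Longrightarrow> K t = A t + B t"
    and A: "\<And>t. t \<in> {-L..L} \<Longrightarrow> A (-t) = A t" "real_analytic_on A {-L..L}"
    and B: "continuous_on {-L..L} B"
    and DB0: "\<And>t. t \<in> {0<..L} \<Longrightarrow> DB 0 t = B t"
    and DB1: "\<And>k t. t \<in> {0<..L} \<Longrightarrow> (DB k has_real_derivative DB (Suc k) t) (at t within {0<..L})"
    and DBo: "\<And>k. (\<lambda>t. DB k t - falling a k * c * t powr (a - real k)) \<in> o[at_right 0](\<lambda>t. t powr (a - real k))"
    unfolding condition_A_def by blast
  from assms(3) obtain D :: "'d list \<Rightarrow> real^'d \<Rightarrow> real" where ro: "r \<in> o[nhds 0](\<lambda>u. norm u powr a)"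
    and D0: "\<And>u. u \<noteq> 0 \<Longrightarrow> D [] u = r u"
    and D1: "\<And>gs g u. u \<noteq> 0 \<Longrightarrow> has_partial (D gs) g (D (g # gs) u) u"
    and Do: "\<And>gs. D gs \<in> o[at 0](\<lambda>u. norm u powr (a - real (length gs)))"
    unfolding remainder_cond_def has_partial_def by blast
  have "\<exists>F. (\<lambda>x. A (0 + x)) has_fps_expansion F"
    by (rule bspec[OF A(2)[unfolded real_analytic_on_def]]) (use assms(1) in auto)
  then obtain F where "(\<lambda>x. A (0 + x)) has_fps_expansion F" by blast
  then have F: "A has_fps_expansion F" by simp
  have "\<forall>\<^sub>F t in nhds 0. t \<in> {-L<..<L}"
    using assms(1) by (intro eventually_nhds_in_open) auto
  then have evA: "\<forall>\<^sub>F t in nhds 0. A (- t) = A t" by eventually_elim (auto intro: A(1))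
  obtain p R \<rho>0 where R0: "\<forall>\<^sub>F t in nhds 0. A t = (\<Sum>i<2*m. p i * t ^ (2 * i)) + R 0 t"
    and \<rho>0: "0 < \<rho>0" and R1: "\<And>k t. \<bar>t\<bar> < \<rho>0 \<Longrightarrow> (R k has_real_derivative R (Suc k) t) (at t)"
    and R2: "\<And>k. k \<le> ?N \<Longrightarrow> \<exists>C. \<forall>\<^sub>F t in at_right 0. \<bar>R k t\<bar> \<le> C * t ^ (?N - k)"
    and R00: "R 0 0 = 0"
    using even_analytic_expansion[OF F evA, of m] assms(4) by (elim exE conjE) blast
  \<comment> \<open>Analytic tail and singular part share one chain of radial derivatives on the
    positive half-line.\<close>
  define E where "E k t = R k t + DB k t" for k t
  obtain \<rho>1 where \<rho>1: "0 < \<rho>1" "\<And>t. \<bar>t\<bar> < \<rho>1 \<Longrightarrow> A t = (\<Sum>i<2*m. p i * t ^ (2 * i)) + R 0 t"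
    using R0 by (auto simp: eventually_nhds_metric dist_real_def)
  have small1: "\<forall>\<^sub>F t in at_right (0::real). 0 < t \<and> t < 1"
    by (auto simp: eventually_at_right_field intro!: exI[of _ 1])
  have Rb: "\<exists>C. \<forall>\<^sub>F t in at_right 0. \<bar>R k t\<bar> \<le> C * t powr (4 * real m - real k)" if k: "k \<le> ?N" for k
  proof -
    obtain C where "\<forall>\<^sub>F t in at_right 0. \<bar>R k t\<bar> \<le> C * t ^ (?N - k)" using R2[OF k] by blast
    then have "\<forall>\<^sub>F t in at_right 0. \<bar>R k t\<bar> \<le> C * t powr (4 * real m - real k)"
      using small1 by eventually_elim (use k in \<open>simp add: of_nat_diff flip: powr_realpow\<close>)
    then show ?thesis by blast
  qed
  have powr_le: "t powr x \<le> t powr y" if "0 < t" "t < 1" "y \<le> x" for t x y :: real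
    using that by (intro powr_mono') auto
  have Eb: "\<exists>C. \<forall>\<^sub>F t in at_right 0. \<bar>E k t\<bar> \<le> C * t powr (?\<gamma> - real k)" if k: "k \<le> ?N" for k
  proof -
    obtain C where C: "\<forall>\<^sub>F t in at_right 0. \<bar>R k t\<bar> \<le> C * t powr (4 * real m - real k)" using Rb[OF k] by blast
    have "\<forall>\<^sub>F t in at_right 0. \<bar>DB k t - falling a k * c * t powr (a - real k)\<bar> \<le> 1 * \<bar>t powr (a - real k)\<bar>"
      using landau_o.smallD[OF DBo[of k], of 1] by simp
    with C small1 have "\<forall>\<^sub>F t in at_right 0. \<bar>E k t\<bar> \<le> (\<bar>C\<bar> + (\<bar>falling a k * c\<bar> + 1)) * t powr (?\<gamma> - real k)"
    proof eventually_elim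
      case (elim t)
      have le: "t powr (4 * real m - real k) \<le> t powr (?\<gamma> - real k)" "t powr (a - real k) \<le> t powr (?\<gamma> - real k)"
        using elim by (auto intro!: powr_le)
      have "\<bar>R k t\<bar> \<le> \<bar>C\<bar> * t powr (4 * real m - real k)"
        using elim(1) by (rule order_trans) (intro mult_right_mono, auto)
      also have "\<dots> \<le> \<bar>C\<bar> * t powr (?\<gamma> - real k)" by (intro mult_left_mono le) auto
      finally have 1: "\<bar>R k t\<bar> \<le> \<bar>C\<bar> * t powr (?\<gamma> - real k)" .
      have "\<bar>DB k t\<bar> \<le> \<bar>falling a k * c * t powr (a - real k)\<bar> + t powr (a - real k)"
        using elim(3) by simp
      also have "\<dots> = (\<bar>falling a k * c\<bar> + 1) * t powr (a - real k)"
        by (simp add: abs_mult algebra_simps)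
      also have "\<dots> \<le> (\<bar>falling a k * c\<bar> + 1) * t powr (?\<gamma> - real k)" by (intro mult_left_mono le) auto
      finally show ?case using 1 unfolding E_def distrib_right by linarith
    qed
    then show ?thesis by blast
  qed
  then obtain CE where "\<And>k. k \<le> ?N \<Longrightarrow> \<forall>\<^sub>F t in at_right 0. \<bar>E k t\<bar> \<le> CE k * t powr (?\<gamma> - real k)" by metis
  then have "\<forall>\<^sub>F t in at_right 0. \<forall>k\<in>{..?N}. \<bar>E k t\<bar> \<le> CE k * t powr (?\<gamma> - real k)"
    by (intro eventually_ball_finite) auto
  then obtain \<rho>2 where \<rho>2: "0 < \<rho>2" "\<And>t k. 0 < t \<Longrightarrow> t < \<rho>2 \<Longrightarrow> k \<le> ?N \<Longrightarrow> \<bar>E k t\<bar> \<le> CE k * t powr (?\<gamma> - real k)"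
    by (auto simp: eventually_at_right_field)
  have small2: "\<forall>\<^sub>F u in at (0::real^'d). u \<noteq> 0 \<and> norm u < 1"
    by (auto simp: eventually_at dist_norm intro!: exI[of _ 1])
  have "\<forall>\<^sub>F u in at 0. \<bar>D gs u\<bar> \<le> 1 * norm u powr (?\<gamma> - real (length gs))" for gs
    using landau_o.smallD[OF Do[of gs] zero_less_one] small2
  proof eventually_elim
    case (elim u)
    have "norm u powr (a - real (length gs)) \<le> norm u powr (?\<gamma> - real (length gs))"
      using elim by (intro powr_le) auto
    with elim show ?case by simp
  qed
  \<comment> \<open>There are finitely many lists of directions of length at most
    \<open>4 * m\<close>, so one radius works for all of them.\<close>
  then have "\<forall>\<^sub>F u in at 0. \<forall>gs\<in>{gs. set gs \<subseteq> UNIV \<and> length gs \<le> ?N}. \<bar>D gs u\<bar> \<le> 1 * norm u powr (?\<gamma> - real (length gs))"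
    by (intro eventually_ball_finite finite_lists_length_le) auto
  then obtain \<rho>3 where \<rho>3: "0 < \<rho>3" "\<And>u gs. u \<noteq> 0 \<Longrightarrow> norm u < \<rho>3 \<Longrightarrow> length gs \<le> ?N \<Longrightarrow>
      \<bar>D gs u\<bar> \<le> 1 * norm u powr (?\<gamma> - real (length gs))"
    by (auto simp: eventually_at dist_norm)
  define \<rho> where "\<rho> = Min {L, \<rho>0, \<rho>1, \<rho>2, \<rho>3}"
  have \<rho>: "0 < \<rho>" "\<rho> \<le> L" "\<rho> \<le> \<rho>0" "\<rho> \<le> \<rho>1" "\<rho> \<le> \<rho>2" "\<rho> \<le> \<rho>3"
    using assms(1) \<rho>0 \<rho>1(1) \<rho>2(1) \<rho>3(1) by (auto simp: \<rho>_def)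
  define f where "f u = R 0 (norm u) + B (norm u) + r u" for u :: "real^'d"
  have "homogeneous_bounded (4 * m) \<rho> (?\<gamma> - real 0) (\<lambda>u::real^'d. E 0 (norm u))"
  proof (rule homogeneous_bounded_radial[where N = ?N])
    fix j :: nat and t :: real assume t: "0 < t" "t < \<rho>"
    \<comment> \<open>The derivative is one-sided at \<open>L\<close>; restricting to the open
      interval makes it two-sided.\<close>
    have "(DB j has_real_derivative DB (Suc j) t) (at t within {0<..<L})"
      using t \<rho> by (intro DERIV_subset[OF DB1]) auto
    then have "(DB j has_real_derivative DB (Suc j) t) (at t)"
      using t \<rho> by (simp add: at_within_open[of t "{0<..<L}"])
    then show "(E j has_real_derivative E (Suc j) t) (at t)"
      unfolding E_def using t \<rho> by (intro DERIV_add R1) auto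
  next
    fix j assume "j \<le> ?N"
    then show "\<exists>C. \<forall>t. 0 < t \<and> t < \<rho> \<longrightarrow> \<bar>E j t\<bar> \<le> C * t powr (?\<gamma> - real j)"
      using \<rho>2(2) \<rho> by (intro exI[of _ "CE j"]) auto
  qed simp
  moreover have "homogeneous_bounded (4 * m) \<rho> (?\<gamma> - real (length ([] :: 'd list))) (D [])"
  proof (rule homogeneous_bounded_iterated_partials[where N = ?N])
    fix gs :: "'d list" assume "length gs \<le> ?N"
    then show "\<exists>C. \<forall>u\<in>punctured_ball \<rho>. \<bar>D gs u\<bar> \<le> C * norm u powr (?\<gamma> - real (length gs))"
      using \<rho>3(2) \<rho> by (intro exI[of _ 1]) (auto simp: punctured_ball_def)
  qed (auto intro: D1)
  ultimately have "homogeneous_bounded (4 * m) \<rho> ?\<gamma> (\<lambda>u. E 0 (norm u) + D [] u)"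
    using homogeneous_bounded_add by fastforce
  then have hf: "homogeneous_bounded (4 * m) \<rho> ?\<gamma> f"
    by (rule homogeneous_bounded_cong[rotated]) (use \<rho> in \<open>auto simp: punctured_ball_def E_def f_def D0 DB0\<close>)
  have "((\<lambda>t. B t) \<longlongrightarrow> B 0) (at_right 0)"
  proof -
    have "(B \<longlongrightarrow> B 0) (at 0 within {-L..L})" using B assms(1) by (auto simp: continuous_on)
    then have "(B \<longlongrightarrow> B 0) (at 0 within {0..L})" by (rule tendsto_within_subset) (use assms(1) in auto)
    then show ?thesis using assms(1) by (simp add: at_within_Icc_at_right)
  qed
  have fall0: "falling a 0 = 1"
  proof -
    have "Gamma (a + 1) \<noteq> 0" using a by (simp add: less_imp_neq[symmetric] Gamma_real_pos)
    then show ?thesis by (simp add: falling_def rGamma_inverse_Gamma)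
  qed
  \<comment> \<open>The asymptotics concern positive \<open>t\<close> only; continuity of
    \<open>B\<close> carries them over to the value at 0.\<close>
  have B0: "B 0 = 0"
  proof (rule tendsto_unique[OF _ \<open>(B \<longlongrightarrow> B 0) (at_right 0)\<close>])
    have pw: "((\<lambda>t::real. t powr a) \<longlongrightarrow> 0) (at_right 0)"
      using a by real_asymp
    have "\<forall>\<^sub>F t in at_right 0. norm (DB 0 t - c * t powr a) \<le> t powr a"
      using landau_o.smallD[OF DBo[of 0], of 1] fall0 by simp
    then have "((\<lambda>t. DB 0 t - c * t powr a) \<longlongrightarrow> 0) (at_right 0)"
      by (rule Lim_null_comparison[OF _ pw])
    from tendsto_add[OF this tendsto_mult[OF tendsto_const[of c] pw]]
    have "((\<lambda>t. DB 0 t) \<longlongrightarrow> 0) (at_right 0)" by simp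
    moreover have "\<forall>\<^sub>F t in at_right 0. DB 0 t = B t"
      using eventually_at_right_less assms(1)
      by (auto simp: eventually_at_right_field intro!: exI[of _ L] DB0)
    ultimately show "(B \<longlongrightarrow> 0) (at_right 0)" by (rule Lim_transform_eventually)
  qed simp
  \<comment> \<open>The filter \<open>nhds 0\<close> contains the point 0 itself, where the
    comparison function vanishes.\<close>
  have r0: "r 0 = 0"
  proof -
    have "\<forall>\<^sub>F u in nhds 0. norm (r u) \<le> 1 * norm (norm u powr a)"
      by (rule landau_o.smallD[OF ro]) simp
    from eventually_nhds_x_imp_x[OF this] show ?thesis by simp
  qed
  have f0: "f 0 = 0" by (simp add: f_def R00 B0 r0)
  show thesis
  proof (rule that[of \<rho> p f])
    show "K (norm u) + r u = (\<Sum>i<2*m. p i * norm u ^ (2 * i)) + f u" if "norm u < \<rho>" for u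
    proof -
      have "K (norm u) = A (norm u) + B (norm u)"
        using that \<rho>(2) assms(1) by (intro K) (auto intro: order_trans[of _ 0])
      moreover have "A (norm u) = (\<Sum>i<2*m. p i * norm u ^ (2 * i)) + R 0 (norm u)"
        using that \<rho>(4) by (intro \<rho>1(2)) simp
      ultimately show ?thesis by (simp add: f_def)
    qed
    fix \<epsilon> :: real assume am: "a < 4 * real m" and \<epsilon>: "0 < \<epsilon>"
    \<comment> \<open>Analytic tail, singular part and remainder contribute
      \<open>\<epsilon> / 3\<close> each. The tail is of order t^(4m), which is negligible because
      \<open>a < 4 * real m\<close>.\<close>
    obtain C where C: "\<forall>\<^sub>F t in at_right 0. \<bar>R 0 t\<bar> \<le> C * t powr (4 * real m)" using Rb[of 0] by auto
    have "((\<lambda>t::real. C * t powr (4 * real m - a)) \<longlongrightarrow> 0) (at_right 0)"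
    proof -
      have "0 < 4 * real m - a" using am by simp
      then show ?thesis by real_asymp
    qed
    then have "\<forall>\<^sub>F t in at_right 0. dist (C * t powr (4 * real m - a)) 0 < \<epsilon> / 3"
      by (rule tendstoD) (use \<epsilon> in simp)
    with C have "\<forall>\<^sub>F t in at_right 0. \<bar>R 0 t\<bar> \<le> \<epsilon> / 3 * t powr a"
    proof eventually_elim
      case (elim t)
      have "C * t powr (4 * real m) = C * t powr (4 * real m - a) * t powr a" by (simp flip: powr_add)
      also have "\<dots> \<le> \<epsilon> / 3 * t powr a" using elim(2) by (intro mult_right_mono) auto
      finally show ?case using elim(1) by simp
    qed
    moreover have "\<forall>\<^sub>F t in at_right 0. \<bar>B t - c * t powr a\<bar> \<le> \<epsilon> / 3 * t powr a"
    proof -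
      have "\<forall>\<^sub>F t in at_right 0. \<bar>DB 0 t - c * t powr a\<bar> \<le> \<epsilon> / 3 * t powr a"
        using landau_o.smallD[OF DBo[of 0], of "\<epsilon> / 3"] \<epsilon> fall0 by simp
      moreover have "\<forall>\<^sub>F t in at_right 0. DB 0 t = B t"
        using assms(1) by (auto simp: eventually_at_right_field intro!: exI[of _ L] DB0)
      ultimately show ?thesis by eventually_elim simp
    qed
    ultimately have "\<forall>\<^sub>F t in at_right 0. \<bar>R 0 t\<bar> \<le> \<epsilon> / 3 * t powr a \<and> \<bar>B t - c * t powr a\<bar> \<le> \<epsilon> / 3 * t powr a"
      by (rule eventually_conj)
    then obtain \<delta> where \<delta>: "0 < \<delta>" "\<And>t. 0 < t \<Longrightarrow> t < \<delta> \<Longrightarrow> \<bar>R 0 t\<bar> \<le> \<epsilon> / 3 * t powr a"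
      "\<And>t. 0 < t \<Longrightarrow> t < \<delta> \<Longrightarrow> \<bar>B t - c * t powr a\<bar> \<le> \<epsilon> / 3 * t powr a"
      by (auto simp: eventually_at_right_field)
    have "\<forall>\<^sub>F u in nhds 0. norm (r u) \<le> \<epsilon> / 3 * norm (norm u powr a)"
      by (rule landau_o.smallD[OF ro]) (use \<epsilon> in simp)
    then obtain \<delta>' where \<delta>': "0 < \<delta>'" "\<And>u. norm u < \<delta>' \<Longrightarrow> \<bar>r u\<bar> \<le> \<epsilon> / 3 * norm u powr a"
      by (auto simp: eventually_nhds_metric dist_norm)
    have "\<bar>f u - c * norm u powr a\<bar> \<le> \<epsilon> * norm u powr a" if u: "norm u < min \<delta> \<delta>'" for u
    proof (cases "u = 0")
      case False
      have "\<bar>R 0 (norm u)\<bar> \<le> \<epsilon> / 3 * norm u powr a" "\<bar>B (norm u) - c * norm u powr a\<bar> \<le> \<epsilon> / 3 * norm u powr a"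
        "\<bar>r u\<bar> \<le> \<epsilon> / 3 * norm u powr a"
        using \<delta>(2,3)[of "norm u"] \<delta>'(2)[of u] u False by auto
      then show ?thesis unfolding f_def by argo
    qed (use f0 in simp)
    then show "\<exists>\<delta>>0. \<forall>u. norm u < \<delta> \<longrightarrow> \<bar>f u - c * norm u powr a\<bar> \<le> \<epsilon> * norm u powr a"
      using \<delta>(1) \<delta>'(1) by (intro exI[of _ "min \<delta> \<delta>'"]) auto
  qed (use \<rho>(1) hf f0 in auto)
qed

subsection \<open>Decay and scaling limit of the differenced covariance\<close>

text \<open>Two regimes. If |u| is at least \<open>4 * m * h\<close>, the stencil, of radius
  \<open>2 * m * h\<close>, stays away from the origin and the mean value bound with derivatives of
  order 4m applies. Otherwise \<open>h\<close> and \<open>h + norm u\<close> are comparable, and the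
  size of \<open>f\<close> divided by h^(4m) is already of the right order; \<open>f 0 = 0\<close>
  covers a stencil point at the origin.\<close>

lemma laplacian_power_decay:
  fixes f cov :: "real^'d \<Rightarrow> real"
  assumes "0 < \<gamma>" "\<gamma> \<le> 4 * real m" "0 < m"
    and cov: "\<And>u. norm u < \<rho> \<Longrightarrow> cov u = (\<Sum>i<2*m. p i * norm u ^ (2 * i)) + f u"
    and f: "homogeneous_bounded (4 * m) \<rho> \<gamma> f" "f 0 = 0"
  obtains C where "0 \<le> C" "\<And>h u. 0 < h \<Longrightarrow> norm u + 2 * real m * h < \<rho> \<Longrightarrow>
    \<bar>(laplacian h ^^ (2 * m)) cov u\<bar> \<le> C * (h + norm u) powr (\<gamma> - 4 * real m)"
proof -
  let ?e = "\<gamma> - 4 * real m"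
  obtain C0 where C0: "0 \<le> C0" "\<And>u. u \<in> punctured_ball \<rho> \<Longrightarrow> \<bar>f u\<bar> \<le> C0 * norm u powr \<gamma>"
    by (rule homogeneous_bounded_bound[OF f(1)]) (rule that)
  obtain C1 where C1: "0 \<le> C1" "partials_bounded (2 * (2 * m)) (punctured_ball \<rho>) (\<lambda>u. C1 * norm u powr ?e) f"
    using homogeneous_bounded_imp_partials_bounded[OF f(1)] by (auto simp: mult.assoc)
  obtain A where A: "0 \<le> A" "\<And>h f B. \<And>u::real^'d. 0 < h \<Longrightarrow> 0 \<le> B \<Longrightarrow>
      (\<And>v. norm (v - u) \<le> real (2 * m) * h \<Longrightarrow> \<bar>f v\<bar> \<le> B) \<Longrightarrow>
      \<bar>(laplacian h ^^ (2 * m)) f u\<bar> \<le> A * B / h ^ (2 * (2 * m))"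
    using laplacian_power_sup_bound[of "2 * m"] by blast
  \<comment> \<open>Away from the origin the stencil stays beyond \<open>norm u / 2\<close>, which
    is at least \<open>(h + norm u) / 4\<close>. Near it the stencil lies within
    \<open>6 * m * h\<close>, and \<open>h\<close> is at least
    \<open>(h + norm u) / (4 * m + 1)\<close>. The exponent is nonpositive, so these lower bounds
    become upper bounds for the powers.\<close>
  define far where "far = (2 * real CARD('d)) ^ (2 * m) * (C1 * (1 / 4) powr ?e)"
  define near where "near = A * (C0 * (6 * real m) powr \<gamma>) * (1 / (4 * real m + 1)) powr ?e"
  have pos: "0 \<le> far" "0 \<le> near" using C1(1) C0(1) A(1) by (auto simp: far_def near_def)
  show thesis
  proof (rule that[of "far + near"])
    show "0 \<le> far + near" using pos by simp
    fix h :: real and u :: "real^'d" assume h: "0 < h" and u: "norm u + 2 * real m * h < \<rho>"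
    let ?w = "(h + norm u) powr ?e"
    have hu: "0 < h + norm u" using h by (simp add: add_pos_nonneg)
    have small: "norm v < \<rho>" if "norm (v - u) \<le> real (2 * m) * h" for v
      using norm_triangle_ineq[of u "v - u"] that u by simp
    have "(laplacian h ^^ (2 * m)) cov u = (laplacian h ^^ (2 * m)) (\<lambda>u. (\<Sum>i<2*m. p i * norm u ^ (2 * i)) + f u) u"
      using h by (intro laplacian_power_cong cov small) auto
    also have "\<dots> = (laplacian h ^^ (2 * m)) f u"
      unfolding laplacian_power_add by (simp add: laplacian_power_norm_poly[OF h])
    finally have eq: "(laplacian h ^^ (2 * m)) cov u = (laplacian h ^^ (2 * m)) f u" .
    have "\<bar>(laplacian h ^^ (2 * m)) f u\<bar> \<le> far * ?w \<or> \<bar>(laplacian h ^^ (2 * m)) f u\<bar> \<le> near * ?w"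
    proof (cases "4 * real m * h \<le> norm u")
      case True
      have mh: "0 < real m * h" using h assms(3) by simp
      have "\<bar>(laplacian h ^^ (2 * m)) f u\<bar> \<le> (2 * real CARD('d)) ^ (2 * m) * (C1 * (norm u / 2) powr ?e)"
      proof (rule laplacian_power_partials_bound[OF h C1(2)])
        fix v assume v: "norm (v - u) \<le> real (2 * m) * h"
        have "norm u / 2 \<le> norm v" using norm_triangle_ineq2[of u "u - v"] v True
          by (simp add: norm_minus_commute)
        moreover have "0 < norm u / 2" using True mh by linarith
        ultimately show "v \<in> punctured_ball \<rho> \<and> C1 * norm v powr ?e \<le> C1 * (norm u / 2) powr ?e"
          using small[OF v] C1(1) assms(2)
          by (auto simp: punctured_ball_def intro!: mult_left_mono powr_mono2')
      qed
      also have "(norm u / 2) powr ?e \<le> ((h + norm u) * (1 / 4)) powr ?e"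
      proof (rule powr_mono2')
        have "h \<le> 4 * real m * h" using h assms(3) by simp
        then have "h \<le> norm u" using True by (rule order_trans)
        then show "(h + norm u) * (1 / 4) \<le> norm u / 2" by simp
      qed (use hu assms(2) in auto)
      then have "(2 * real CARD('d)) ^ (2 * m) * (C1 * (norm u / 2) powr ?e) \<le>
          (2 * real CARD('d)) ^ (2 * m) * (C1 * ((h + norm u) * (1 / 4)) powr ?e)"
        using C1(1) by (intro mult_left_mono) auto
      also have "\<dots> = far * ?w" unfolding far_def using hu by (subst powr_mult) auto
      finally show ?thesis by blast
    next
      case False
      have "\<bar>(laplacian h ^^ (2 * m)) f u\<bar> \<le> A * (C0 * (6 * real m * h) powr \<gamma>) / h ^ (2 * (2 * m))"
      proof (rule A(2)[OF h])
        fix v assume v: "norm (v - u) \<le> real (2 * m) * h"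
        have "norm v \<le> 6 * real m * h" using norm_triangle_ineq[of u "v - u"] v False by simp
        then have "C0 * norm v powr \<gamma> \<le> C0 * (6 * real m * h) powr \<gamma>"
          using C0(1) assms(1) by (intro mult_left_mono powr_mono2) auto
        moreover have "\<bar>f v\<bar> \<le> C0 * norm v powr \<gamma>"
          using C0(2)[of v] small[OF v] f(2) by (cases "v = 0") (auto simp: punctured_ball_def)
        ultimately show "\<bar>f v\<bar> \<le> C0 * (6 * real m * h) powr \<gamma>" by linarith
      qed (use C0(1) in simp)
      also have "\<dots> = A * (C0 * (6 * real m) powr \<gamma>) * h powr ?e"
      proof -
        have "h powr ?e = h powr \<gamma> / h ^ (2 * (2 * m))"
          using h by (simp add: powr_diff flip: powr_realpow)
        then show ?thesis using h by (simp add: powr_mult)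
      qed
      also have "\<dots> \<le> A * (C0 * (6 * real m) powr \<gamma>) * ((h + norm u) * (1 / (4 * real m + 1))) powr ?e"
      proof (intro mult_left_mono powr_mono2')
        show "(h + norm u) * (1 / (4 * real m + 1)) \<le> h" using False by (simp add: field_simps)
        show "0 < (h + norm u) * (1 / (4 * real m + 1))" using hu by (intro mult_pos_pos) auto
      qed (use assms(2) A(1) C0(1) in auto)
      also have "\<dots> = near * ?w" unfolding near_def using hu by (subst powr_mult) auto
      finally show ?thesis by blast
    qed
    moreover have "0 \<le> far * ?w" "0 \<le> near * ?w" using pos by auto
    ultimately show "\<bar>(laplacian h ^^ (2 * m)) cov u\<bar> \<le> (far + near) * ?w"
      unfolding eq distrib_right by linarith
  qed
qed

text \<open>At the point \<open>h *\<^sub>R x\<close> the stencil evaluates \<open>f\<close> at h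
  times fixed points, and h^(-a) f(h y) tends to c |y|^a for each of them.\<close>

lemma laplacian_power_scaling_limit:
  fixes f cov :: "real^'d \<Rightarrow> real"
  assumes "0 < \<rho>" "0 < a"
    and cov: "\<And>u. norm u < \<rho> \<Longrightarrow> cov u = (\<Sum>i<2*m. p i * norm u ^ (2 * i)) + f u"
    and f: "\<And>\<epsilon>. 0 < \<epsilon> \<Longrightarrow> \<exists>\<delta>>0. \<forall>u. norm u < \<delta> \<longrightarrow> \<bar>f u - c * norm u powr a\<bar> \<le> \<epsilon> * norm u powr a"
  shows "((\<lambda>h. h powr (4 * real m - a) * (laplacian h ^^ (2 * m)) cov (h *\<^sub>R x)) \<longlongrightarrow>
    c * (laplacian 1 ^^ (2 * m)) (\<lambda>u. norm u powr a) x) (at_right 0)"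
proof -
  have pt: "((\<lambda>h. h powr - a * f (h *\<^sub>R y)) \<longlongrightarrow> c * norm y powr a) (at_right 0)" for y
  proof (rule tendstoI)
    fix \<epsilon> :: real assume \<epsilon>: "0 < \<epsilon>"
    \<comment> \<open>The added 1 keeps the denominator positive for \<open>y = 0\<close>.\<close>
    define \<eta> where "\<eta> = \<epsilon> / (2 * (norm y powr a + 1))"
    have n: "0 < norm y powr a + 1" by (simp add: add_nonneg_pos)
    have \<eta>: "0 < \<eta>" using \<epsilon> n by (simp add: \<eta>_def)
    obtain \<delta> where \<delta>: "0 < \<delta>" "\<And>u. norm u < \<delta> \<Longrightarrow> \<bar>f u - c * norm u powr a\<bar> \<le> \<eta> * norm u powr a"
      using f[OF \<eta>] by blast
    have "\<forall>\<^sub>F h in at_right 0. 0 < h \<and> h < \<delta> / (norm y + 1)"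
      using \<delta>(1) by (auto simp: eventually_at_right_field add_nonneg_pos intro!: exI[of _ "\<delta> / (norm y + 1)"])
    then show "\<forall>\<^sub>F h in at_right 0. dist (h powr - a * f (h *\<^sub>R y)) (c * norm y powr a) < \<epsilon>"
    proof eventually_elim
      case (elim h)
      have "h * (norm y + 1) < \<delta>" using elim by (simp add: pos_less_divide_eq add_nonneg_pos)
      then have "norm (h *\<^sub>R y) < \<delta>" using elim by (simp add: algebra_simps)
      from \<delta>(2)[OF this] have b: "\<bar>f (h *\<^sub>R y) - c * (h powr a * norm y powr a)\<bar> \<le> \<eta> * (h powr a * norm y powr a)"
        using elim by (simp add: powr_mult)
      have one: "h powr - a * h powr a = 1" using elim by (simp flip: powr_add)
      have "h powr - a * f (h *\<^sub>R y) - c * norm y powr a = h powr - a * (f (h *\<^sub>R y) - c * (h powr a * norm y powr a))"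
        using one by (simp add: algebra_simps)
      then have "\<bar>h powr - a * f (h *\<^sub>R y) - c * norm y powr a\<bar> \<le> h powr - a * (\<eta> * (h powr a * norm y powr a))"
        using b by (simp add: abs_mult mult_left_mono)
      also have "\<dots> = \<eta> * norm y powr a" using one by (simp add: algebra_simps)
      also have "\<dots> < \<epsilon>"
        using \<epsilon> n unfolding \<eta>_def by (simp add: field_simps) (smt (verit) mult_nonneg_nonneg powr_ge_zero)
      finally show ?case by (simp add: dist_real_def)
    qed
  qed
  obtain J :: "(real^'d) set" and b
    where J: "finite J" "\<And>v. v \<in> J \<Longrightarrow> norm v \<le> real (2 * m)" "\<And>v i. v \<in> J \<Longrightarrow> v $ i \<in> \<int>"
    and eq: "\<And>h f u. (laplacian h ^^ (2 * m)) f u = (\<Sum>v\<in>J. b v * f (u + h *\<^sub>R v)) / h ^ (2 * (2 * m))"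
    by (rule laplacian_power_stencil) (rule that)
  have "((\<lambda>h. \<Sum>v\<in>J. b v * (h powr - a * f (h *\<^sub>R (x + v)))) \<longlongrightarrow> (\<Sum>v\<in>J. b v * (c * norm (x + v) powr a))) (at_right 0)"
    by (intro tendsto_intros pt)
  also have "(\<Sum>v\<in>J. b v * (c * norm (x + v) powr a)) = c * (laplacian 1 ^^ (2 * m)) (\<lambda>u. norm u powr a) x"
    unfolding eq by (simp add: sum_distrib_left mult_ac)
  finally have lim: "((\<lambda>h. \<Sum>v\<in>J. b v * (h powr - a * f (h *\<^sub>R (x + v)))) \<longlongrightarrow>
      c * (laplacian 1 ^^ (2 * m)) (\<lambda>u. norm u powr a) x) (at_right 0)" .
  have "\<forall>\<^sub>F h in at_right 0. 0 < h \<and> h < \<rho> / (norm x + 2 * real m + 1)"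
    using assms(1) by (auto simp: eventually_at_right_field add_nonneg_pos intro!: exI[of _ "\<rho> / (norm x + 2 * real m + 1)"])
  then have "\<forall>\<^sub>F h in at_right 0. (\<Sum>v\<in>J. b v * (h powr - a * f (h *\<^sub>R (x + v)))) =
      h powr (4 * real m - a) * (laplacian h ^^ (2 * m)) cov (h *\<^sub>R x)"
  proof eventually_elim
    case (elim h)
    then have h: "0 < h" and "h * (norm x + 2 * real m + 1) < \<rho>"
      by (simp_all add: pos_less_divide_eq add_nonneg_pos)
    then have hx: "norm (h *\<^sub>R x) + real (2 * m) * h < \<rho>" by (simp add: algebra_simps)
    have small: "norm v < \<rho>" if "norm (v - h *\<^sub>R x) \<le> real (2 * m) * h" for v
      using norm_triangle_ineq[of "h *\<^sub>R x" "v - h *\<^sub>R x"] that hx by simp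
    have "(laplacian h ^^ (2 * m)) cov (h *\<^sub>R x) =
        (laplacian h ^^ (2 * m)) (\<lambda>u. (\<Sum>i<2*m. p i * norm u ^ (2 * i)) + f u) (h *\<^sub>R x)"
      using h by (intro laplacian_power_cong cov small) auto
    also have "\<dots> = (laplacian h ^^ (2 * m)) f (h *\<^sub>R x)"
      unfolding laplacian_power_add by (simp add: laplacian_power_norm_poly[OF h])
    also have "\<dots> = (\<Sum>v\<in>J. b v * f (h *\<^sub>R (x + v))) / h ^ (2 * (2 * m))"
      unfolding eq by (simp add: scaleR_add_right)
    finally have L: "(laplacian h ^^ (2 * m)) cov (h *\<^sub>R x) = (\<Sum>v\<in>J. b v * f (h *\<^sub>R (x + v))) / h ^ (2 * (2 * m))" .
    have "h powr (4 * real m - a) = h ^ (2 * (2 * m)) * h powr - a"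
      using h by (simp add: powr_diff powr_minus divide_simps flip: powr_realpow)
    then show ?case unfolding L using h by (simp add: sum_distrib_left sum_divide_distrib mult_ac)
  qed
  from Lim_transform_eventually[OF lim this] show ?thesis .
qed

text \<open>Near 0 the function behaves like its leading term l z^k. Comparing moduli along the
  positive axis forces a = k; comparing the limits from the right and from the left then forces
  (-1)^k = 1, so \<open>a\<close> would be an even integer.\<close>

lemma abs_powr_not_analytic:
  fixes G :: "complex \<Rightarrow> complex"
  assumes F: "G has_fps_expansion F" and "b \<noteq> 0" "0 < a" "\<nexists>j::int. a = 2 * of_int j"
    and G: "\<And>t::real. G (of_real t) = of_real (b * \<bar>t\<bar> powr a)"
  shows False
proof (cases "F = 0")
  case True
  then have "\<forall>\<^sub>F z in nhds 0. G z = 0" using F by (simp add: has_fps_expansion_0_iff)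
  then obtain e where e: "0 < e" "\<And>z. dist z 0 < e \<Longrightarrow> G z = 0"
    by (auto simp: eventually_nhds_metric)
  have "G (of_real (e / 2)) = 0" using e(1) by (intro e(2)) simp
  then show False using assms(2) e(1) unfolding G by simp
next
  case False
  define k where "k = subdegree F"
  define l where "l = fps_nth F k"
  have l: "l \<noteq> 0" using False by (simp add: l_def k_def)
  have "G \<sim>[at 0] (\<lambda>z. l * z ^ k)"
    using has_fps_expansion_imp_asymp_equiv_0[OF F] by (simp add: l_def k_def asymp_equiv_nhds_iff)
  moreover have "\<forall>\<^sub>F z in at 0. G z \<noteq> 0 \<or> l * z ^ k \<noteq> 0"
    by (rule eventually_mono[of "\<lambda>z. z \<noteq> 0"]) (use l in \<open>auto simp: eventually_at_filter\<close>)
  ultimately have lim': "((\<lambda>z. G z / (l * z ^ k)) \<longlongrightarrow> 1) (at 0)"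
    by (rule asymp_equivD_strong)
  then have lim: "((\<lambda>z. norm (G z / (l * z ^ k))) \<longlongrightarrow> norm (1::complex)) (at 0)"
    by (rule tendsto_norm)
  have sub: "filterlim (\<lambda>t. of_real t :: complex) (at 0) (at_right 0)"
    "filterlim (\<lambda>t. - of_real t :: complex) (at 0) (at_right 0)"
    by (auto simp: filterlim_at eventually_at_filter intro!: tendsto_eq_intros)
  have "((\<lambda>t. \<bar>b\<bar> / norm l * t powr (a - real k)) \<longlongrightarrow> 1) (at_right 0)"
  proof (rule Lim_transform_eventually)
    show "((\<lambda>t. norm (G (of_real t) / (l * of_real t ^ k))) \<longlongrightarrow> 1) (at_right 0)"
      using filterlim_compose[OF lim sub(1)] by simp
    show "\<forall>\<^sub>F t in at_right 0. norm (G (of_real t) / (l * of_real t ^ k)) = \<bar>b\<bar> / norm l * t powr (a - real k)"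
      unfolding G using eventually_at_right_less
      by (auto simp: eventually_at_filter norm_divide norm_mult norm_power powr_diff powr_realpow abs_mult)
  qed
  then have lim1: "((\<lambda>t. t powr (a - real k)) \<longlongrightarrow> norm l / \<bar>b\<bar>) (at_right 0)"
    using tendsto_mult_left[of "\<lambda>t. \<bar>b\<bar> / norm l * t powr (a - real k)" 1 "at_right 0" "norm l / \<bar>b\<bar>"] l assms(2)
    by simp
  have ak: "a = real k"
  proof (rule ccontr)
    assume "a \<noteq> real k"
    then consider "0 < a - real k" | "a - real k < 0" by linarith
    then show False
    proof cases
      case 1
      then have "((\<lambda>t::real. t powr (a - real k)) \<longlongrightarrow> 0) (at_right 0)" by real_asymp
      from tendsto_unique[OF _ this lim1] l assms(2) show False by simp
    next
      case 2
      then have "filterlim (\<lambda>t::real. t powr (a - real k)) at_top (at_right 0)" by real_asymp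
      from not_tendsto_and_filterlim_at_infinity[OF _ lim1] this show False
        by (simp add: filterlim_at_top_imp_at_infinity)
    qed
  qed
  have "((\<lambda>t. of_real b / l :: complex) \<longlongrightarrow> 1) (at_right (0::real))"
  proof (rule Lim_transform_eventually[OF filterlim_compose[OF lim' sub(1)]])
    show "\<forall>\<^sub>F t in at_right 0. G (of_real t) / (l * of_real t ^ k) = of_real b / l"
      unfolding G ak by (auto simp: eventually_at_filter powr_realpow)
  qed
  then have 1: "of_real b / l = (1::complex)" by (simp add: tendsto_const_iff)
  have "((\<lambda>t. of_real b / (l * (- 1) ^ k) :: complex) \<longlongrightarrow> 1) (at_right (0::real))"
  proof (rule Lim_transform_eventually[OF filterlim_compose[OF lim' sub(2)]])
    have "G (- of_real t) = of_real (b * \<bar>t\<bar> powr a)" for t using G[of "- t"] by simp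
    then show "\<forall>\<^sub>F t in at_right 0. G (- of_real t) / (l * (- of_real t) ^ k) = of_real b / (l * (- 1) ^ k)"
      unfolding ak by (auto simp: eventually_at_filter powr_realpow power_minus[of "of_real _"])
  qed
  then have "of_real b / (l * (- 1) ^ k) = (1::complex)" by (simp add: tendsto_const_iff)
  with 1 l have "(- 1) ^ k = (1::complex)" by (simp add: field_simps)
  then have "even k" by (cases "even k") auto
  then obtain j where "k = 2 * j" by (elim evenE)
  then have "a = 2 * of_int (int j)" using ak by simp
  then show False using assms(4) by blast
qed

text \<open>Multiplication by \<open>sign v = \<Prod>\<^sub>i cos (\<pi> v\<^sub>i)\<close>, which changes sign under unit shifts, turns the
  Laplacian into minus a positive operator; hence its powers have a nonzero central coefficient.\<close>
lemma laplacian_power_indicator_0: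
  "(laplacian 1 ^^ k) (\<lambda>v::real^'d. if v = 0 then 1 else 0) 0 \<noteq> 0"
proof -
  define sign where "sign v = (\<Prod>i\<in>UNIV. cos (pi * v $ i))" for v :: "real^'d"
  define Q where "Q F v = (\<Sum>g\<in>UNIV. F (v + axis g 1) + F (v - axis g 1) + 2 * F v)"
    for F :: "real^'d \<Rightarrow> real" and v
  define \<delta> where "\<delta> v = (if v = 0 then 1 else 0 :: real)" for v :: "real^'d"
  have shift: "sign (v + axis g 1) = - sign v" for v g
  proof -
    have "sign (v + axis g 1) = (\<Prod>i\<in>UNIV. (if i = g then - 1 else 1) * cos (pi * v $ i))"
      unfolding sign_def by (intro prod.cong refl) (auto simp: axis_def distrib_left)
    then show ?thesis by (simp add: prod.distrib sign_def)
  qed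
  have shift': "sign (v - axis g 1) = - sign v" for v g
    using shift[of "v - axis g 1" g] by simp
  have lap: "laplacian 1 (\<lambda>v. r * (sign v * F v)) = (\<lambda>v. (- r) * (sign v * Q F v))" for r F
  proof
    fix v
    have "laplacian 1 (\<lambda>v. r * (sign v * F v)) v =
        (\<Sum>g\<in>UNIV. (- r) * (sign v * (F (v + axis g 1) + F (v - axis g 1) + 2 * F v)))"
      unfolding laplacian_def power_one div_by_1 scaleR_one
      by (intro sum.cong refl) (simp add: shift shift' algebra_simps)
    then show "laplacian 1 (\<lambda>v. r * (sign v * F v)) v = (- r) * (sign v * Q F v)"
      by (simp add: Q_def sum_distrib_left)
  qed
  have pow: "(laplacian 1 ^^ k) (\<lambda>v. 1 * (sign v * \<delta> v)) = (\<lambda>v. (- 1) ^ k * (sign v * (Q ^^ k) \<delta> v))"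
    by (induction k) (simp_all only: funpow.simps o_apply id_apply power_0 lap power_Suc mult_minus1)
  have Q0: "(\<forall>v. 0 \<le> (Q ^^ k) \<delta> v) \<and> 0 < (Q ^^ k) \<delta> 0"
  proof (induction k)
    case (Suc k)
    have "0 \<le> Q ((Q ^^ k) \<delta>) v" for v
      unfolding Q_def[of "(Q ^^ k) \<delta>"] using Suc by (intro sum_nonneg add_nonneg_nonneg) auto
    moreover have "0 < Q ((Q ^^ k) \<delta>) 0"
      unfolding Q_def[of "(Q ^^ k) \<delta>"] using Suc by (intro sum_pos add_nonneg_pos add_nonneg_nonneg) auto
    ultimately show ?case by simp
  qed (simp add: \<delta>_def)
  have sign0: "sign 0 = 1" by (simp add: sign_def)
  then have "(\<lambda>v. 1 * (sign v * \<delta> v)) = \<delta>" by (auto simp: \<delta>_def)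
  then have "(laplacian 1 ^^ k) \<delta> 0 = (- 1) ^ k * (sign 0 * (Q ^^ k) \<delta> 0)" using pow by metis
  then have "(laplacian 1 ^^ k) \<delta> 0 \<noteq> 0" using Q0 sign0 by simp
  then show ?thesis by (simp add: \<delta>_def[abs_def])
qed

text \<open>On a coordinate line through the origin every stencil term except the central one is
  analytic near 0. If the sum vanished identically, the central term, a nonzero multiple of |t|^a,
  would be analytic too.\<close>

lemma laplacian_power_norm_powr_not_0:
  assumes "0 < a" "\<nexists>j::int. a = 2 * of_int j"
  shows "\<exists>x::real^'d. (laplacian 1 ^^ k) (\<lambda>u. norm u powr a) x \<noteq> 0"
proof (rule ccontr)
  assume "\<nexists>x::real^'d. (laplacian 1 ^^ k) (\<lambda>u. norm u powr a) x \<noteq> 0"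
  then have zero: "(laplacian 1 ^^ k) (\<lambda>u. norm u powr a) x = 0" for x :: "real^'d" by blast
  obtain J :: "(real^'d) set" and b
    where J: "finite J" "\<And>v. v \<in> J \<Longrightarrow> norm v \<le> real k" "\<And>v i. v \<in> J \<Longrightarrow> v $ i \<in> \<int>"
    and eq: "\<And>h f u. (laplacian h ^^ k) f u = (\<Sum>v\<in>J. b v * f (u + h *\<^sub>R v)) / h ^ (2 * k)"
    by (rule laplacian_power_stencil) (rule that)
  \<comment> \<open>The central coefficient, read off by applying the stencil to the indicator of
    the origin.\<close>
  define b0 where "b0 = (\<Sum>v\<in>J. b v * (if v = 0 then 1 else 0))"
  have b0: "b0 \<noteq> 0"
    using laplacian_power_indicator_0[of k, where 'd = 'd] unfolding eq b0_def by simp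
  have b0': "b0 = (if 0 \<in> J then b 0 else 0)" unfolding b0_def using J(1) by (simp add: if_distrib cong: if_cong)
  then have "0 \<in> J" "b 0 = b0" using b0 by (auto split: if_splits)
  fix g :: 'd
  \<comment> \<open>The noncentral terms, with |t e_g + v|^2 written as a polynomial in
    \<open>t\<close> so that it extends to complex arguments.\<close>
  define G where "G z = (\<Sum>v\<in>J - {0}. of_real (b v) *
      (z\<^sup>2 + 2 * z * of_real (v $ g) + of_real ((norm v)\<^sup>2)) powr of_real (a / 2))" for z :: complex
  have "G (of_real t) = of_real ((- b0) * \<bar>t\<bar> powr a)" for t :: real
  proof -
    have nrm: "norm (t *\<^sub>R axis g 1 + v) powr a = (t\<^sup>2 + 2 * t * v $ g + (norm v)\<^sup>2) powr (a / 2)" for v :: "real^'d"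
    proof -
      have "t\<^sup>2 + 2 * t * v $ g + (norm v)\<^sup>2 = (norm (t *\<^sub>R axis g 1 + v))\<^sup>2"
        unfolding power2_norm_eq_inner
        by (simp add: inner_add_left inner_add_right inner_axis inner_axis' power2_eq_square inner_commute)
      moreover have "((norm w)\<^sup>2) powr (a / 2) = norm w powr a" for w :: "real^'d"
        by (cases "w = 0") (use assms(1) in \<open>simp_all add: powr_powr flip: powr_numeral\<close>)
      ultimately show ?thesis by simp
    qed
    have "0 = (\<Sum>v\<in>J. b v * norm (t *\<^sub>R axis g 1 + v) powr a)"
      using zero[of "t *\<^sub>R axis g 1"] unfolding eq by simp
    also have "\<dots> = b 0 * norm (t *\<^sub>R axis g 1 + 0 :: real^'d) powr a +
        (\<Sum>v\<in>J - {0}. b v * norm (t *\<^sub>R axis g 1 + v) powr a)"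
      by (rule sum.remove[OF J(1) \<open>0 \<in> J\<close>])
    finally have s: "(\<Sum>v\<in>J - {0}. b v * (t\<^sup>2 + 2 * t * v $ g + (norm v)\<^sup>2) powr (a / 2)) = - b0 * \<bar>t\<bar> powr a"
      unfolding nrm[symmetric] by (simp add: \<open>b 0 = b0\<close> norm_axis_1)
    have "(of_real t)\<^sup>2 + 2 * of_real t * of_real (v $ g) + of_real ((norm v)\<^sup>2) =
        (of_real (t\<^sup>2 + 2 * t * v $ g + (norm v)\<^sup>2) :: complex)" for v :: "real^'d" by simp
    moreover have "0 \<le> t\<^sup>2 + 2 * t * v $ g + (norm v)\<^sup>2" for v :: "real^'d"
    proof -
      have "t\<^sup>2 + 2 * t * v $ g + (norm v)\<^sup>2 = (norm (t *\<^sub>R axis g 1 + v))\<^sup>2"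
        unfolding power2_norm_eq_inner
        by (simp add: inner_add_left inner_add_right inner_axis inner_axis' power2_eq_square inner_commute)
      then show ?thesis by simp
    qed
    ultimately have "G (of_real t) = of_real (\<Sum>v\<in>J - {0}. b v * (t\<^sup>2 + 2 * t * v $ g + (norm v)\<^sup>2) powr (a / 2))"
      unfolding G_def by (simp only: powr_of_real of_real_sum of_real_mult)
    then show ?thesis unfolding s .
  qed
  \<comment> \<open>At z = 0 the base of each power is |v|^2 > 0, off the branch cut, because
    \<open>v = 0\<close> has been removed.\<close>
  moreover have "G analytic_on {0}"
    unfolding G_def by (intro analytic_intros) (auto simp: complex_nonpos_Reals_iff)
  then obtain F where "G has_fps_expansion F"
    using analytic_at_imp_has_fps_expansion_0 by blast
  ultimately show False using abs_powr_not_analytic[of G F "- b0" a] b0 assms by auto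
qed

subsection \<open>Sums over the grid\<close>

definition lattice_point :: "real \<Rightarrow> ('d \<Rightarrow> nat) \<Rightarrow> real^'d" where
  "lattice_point h k = (\<chi> i. real (k i) * h)"

text \<open>Indexing by integer vectors lets sums over the grid factor over the coordinates. For
  \<open>n < 2 * m\<close> the interval \<open>{m..n - m}\<close> with truncated subtraction is
  empty, as is the grid.\<close>

lemma igrid_eq_image:
  assumes "0 < L" "0 < n"
  shows "(igrid L n m :: (real^'d) set) = lattice_point (L / real n) ` (UNIV \<rightarrow>\<^sub>E {m..n - m})"
proof (intro set_eqI iffI)
  fix s :: "real^'d" assume "s \<in> igrid L n m"
  then have "\<forall>i. \<exists>k. m \<le> k \<and> k + m \<le> n \<and> s $ i = real k * (L / real n)"
    unfolding igrid_explicit[OF assms] by blast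
  then obtain k where k: "\<And>i. m \<le> k i \<and> k i + m \<le> n \<and> s $ i = real (k i) * (L / real n)"
    by metis
  then have "s = lattice_point (L / real n) k" by (simp add: lattice_point_def vec_eq_iff)
  moreover have "k \<in> UNIV \<rightarrow>\<^sub>E {m..n - m}" using k by (auto simp: le_diff_conv2 PiE_iff) (metis add_leE le_diff_conv2)
  ultimately show "s \<in> lattice_point (L / real n) ` (UNIV \<rightarrow>\<^sub>E {m..n - m})" by blast
next
  fix s :: "real^'d" assume "s \<in> lattice_point (L / real n) ` (UNIV \<rightarrow>\<^sub>E {m..n - m})"
  then obtain k where k: "s = lattice_point (L / real n) k" "k \<in> UNIV \<rightarrow>\<^sub>E {m..n - m}" by blast
  have ki: "m \<le> k i" "k i \<le> n - m" for i using k(2) by (auto simp: PiE_iff)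
  have "m \<le> k i \<and> k i + m \<le> n" for i using ki[of i] assms(2) by (cases "m \<le> n") auto
  then have "\<exists>j. m \<le> j \<and> j + m \<le> n \<and> s $ i = real j * (L / real n)" for i
    unfolding k(1) lattice_point_def by auto
  then show "s \<in> igrid L n m" unfolding igrid_explicit[OF assms] by blast
qed

lemma inj_lattice_point: "0 < h \<Longrightarrow> inj_on (lattice_point h) A"
  by (rule inj_onI) (auto simp: lattice_point_def vec_eq_iff fun_eq_iff)

lemma finite_igrid: "0 < L \<Longrightarrow> 0 < n \<Longrightarrow> finite (igrid L n m :: (real^'d) set)"
  unfolding igrid_eq_image by (intro finite_imageI finite_PiE) auto

lemma card_igrid:
  assumes "0 < L" "0 < n"
  shows "card (igrid L n m :: (real^'d) set) = (n - m + 1 - m) ^ CARD('d)"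
  unfolding igrid_eq_image[OF assms]
  by (subst card_image[OF inj_lattice_point]) (use assms in \<open>auto simp: card_PiE\<close>)

text \<open>With \<open>4 * m \<le> n\<close> the removed layers take away at most half of each
  side.\<close>

lemma card_igrid_ge:
  assumes "0 < L" "0 < n" "4 * m \<le> n"
  shows "(real n / 2) ^ CARD('d) \<le> real (card (igrid L n m :: (real^'d) set))"
proof -
  have "real n / 2 \<le> real (n - m + 1 - m)" using assms(3) by simp
  then show ?thesis unfolding card_igrid[OF assms(1,2)] of_nat_power by (intro power_mono) auto
qed

text \<open>Comparison with an integral: by the mean value theorem each new term is at most the
  increment of the antiderivative x^(1-q) / (1-q).\<close>

lemma sum_powr_le:
  assumes "0 < q" "q < 1"
  shows "(\<Sum>j\<le>n. (1 + real j) powr - q) \<le> (1 + real n) powr (1 - q) / (1 - q)"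
proof (induction n)
  case 0
  then show ?case using assms by simp
next
  case (Suc n)
  have "\<exists>z>1 + real n. z < 2 + real n \<and> (2 + real n) powr (1 - q) - (1 + real n) powr (1 - q) =
      ((2 + real n) - (1 + real n)) * ((1 - q) * z powr - q)"
    by (rule MVT2) (auto intro!: derivative_eq_intros)
  then obtain z where z: "1 + real n < z" "z < 2 + real n"
    "(2 + real n) powr (1 - q) - (1 + real n) powr (1 - q) = (1 - q) * z powr - q" by auto
  have "(2 + real n) powr - q \<le> z powr - q" using z assms by (intro powr_mono2') auto
  then have "(1 - q) * (2 + real n) powr - q \<le> (2 + real n) powr (1 - q) - (1 + real n) powr (1 - q)"
    unfolding z(3) using assms by (intro mult_left_mono) auto
  then have "(2 + real n) powr - q \<le> (2 + real n) powr (1 - q) / (1 - q) - (1 + real n) powr (1 - q) / (1 - q)"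
    using assms by (simp add: pos_le_divide_eq mult.commute flip: diff_divide_distrib)
  then show ?case using Suc.IH by (simp add: algebra_simps)
qed

text \<open>Each distance from \<open>k0\<close> occurs at most twice, once on either side.\<close>

lemma sum_abs_diff_le:
  fixes F :: "nat \<Rightarrow> real"
  assumes "\<And>j. 0 \<le> F j" "k0 \<le> n" "finite A" "A \<subseteq> {..n}"
  shows "(\<Sum>k\<in>A. F (nat \<bar>int k0 - int k\<bar>)) \<le> 2 * (\<Sum>j\<le>n. F j)"
proof -
  let ?g = "\<lambda>k. nat \<bar>int k0 - int k\<bar>"
  have part: "(\<Sum>k\<in>B. F (?g k)) \<le> (\<Sum>j\<le>n. F j)" if B: "finite B" "inj_on ?g B" "B \<subseteq> {..n}" for B
  proof -
    have "(\<Sum>k\<in>B. F (?g k)) = (\<Sum>j\<in>?g ` B. F j)" by (simp add: sum.reindex[OF B(2)])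
    also have "\<dots> \<le> (\<Sum>j\<le>n. F j)" using B assms(1,2) by (intro sum_mono2) auto
    finally show ?thesis .
  qed
  have "A = (A \<inter> {..k0}) \<union> (A \<inter> {k0<..})" by auto
  then have "(\<Sum>k\<in>A. F (?g k)) = (\<Sum>k\<in>A \<inter> {..k0}. F (?g k)) + (\<Sum>k\<in>A \<inter> {k0<..}. F (?g k))"
    using assms(3) by (metis (no_types, lifting) finite_Int sum.union_disjoint Int_assoc Int_commute
        disjoint_iff greaterThan_iff atMost_iff Int_iff not_le)
  also have "\<dots> \<le> (\<Sum>j\<le>n. F j) + (\<Sum>j\<le>n. F j)"
    using assms(3,4) by (intro add_mono part) (auto simp: inj_on_def)
  finally show ?thesis by simp
qed

text \<open>The singular kernel is bounded by a product of one-dimensional kernels, each of which is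
  summable up to order \<open>n\<close> because its exponent is below \<open>1\<close>.\<close>
lemma igrid_kernel_sum_le:
  assumes "0 < L" "0 < q" "q < 1"
  obtains C where "0 \<le> C" "\<And>n s. 0 < n \<Longrightarrow> s \<in> (igrid L n m :: (real^'d) set) \<Longrightarrow>
    (\<Sum>t\<in>igrid L n m. (L / real n + norm (s - t)) powr - (q * real CARD('d))) \<le> C * real n ^ CARD('d)"
proof -
  \<comment> \<open>One factor 2 counts the two sides of \<open>k0\<close>, the other bounds
    \<open>1 + real n\<close> by \<open>2 * real n\<close>; the power of \<open>L\<close> comes from
    splitting that of the mesh \<open>L / real n\<close>.\<close>
  define C1 where "C1 = 4 * L powr - q / (1 - q)"
  have C1: "0 \<le> C1" using assms by (simp add: C1_def)
  show thesis
  proof (rule that[of "C1 ^ CARD('d)"])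
    fix n and s :: "real^'d" assume n: "0 < n" and s: "s \<in> igrid L n m"
    define h where "h = L / real n"
    have h: "0 < h" using assms n by (simp add: h_def)
    obtain k0 where k0: "s = lattice_point h k0" "k0 \<in> UNIV \<rightarrow>\<^sub>E {m..n - m}"
      using s unfolding igrid_eq_image[OF assms(1) n] h_def by blast
    have k0n: "k0 i \<le> n" for i using k0(2) by (auto simp: PiE_iff intro: order_trans)
    have one: "(\<Sum>k\<in>{m..n - m}. (h + \<bar>real (k0 i) * h - real k * h\<bar>) powr - q) \<le> C1 * real n" for i
    proof -
      have "(h + \<bar>real (k0 i) * h - real k * h\<bar>) powr - q =
          h powr - q * (1 + real (nat \<bar>int (k0 i) - int k\<bar>)) powr - q" for k
      proof -
        have "\<bar>real (k0 i) * h - real k * h\<bar> = h * \<bar>real (k0 i) - real k\<bar>"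
          using h by (simp add: abs_mult mult.commute flip: right_diff_distrib)
        then have "h + \<bar>real (k0 i) * h - real k * h\<bar> = h * (1 + \<bar>real (k0 i) - real k\<bar>)"
          by (simp add: distrib_left)
        moreover have "real (nat \<bar>int (k0 i) - int k\<bar>) = \<bar>real (k0 i) - real k\<bar>" by simp
        ultimately show ?thesis using h by (simp add: powr_mult)
      qed
      then have "(\<Sum>k\<in>{m..n - m}. (h + \<bar>real (k0 i) * h - real k * h\<bar>) powr - q) =
          h powr - q * (\<Sum>k\<in>{m..n - m}. (1 + real (nat \<bar>int (k0 i) - int k\<bar>)) powr - q)"
        by (simp add: sum_distrib_left)
      also have "\<dots> \<le> h powr - q * (2 * (\<Sum>j\<le>n. (1 + real j) powr - q))"
        by (intro mult_left_mono sum_abs_diff_le k0n) auto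
      also have "\<dots> \<le> h powr - q * (2 * ((1 + real n) powr (1 - q) / (1 - q)))"
        by (intro mult_left_mono sum_powr_le assms) auto
      also have "\<dots> \<le> h powr - q * (2 * (2 * real n powr (1 - q) / (1 - q)))"
      proof -
        have "(1 + real n) powr (1 - q) \<le> (2 * real n) powr (1 - q)"
          using n assms by (intro powr_mono2) auto
        also have "\<dots> = 2 powr (1 - q) * real n powr (1 - q)" by (simp add: powr_mult)
        also have "\<dots> \<le> 2 powr 1 * real n powr (1 - q)"
          using assms by (intro mult_right_mono powr_mono) auto
        finally show ?thesis using assms by (intro mult_left_mono divide_right_mono) auto
      qed
      also have "\<dots> = C1 * (real n powr q * real n powr (1 - q))"
        using n assms by (simp add: C1_def h_def powr_divide powr_minus divide_simps)
      also have "real n powr q * real n powr (1 - q) = real n" using n by (simp flip: powr_add)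
      finally show ?thesis .
    qed
    have "(\<Sum>t\<in>igrid L n m. (h + norm (s - t)) powr - (q * real CARD('d))) =
        (\<Sum>k\<in>UNIV \<rightarrow>\<^sub>E {m..n - m}. (h + norm (s - lattice_point h k)) powr - (q * real CARD('d)))"
      unfolding igrid_eq_image[OF assms(1) n] h_def[symmetric]
      by (subst sum.reindex[OF inj_lattice_point[OF h]]) simp
    also have "\<dots> \<le> (\<Sum>k\<in>UNIV \<rightarrow>\<^sub>E {m..n - m}. \<Prod>i\<in>UNIV. (h + \<bar>real (k0 i) * h - real (k i) * h\<bar>) powr - q)"
    proof (rule sum_mono)
      fix k :: "'d \<Rightarrow> nat"
      let ?u = "s - lattice_point h k"
      \<comment> \<open>The exponent is shared out equally among the coordinates; in each factor the
        norm may then be lowered to one coordinate, since the exponent is negative.\<close>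
      have "(h + norm ?u) powr - (q * real CARD('d)) = (\<Prod>i\<in>(UNIV :: 'd set). (h + norm ?u) powr - q)"
      proof -
        have "0 < h + norm ?u" using h by (simp add: add_pos_nonneg)
        then show ?thesis by (simp add: powr_power mult.commute)
      qed
      also have "\<dots> \<le> (\<Prod>i\<in>UNIV. (h + \<bar>?u $ i\<bar>) powr - q)"
        using h assms component_le_norm_cart[of ?u]
        by (intro prod_mono conjI powr_mono2') (auto intro: add_pos_nonneg)
      finally show "(h + norm ?u) powr - (q * real CARD('d)) \<le>
          (\<Prod>i\<in>UNIV. (h + \<bar>real (k0 i) * h - real (k i) * h\<bar>) powr - q)"
        by (simp add: k0(1) lattice_point_def)
    qed
    also have "\<dots> = (\<Prod>i\<in>UNIV. \<Sum>k\<in>{m..n - m}. (h + \<bar>real (k0 i) * h - real k * h\<bar>) powr - q)"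
      by (subst prod_sum_PiE) auto
    also have "\<dots> \<le> (\<Prod>i\<in>(UNIV :: 'd set). C1 * real n)"
      by (intro prod_mono conjI one sum_nonneg) auto
    finally show "(\<Sum>t\<in>igrid L n m. (L / real n + norm (s - t)) powr - (q * real CARD('d))) \<le> C1 ^ CARD('d) * real n ^ CARD('d)"
      by (simp add: power_mult_distrib h_def)
  qed (use C1 in simp)
qed

text \<open>The partition is fixed before the grid, so the number of cells is bounded uniformly in
  \<open>n\<close>.\<close>

lemma cube_cells:
  assumes "0 < L" "0 < \<delta>"
  obtains cell :: "real^'d \<Rightarrow> 'd \<Rightarrow> nat" and Q
  where "finite Q" "\<And>n m. 0 < n \<Longrightarrow> cell ` igrid L n m \<subseteq> Q"
    "\<And>n m s t. 0 < n \<Longrightarrow> s \<in> igrid L n m \<Longrightarrow> t \<in> igrid L n m \<Longrightarrow> cell t = cell s \<Longrightarrow> norm (s - t) \<le> \<delta>"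
proof -
  \<comment> \<open>With this side length the sum of the coordinate differences within a cell, and
    hence the norm, is at most \<open>\<delta>\<close>.\<close>
  define \<eta> where "\<eta> = \<delta> / real CARD('d)"
  have \<eta>: "0 < \<eta>" using assms by (simp add: \<eta>_def)
  define cell where "cell s i = nat \<lfloor>s $ i / \<eta>\<rfloor>" for s :: "real^'d" and i
  define Q where "Q = (UNIV :: 'd set) \<rightarrow>\<^sub>E {..nat \<lfloor>L / \<eta>\<rfloor>}"
  have range: "0 \<le> s $ i \<and> s $ i \<le> L" if s: "0 < n" "s \<in> igrid L n m" for s :: "real^'d" and n m i
  proof -
    obtain k where k: "k + m \<le> n" "s $ i = real k * (L / real n)"
      using s(2) unfolding igrid_explicit[OF assms(1) s(1)] by blast
    have "real k * (L / real n) \<le> real n * (L / real n)"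
      using k(1) assms(1) by (intro mult_right_mono) auto
    then show ?thesis using k(2) s(1) assms(1) by simp
  qed
  show thesis
  proof (rule that[of Q cell])
    show "finite Q" unfolding Q_def by (intro finite_PiE) auto
    show "cell ` igrid L n m \<subseteq> Q" if "0 < n" for n m
      using range[OF that] \<eta> by (auto simp: Q_def cell_def intro!: nat_mono floor_mono divide_right_mono)
    fix n m and s t :: "real^'d"
    assume n: "0 < n" and s: "s \<in> igrid L n m" and t: "t \<in> igrid L n m" and c: "cell t = cell s"
    have "\<bar>(s - t) $ i\<bar> \<le> \<eta>" for i
    proof -
      have "nat \<lfloor>t $ i / \<eta>\<rfloor> = nat \<lfloor>s $ i / \<eta>\<rfloor>" using c by (metis cell_def)
      moreover have "0 \<le> \<lfloor>t $ i / \<eta>\<rfloor>" "0 \<le> \<lfloor>s $ i / \<eta>\<rfloor>" using range[OF n s, of i] range[OF n t, of i] \<eta> by auto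
      ultimately have "\<lfloor>t $ i / \<eta>\<rfloor> = \<lfloor>s $ i / \<eta>\<rfloor>" by (simp add: eq_nat_nat_iff)
      then have "\<bar>s $ i / \<eta> - t $ i / \<eta>\<bar> \<le> 1" by linarith
      then have "\<bar>s $ i - t $ i\<bar> / \<eta> \<le> 1" using \<eta> by (simp flip: diff_divide_distrib)
      then show ?thesis using \<eta> by simp
    qed
    then have "(\<Sum>i\<in>UNIV. \<bar>(s - t) $ i\<bar>) \<le> (\<Sum>i\<in>(UNIV :: 'd set). \<eta>)" by (intro sum_mono)
    also have "\<dots> = \<delta>" by (simp add: \<eta>_def)
    finally show "norm (s - t) \<le> \<delta>" using norm_le_l1_cart order_trans by blast
  qed
qed

text \<open>The exponent \<open>\<theta> = q d\<close> traded between the mesh size and the kernel has to satisfy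
  \<open>\<gamma> - \<gamma>' < \<theta> < d\<close>, which is where \<open>\<gamma> < \<gamma>' + d\<close> is used.\<close>
lemma normalized_cell_sum_tendsto_0:
  fixes \<sigma> \<tau> :: "nat \<Rightarrow> real^'d \<Rightarrow> real" and v :: "nat \<Rightarrow> real" and cell :: "real^'d \<Rightarrow> 'c"
  assumes L: "0 < L" and \<gamma>: "\<gamma> < K" "\<gamma>' \<le> K" "\<gamma> < \<gamma>' + real CARD('d)"
    and \<sigma>: "\<forall>\<^sub>F n in sequentially. \<forall>u. norm u \<le> \<delta> \<longrightarrow> \<bar>\<sigma> n u\<bar> \<le> C * (L / real n + norm u) powr (\<gamma> - K)"
    and \<tau>: "\<forall>\<^sub>F n in sequentially. \<forall>u. norm u \<le> \<delta> \<longrightarrow> \<bar>\<tau> n u\<bar> \<le> C' * (L / real n + norm u) powr (\<gamma>' - K)"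
    and C: "0 \<le> C" "0 \<le> C'"
    and v: "(\<lambda>n. (L / real n) powr (K - \<gamma>) * v n) \<longlonglongrightarrow> \<kappa>" "0 < \<kappa>"
    and cell: "\<And>n s t. 0 < n \<Longrightarrow> s \<in> igrid L n m \<Longrightarrow> t \<in> igrid L n m \<Longrightarrow> cell t = cell s \<Longrightarrow> norm (s - t) \<le> \<delta>"
  shows "(\<lambda>n. (\<Sum>s\<in>igrid L n m. \<Sum>t\<in>{t\<in>igrid L n m. cell t = cell s}. \<bar>\<sigma> n (s - t) * \<tau> n (s - t)\<bar>) /
      (real (card (igrid L n m :: (real^'d) set)) * v n)\<^sup>2) \<longlonglongrightarrow> 0"
proof -
  let ?d = "real CARD('d)" and ?G = "\<lambda>n. igrid L n m :: (real^'d) set" and ?h = "\<lambda>n. L / real n"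
  have d: "0 < ?d" by simp
  \<comment> \<open>Beyond the two bounds named above, \<theta> must be below
    \<open>2 * K - \<gamma> - \<gamma>'\<close>: what is left of the kernel then has a negative
    exponent and is largest at \<open>u = 0\<close>, where it is a power of the mesh.\<close>
  have "\<exists>\<theta>. max 0 (\<gamma> - \<gamma>') < \<theta> \<and> \<theta> < min ?d (2 * K - \<gamma> - \<gamma>')"
    using \<gamma> d by (intro dense) auto
  then obtain \<theta> where \<theta>: "0 < \<theta>" "\<gamma> - \<gamma>' < \<theta>" "\<theta> < ?d" "\<theta> < 2 * K - \<gamma> - \<gamma>'" by auto
  define q where "q = \<theta> / ?d"
  have q: "0 < q" "q < 1" "q * ?d = \<theta>" using \<theta> d by (auto simp: q_def)
  obtain C2 where C2: "0 \<le> C2" "\<And>n s. 0 < n \<Longrightarrow> s \<in> ?G n \<Longrightarrow>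
    (\<Sum>t\<in>?G n. (?h n + norm (s - t)) powr - \<theta>) \<le> C2 * real n ^ CARD('d)"
    using igrid_kernel_sum_le[OF L q(1,2), of m, where 'd = 'd] unfolding q(3) by metis
  \<comment> \<open>The power of 2 bounds n^d by the number of grid points, and
    \<open>2 / \<kappa>\<close> bounds the reciprocal of the normalized variance, eventually above
    \<open>\<kappa> / 2\<close>.\<close>
  define B where "B = C * C' * C2 * 2 ^ CARD('d) * (2 / \<kappa>)\<^sup>2"
  have ev: "\<forall>\<^sub>F n in sequentially. \<kappa> / 2 < ?h n powr (K - \<gamma>) * v n"
    by (rule order_tendstoD(1)[OF v(1)]) (use v(2) in simp)
  have "\<forall>\<^sub>F n in sequentially. norm ((\<Sum>s\<in>?G n. \<Sum>t\<in>{t\<in>?G n. cell t = cell s}. \<bar>\<sigma> n (s - t) * \<tau> n (s - t)\<bar>) /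
      (real (card (?G n)) * v n)\<^sup>2) \<le> B * ?h n powr (\<gamma>' - \<gamma> + \<theta>)"
    using \<sigma> \<tau> ev eventually_ge_at_top[of "4 * m + 1"]
  proof eventually_elim
    case (elim n)
    then have n: "0 < n" "4 * m \<le> n" by auto
    have h: "0 < ?h n" using L n by simp
    let ?N = "real (card (?G n))" and ?w = "?h n powr (\<gamma> + \<gamma>' - 2 * K + \<theta>)"
    have fin: "finite (?G n)" by (rule finite_igrid[OF L n(1)])
    have N: "(real n / 2) ^ CARD('d) \<le> ?N" by (rule card_igrid_ge[OF L n])
    have N0: "0 < ?N" using N n by (smt (verit) divide_pos_pos of_nat_0_less_iff zero_less_power)
    have vpos: "0 < ?h n powr (K - \<gamma>) * v n" using elim(3) v(2) by linarith
    have kernel: "\<bar>\<sigma> n u * \<tau> n u\<bar> \<le> C * C' * ?w * (?h n + norm u) powr - \<theta>" if u: "norm u \<le> \<delta>" for u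
    proof -
      have hu: "0 < ?h n + norm u" using h by (simp add: add_pos_nonneg)
      have p: "(?h n + norm u) powr (\<gamma> - K) * (?h n + norm u) powr (\<gamma>' - K) =
          (?h n + norm u) powr (\<gamma> + \<gamma>' - 2 * K + \<theta>) * (?h n + norm u) powr - \<theta>"
        unfolding powr_add[symmetric] by (simp add: algebra_simps)
      have "\<bar>\<sigma> n u * \<tau> n u\<bar> \<le> (C * (?h n + norm u) powr (\<gamma> - K)) * (C' * (?h n + norm u) powr (\<gamma>' - K))"
        unfolding abs_mult using elim(1,2) u C by (intro mult_mono) auto
      also have "\<dots> = C * C' * ((?h n + norm u) powr (\<gamma> + \<gamma>' - 2 * K + \<theta>) * (?h n + norm u) powr - \<theta>)"
        unfolding p[symmetric] by (simp only: mult_ac)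
      also have "\<dots> \<le> C * C' * (?w * (?h n + norm u) powr - \<theta>)"
        using C h \<theta> by (intro mult_left_mono mult_right_mono powr_mono2') auto
      finally show ?thesis by (simp add: mult.assoc)
    qed
    have "(\<Sum>s\<in>?G n. \<Sum>t\<in>{t\<in>?G n. cell t = cell s}. \<bar>\<sigma> n (s - t) * \<tau> n (s - t)\<bar>)
        \<le> (\<Sum>s\<in>?G n. C * C' * ?w * (C2 * real n ^ CARD('d)))"
    proof (rule sum_mono)
      fix s assume s: "s \<in> ?G n"
      have "(\<Sum>t\<in>{t\<in>?G n. cell t = cell s}. \<bar>\<sigma> n (s - t) * \<tau> n (s - t)\<bar>)
          \<le> (\<Sum>t\<in>{t\<in>?G n. cell t = cell s}. C * C' * ?w * (?h n + norm (s - t)) powr - \<theta>)"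
        by (intro sum_mono kernel cell[OF n(1) s]) auto
      also have "\<dots> \<le> (\<Sum>t\<in>?G n. C * C' * ?w * (?h n + norm (s - t)) powr - \<theta>)"
        using fin C by (intro sum_mono2) auto
      also have "\<dots> = C * C' * ?w * (\<Sum>t\<in>?G n. (?h n + norm (s - t)) powr - \<theta>)"
        by (simp add: sum_distrib_left)
      also have "\<dots> \<le> C * C' * ?w * (C2 * real n ^ CARD('d))"
        using C by (intro mult_left_mono C2(2)[OF n(1) s]) auto
      finally show "(\<Sum>t\<in>{t\<in>?G n. cell t = cell s}. \<bar>\<sigma> n (s - t) * \<tau> n (s - t)\<bar>)
          \<le> C * C' * ?w * (C2 * real n ^ CARD('d))" .
    qed
    also have "\<dots> = C * C' * C2 * ?w * ?N * (2 ^ CARD('d) * (real n / 2) ^ CARD('d))"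
      by (simp add: power_divide mult_ac)
    also have "\<dots> \<le> C * C' * C2 * ?w * ?N * (2 ^ CARD('d) * ?N)"
      using C C2(1) N by (intro mult_left_mono) auto
    finally have S: "(\<Sum>s\<in>?G n. \<Sum>t\<in>{t\<in>?G n. cell t = cell s}. \<bar>\<sigma> n (s - t) * \<tau> n (s - t)\<bar>)
        \<le> C * C' * C2 * 2 ^ CARD('d) * ?w * ?N\<^sup>2" by (simp add: power2_eq_square mult_ac)
    have "1 / (?h n powr (K - \<gamma>) * v n) \<le> 2 / \<kappa>"
      using elim(3) v(2) vpos by (simp add: field_simps)
    then have "(1 / (?h n powr (K - \<gamma>) * v n))\<^sup>2 \<le> (2 / \<kappa>)\<^sup>2"
      using vpos by (intro power_mono) auto
    moreover have "(1 / v n)\<^sup>2 = (1 / (?h n powr (K - \<gamma>) * v n))\<^sup>2 * ?h n powr (2 * K - 2 * \<gamma>)"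
    proof -
      have "?h n powr (2 * K - 2 * \<gamma>) = (?h n powr (K - \<gamma>))\<^sup>2"
        using h by (simp add: power2_eq_square flip: powr_add)
      moreover have "?h n powr (K - \<gamma>) \<noteq> 0" using L n by simp
      ultimately show ?thesis by (simp add: power_mult_distrib power_divide del: powr_eq_0_iff)
    qed
    ultimately have V: "(1 / v n)\<^sup>2 \<le> (2 / \<kappa>)\<^sup>2 * ?h n powr (2 * K - 2 * \<gamma>)"
      by (simp add: mult_right_mono)
    have "(\<Sum>s\<in>?G n. \<Sum>t\<in>{t\<in>?G n. cell t = cell s}. \<bar>\<sigma> n (s - t) * \<tau> n (s - t)\<bar>) / (?N * v n)\<^sup>2
        \<le> (C * C' * C2 * 2 ^ CARD('d) * ?w * ?N\<^sup>2) / (?N * v n)\<^sup>2"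
      by (intro divide_right_mono S) auto
    also have "\<dots> = C * C' * C2 * 2 ^ CARD('d) * ?w * (1 / v n)\<^sup>2"
      using N0 by (simp add: power_mult_distrib power_divide)
    also have "\<dots> \<le> C * C' * C2 * 2 ^ CARD('d) * ?w * ((2 / \<kappa>)\<^sup>2 * ?h n powr (2 * K - 2 * \<gamma>))"
      using C C2(1) by (intro mult_left_mono V) auto
    also have "\<dots> = B * (?w * ?h n powr (2 * K - 2 * \<gamma>))" by (simp add: B_def mult_ac)
    also have "?w * ?h n powr (2 * K - 2 * \<gamma>) = ?h n powr (\<gamma>' - \<gamma> + \<theta>)"
      unfolding powr_add[symmetric] by (simp add: algebra_simps)
    finally show ?case by (simp add: sum_nonneg)
  qed
  moreover have "(\<lambda>n. B * ?h n powr (\<gamma>' - \<gamma> + \<theta>)) \<longlonglongrightarrow> 0"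
  proof -
    have "0 < \<gamma>' - \<gamma> + \<theta>" using \<theta> by simp
    with L show ?thesis by real_asymp
  qed
  ultimately show ?thesis by (rule Lim_null_comparison)
qed

subsection \<open>The differenced field\<close>

context centered_gaussian_space
begin

text \<open>Centring removes exactly the pairing of \<open>a\<close> with \<open>b\<close> and of
  \<open>a'\<close> with \<open>b'\<close> from Isserlis' formula; the other two pairings
  remain.\<close>

lemma product_covariance:
  assumes "a \<in> G" "b \<in> G" "a' \<in> G" "b' \<in> G"
    and "(\<integral>\<omega>. a \<omega> * b \<omega> \<partial>M) = r" "(\<integral>\<omega>. a' \<omega> * b' \<omega> \<partial>M) = r"
  shows "integrable M (\<lambda>\<omega>. (a \<omega> * b \<omega> - r) * (a' \<omega> * b' \<omega> - r))"
    and "(\<integral>\<omega>. (a \<omega> * b \<omega> - r) * (a' \<omega> * b' \<omega> - r) \<partial>M) =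
      (\<integral>\<omega>. a \<omega> * a' \<omega> \<partial>M) * (\<integral>\<omega>. b \<omega> * b' \<omega> \<partial>M) + (\<integral>\<omega>. a \<omega> * b' \<omega> \<partial>M) * (\<integral>\<omega>. b \<omega> * a' \<omega> \<partial>M)"
proof -
  have eq: "(a \<omega> * b \<omega> - r) * (a' \<omega> * b' \<omega> - r) =
      a \<omega> * b \<omega> * (a' \<omega> * b' \<omega>) - r * (a \<omega> * b \<omega>) - r * (a' \<omega> * b' \<omega>) + r * r" for \<omega>
    by (simp add: algebra_simps)
  have int: "integrable M (\<lambda>\<omega>. a \<omega> * b \<omega> * (a' \<omega> * b' \<omega>))" "integrable M (\<lambda>\<omega>. r * (a \<omega> * b \<omega>))"
    "integrable M (\<lambda>\<omega>. r * (a' \<omega> * b' \<omega>))"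
    using integrable_mult4[OF assms(1-4)] integrable_mult2[OF assms(1,2)] integrable_mult2[OF assms(3,4)]
    by auto
  show "integrable M (\<lambda>\<omega>. (a \<omega> * b \<omega> - r) * (a' \<omega> * b' \<omega> - r))"
    unfolding eq using int
    by (intro Bochner_Integration.integrable_add Bochner_Integration.integrable_diff integrable_const) auto
  show "(\<integral>\<omega>. (a \<omega> * b \<omega> - r) * (a' \<omega> * b' \<omega> - r) \<partial>M) =
      (\<integral>\<omega>. a \<omega> * a' \<omega> \<partial>M) * (\<integral>\<omega>. b \<omega> * b' \<omega> \<partial>M) + (\<integral>\<omega>. a \<omega> * b' \<omega> \<partial>M) * (\<integral>\<omega>. b \<omega> * a' \<omega> \<partial>M)"
    unfolding eq using int isserlis[OF assms(1-4)] assms(5,6) by (simp add: prob_space)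
qed

end

section \<open>Second moments of the differenced bivariate field\<close>

lemma laplacian_power_expectation:
  fixes F :: "real^'d \<Rightarrow> 'a \<Rightarrow> real"
  assumes "\<And>s. integrable M (\<lambda>\<omega>. F s \<omega> * V \<omega>)"
  shows "(\<integral>\<omega>. (laplacian h ^^ k) (\<lambda>s. F s \<omega>) s * V \<omega> \<partial>M) = (laplacian h ^^ k) (\<lambda>s. \<integral>\<omega>. F s \<omega> * V \<omega> \<partial>M) s"
    and "integrable M (\<lambda>\<omega>. (laplacian h ^^ k) (\<lambda>s. F s \<omega>) s * V \<omega>)"
proof -
  obtain J :: "(real^'d) set" and a
    where J: "finite J" "\<And>v. v \<in> J \<Longrightarrow> norm v \<le> real k" "\<And>v i. v \<in> J \<Longrightarrow> v $ i \<in> \<int>"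
    and eq: "\<And>h f u. (laplacian h ^^ k) f u = (\<Sum>v\<in>J. a v * f (u + h *\<^sub>R v)) / h ^ (2 * k)"
    by (rule laplacian_power_stencil) (rule that)
  have e: "(laplacian h ^^ k) (\<lambda>s. F s \<omega>) s * V \<omega> = (\<Sum>v\<in>J. a v * (F (s + h *\<^sub>R v) \<omega> * V \<omega>)) / h ^ (2 * k)" for \<omega>
    unfolding eq by (simp add: sum_distrib_right mult.assoc)
  show "(\<integral>\<omega>. (laplacian h ^^ k) (\<lambda>s. F s \<omega>) s * V \<omega> \<partial>M) = (laplacian h ^^ k) (\<lambda>s. \<integral>\<omega>. F s \<omega> * V \<omega> \<partial>M) s"
    unfolding e unfolding eq using assms by (simp add: Bochner_Integration.integral_sum)
  show "integrable M (\<lambda>\<omega>. (laplacian h ^^ k) (\<lambda>s. F s \<omega>) s * V \<omega>)"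
    unfolding e using assms by simp
qed

locale bivariate_field = prob_space M for M :: "'a measure" +
  fixes X W :: "real^'d \<Rightarrow> 'a \<Rightarrow> real" and C :: "real^'d \<Rightarrow> real^2^2"
  assumes field: "stationary_gaussian_field M (\<lambda>s \<omega>. vector [X s \<omega>, W s \<omega>] :: real^2) C"
    and sym: "C u $ 1 $ 2 = C u $ 2 $ 1"
begin

definition Z :: "2 \<Rightarrow> real^'d \<Rightarrow> 'a \<Rightarrow> real" where
  "Z k s \<omega> = (vector [X s \<omega>, W s \<omega>] :: real^2) $ k"

text \<open>The means of the fields may be nonzero, so this span is not centred. The differenced
  fields lie in its mean-zero part because \<open>laplacian h ^^ m\<close> with \<open>0 < m\<close>
  annihilates constants.\<close>

definition combinations :: "('a \<Rightarrow> real) set" where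
  "combinations = {V. \<exists>S a. finite S \<and>
     V = (\<lambda>\<omega>. \<Sum>s\<in>S. a s \<bullet> (vector [X s \<omega>, W s \<omega>] :: real^2))}"

lemma combinationsI:
  "finite S \<Longrightarrow> (\<lambda>\<omega>. \<Sum>s\<in>S. a s \<bullet> (vector [X s \<omega>, W s \<omega>] :: real^2)) \<in> combinations"
  unfolding combinations_def by blast

lemma combinations_gaussian: "V \<in> combinations \<Longrightarrow> gaussian_rv M V"
  using field unfolding combinations_def stationary_gaussian_field_def gaussian_field_def by blast

lemma combinations_add:
  assumes "U \<in> combinations" "V \<in> combinations"
  shows "(\<lambda>\<omega>. U \<omega> + V \<omega>) \<in> combinations"
proof -
  let ?v = "\<lambda>s \<omega>. vector [X s \<omega>, W s \<omega>] :: real^2"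
  obtain S a where S: "finite S" "U = (\<lambda>\<omega>. \<Sum>s\<in>S. a s \<bullet> ?v s \<omega>)"
    using assms(1) unfolding combinations_def by blast
  obtain S' a' where S': "finite S'" "V = (\<lambda>\<omega>. \<Sum>s\<in>S'. a' s \<bullet> ?v s \<omega>)"
    using assms(2) unfolding combinations_def by blast
  let ?b = "\<lambda>s. (if s \<in> S then a s else 0) + (if s \<in> S' then a' s else 0)"
  have "U \<omega> + V \<omega> = (\<Sum>s\<in>S \<union> S'. ?b s \<bullet> ?v s \<omega>)" for \<omega>
  proof -
    have "U \<omega> = (\<Sum>s\<in>S \<union> S'. (if s \<in> S then a s else 0) \<bullet> ?v s \<omega>)"
      unfolding S(2) using S(1) S'(1) by (intro sum.mono_neutral_cong_left) auto
    moreover have "V \<omega> = (\<Sum>s\<in>S \<union> S'. (if s \<in> S' then a' s else 0) \<bullet> ?v s \<omega>)"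
      unfolding S'(2) using S(1) S'(1) by (intro sum.mono_neutral_cong_left) auto
    ultimately show ?thesis by (simp add: inner_add_left sum.distrib)
  qed
  then have "(\<lambda>\<omega>. U \<omega> + V \<omega>) = (\<lambda>\<omega>. \<Sum>s\<in>S \<union> S'. ?b s \<bullet> ?v s \<omega>)" by blast
  moreover have "finite (S \<union> S')" using S(1) S'(1) by simp
  ultimately show ?thesis unfolding combinations_def by (intro CollectI exI conjI)
qed

lemma combinations_scale:
  assumes "V \<in> combinations"
  shows "(\<lambda>\<omega>. r * V \<omega>) \<in> combinations"
proof -
  let ?v = "\<lambda>s \<omega>. vector [X s \<omega>, W s \<omega>] :: real^2"
  obtain S a where S: "finite S" "V = (\<lambda>\<omega>. \<Sum>s\<in>S. a s \<bullet> ?v s \<omega>)"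
    using assms unfolding combinations_def by blast
  then have "(\<lambda>\<omega>. r * V \<omega>) = (\<lambda>\<omega>. \<Sum>s\<in>S. (r *\<^sub>R a s) \<bullet> ?v s \<omega>)"
    by (simp add: sum_distrib_left)
  with S(1) show ?thesis unfolding combinations_def by (intro CollectI exI conjI)
qed

lemma combinations_sum: "finite J \<Longrightarrow> (\<And>v. v \<in> J \<Longrightarrow> F v \<in> combinations) \<Longrightarrow> (\<lambda>\<omega>. \<Sum>v\<in>J. F v \<omega>) \<in> combinations"
proof (induction J rule: finite_induct)
  case empty
  show ?case unfolding combinations_def by (auto intro: exI[of _ "{}"])
next
  case (insert x J)
  then show ?case using combinations_add[of "F x" "\<lambda>\<omega>. \<Sum>v\<in>J. F v \<omega>"] by simp
qed

lemma Z_combination: "Z k s \<in> combinations"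
proof -
  have "Z k s = (\<lambda>\<omega>. \<Sum>t\<in>{s}. axis k 1 \<bullet> (vector [X t \<omega>, W t \<omega>] :: real^2))"
    by (auto simp: Z_def inner_axis' fun_eq_iff)
  then show ?thesis using combinationsI[of "{s}" "\<lambda>_. axis k 1"] by simp
qed

definition U :: "real \<Rightarrow> nat \<Rightarrow> 2 \<Rightarrow> real^'d \<Rightarrow> 'a \<Rightarrow> real" where
  "U h m k s \<omega> = (laplacian h ^^ m) (\<lambda>s. Z k s \<omega>) s"

lemma U_combination: "U h m k s \<in> combinations"
proof -
  obtain J :: "(real^'d) set" and a
    where J: "finite J" "\<And>v. v \<in> J \<Longrightarrow> norm v \<le> real m" "\<And>v i. v \<in> J \<Longrightarrow> v $ i \<in> \<int>"
    and eq: "\<And>h f u. (laplacian h ^^ m) f u = (\<Sum>v\<in>J. a v * f (u + h *\<^sub>R v)) / h ^ (2 * m)"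
    by (rule laplacian_power_stencil) (rule that)
  have eqU: "U h m k s = (\<lambda>\<omega>. (1 / h ^ (2 * m)) * (\<Sum>v\<in>J. a v * Z k (s + h *\<^sub>R v) \<omega>))"
    unfolding U_def eq by (simp add: fun_eq_iff)
  show ?thesis
    unfolding eqU by (intro combinations_scale combinations_sum[OF J(1)] combinations_scale[OF Z_combination])
qed

lemma combinations_integrable: "V \<in> combinations \<Longrightarrow> integrable M (\<lambda>\<omega>. V \<omega> ^ k)"
  by (rule gaussian_rv_power_integrable[OF prob_space_axioms combinations_gaussian])

lemma combinations_integrable1: "V \<in> combinations \<Longrightarrow> integrable M V"
  using combinations_integrable[of V 1] by simp

lemma combinations_integrable_mult:
  assumes "V \<in> combinations" "V' \<in> combinations"
  shows "integrable M (\<lambda>\<omega>. V \<omega> * V' \<omega>)"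
proof -
  have eq: "V \<omega> * V' \<omega> = ((V \<omega> + V' \<omega>) ^ 2 - V \<omega> ^ 2 - V' \<omega> ^ 2) / 2" for \<omega>
    by (simp add: power2_eq_square algebra_simps)
  show ?thesis unfolding eq
    using combinations_integrable[OF combinations_add[OF assms], of 2]
      combinations_integrable[OF assms(1), of 2] combinations_integrable[OF assms(2), of 2] by simp
qed

lemma Z_mean: obtains \<mu> where "\<And>s k. (\<integral>\<omega>. Z k s \<omega> \<partial>M) = \<mu> k"
  using field unfolding stationary_gaussian_field_def Z_def by metis

text \<open>The constant \<open>r k l\<close> is the product of the two means; it disappears on
  differencing.\<close>

lemma Z_second_moment:
  obtains r where "\<And>s t k l. (\<integral>\<omega>. Z k s \<omega> * Z l t \<omega> \<partial>M) = C (s - t) $ k $ l + r k l"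
proof -
  obtain \<mu> where \<mu>: "\<And>s k. (\<integral>\<omega>. Z k s \<omega> \<partial>M) = \<mu> k" by (rule Z_mean) (rule that)
  have "(\<integral>\<omega>. Z k s \<omega> * Z l t \<omega> \<partial>M) = C (s - t) $ k $ l + \<mu> k * \<mu> l" for s t k l
  proof -
    have int: "integrable M (\<lambda>\<omega>. Z k s \<omega> * Z l t \<omega>)" "integrable M (Z k s)" "integrable M (Z l t)"
      by (auto intro: combinations_integrable_mult combinations_integrable1 Z_combination)
    have "C (s - t) $ k $ l = covariance M (Z k s) (Z l t)"
      using field unfolding stationary_gaussian_field_def Z_def[abs_def] by metis
    also have "\<dots> = (\<integral>\<omega>. Z k s \<omega> * Z l t \<omega> - \<mu> l * Z k s \<omega> - \<mu> k * Z l t \<omega> + \<mu> k * \<mu> l \<partial>M)"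
      unfolding covariance_def \<mu> by (intro Bochner_Integration.integral_cong) (auto simp: algebra_simps)
    also have "\<dots> = (\<integral>\<omega>. Z k s \<omega> * Z l t \<omega> \<partial>M) - \<mu> k * \<mu> l"
      using int by (simp add: \<mu> prob_space)
    finally show ?thesis by simp
  qed
  then show thesis by (rule that)
qed

text \<open>The covariance function of the differenced fields, as \<open>U_covariance\<close>
  confirms.\<close>

definition \<sigma> :: "real \<Rightarrow> nat \<Rightarrow> 2 \<Rightarrow> 2 \<Rightarrow> real^'d \<Rightarrow> real" where
  "\<sigma> h m k l u = (laplacian h ^^ (2 * m)) (\<lambda>u. C u $ k $ l) u"

lemma \<sigma>_sym: "\<sigma> h m 1 2 = \<sigma> h m 2 1"
  by (simp add: \<sigma>_def fun_eq_iff sym)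

lemma U_mean:
  assumes "0 < m"
  shows "(\<integral>\<omega>. U h m k s \<omega> \<partial>M) = 0"
proof -
  obtain \<mu> where \<mu>: "\<And>s k. (\<integral>\<omega>. Z k s \<omega> \<partial>M) = \<mu> k" by (rule Z_mean) (rule that)
  have "(\<integral>\<omega>. U h m k s \<omega> * 1 \<partial>M) = (laplacian h ^^ m) (\<lambda>s. \<integral>\<omega>. Z k s \<omega> * 1 \<partial>M) s"
    unfolding U_def by (rule laplacian_power_expectation) (simp add: combinations_integrable1 Z_combination)
  then show ?thesis by (simp add: \<mu> laplacian_power_const[OF assms])
qed

text \<open>One power of the Laplacian acts in each argument of \<open>C (s - t)\<close>. Reflection
  and translation turn both into operators on \<open>C\<close>, and the exponents add up to
  \<open>2 * m\<close>.\<close>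

lemma U_covariance:
  assumes "0 < m"
  shows "(\<integral>\<omega>. U h m k s \<omega> * U h m l t \<omega> \<partial>M) = \<sigma> h m k l (s - t)"
proof -
  obtain r where r: "\<And>s t k l. (\<integral>\<omega>. Z k s \<omega> * Z l t \<omega> \<partial>M) = C (s - t) $ k $ l + r k l"
    by (rule Z_second_moment) (rule that)
  have inner: "(\<integral>\<omega>. Z k s \<omega> * U h m l t \<omega> \<partial>M) = (laplacian h ^^ m) (\<lambda>u. C u $ k $ l) (s - t)" for s
  proof -
    have "(\<integral>\<omega>. Z k s \<omega> * U h m l t \<omega> \<partial>M) = (\<integral>\<omega>. U h m l t \<omega> * Z k s \<omega> \<partial>M)"
      by (simp only: mult.commute)
    also have "\<dots> = (laplacian h ^^ m) (\<lambda>t. \<integral>\<omega>. Z l t \<omega> * Z k s \<omega> \<partial>M) t"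
      unfolding U_def by (rule laplacian_power_expectation) (intro combinations_integrable_mult Z_combination)
    also have "(\<lambda>t. \<integral>\<omega>. Z l t \<omega> * Z k s \<omega> \<partial>M) = (\<lambda>t. C (s - t) $ k $ l + r k l)"
      using r by (simp add: mult.commute)
    also have "(laplacian h ^^ m) \<dots> t = (laplacian h ^^ m) (\<lambda>u. C u $ k $ l) (s - t)"
      unfolding laplacian_power_add laplacian_power_const[OF assms]
      by (simp add: laplacian_power_reflect[where f = "\<lambda>u. C u $ k $ l"])
    finally show ?thesis .
  qed
  have "(\<integral>\<omega>. U h m k s \<omega> * U h m l t \<omega> \<partial>M) = (laplacian h ^^ m) (\<lambda>s. \<integral>\<omega>. Z k s \<omega> * U h m l t \<omega> \<partial>M) s"
    unfolding U_def[of h m k s] by (rule laplacian_power_expectation)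
      (intro combinations_integrable_mult Z_combination U_combination)
  also have "\<dots> = (laplacian h ^^ m) ((laplacian h ^^ m) (\<lambda>u. C u $ k $ l)) (s - t)"
    unfolding inner by (rule laplacian_power_translate)
  finally show ?thesis by (simp add: \<sigma>_def mult_2 funpow_add)
qed

text \<open>By stationarity both variances agree, so the inequality 2|ab| \<le> a^2 + b^2 already
  yields the Cauchy--Schwarz bound.\<close>

lemma \<sigma>_le_variance:
  assumes "0 < m"
  shows "\<bar>\<sigma> h m 1 1 u\<bar> \<le> \<sigma> h m 1 1 0"
proof -
  let ?a = "U h m 1 u" and ?b = "U h m 1 0"
  have c: "?a \<in> combinations" "?b \<in> combinations" by (rule U_combination)+
  have "\<bar>\<integral>\<omega>. ?a \<omega> * ?b \<omega> \<partial>M\<bar> \<le> (\<integral>\<omega>. \<bar>?a \<omega> * ?b \<omega>\<bar> \<partial>M)" by (rule integral_abs_bound)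
  also have "\<dots> \<le> (\<integral>\<omega>. (?a \<omega> * ?a \<omega> + ?b \<omega> * ?b \<omega>) / 2 \<partial>M)"
    using c abs_mult_le_half_sum_squares
    by (intro integral_mono) (auto intro!: combinations_integrable_mult simp: power2_eq_square)
  also have "\<dots> = (\<sigma> h m 1 1 0 + \<sigma> h m 1 1 0) / 2"
    using c by (simp add: combinations_integrable_mult U_covariance[OF assms])
  finally show ?thesis by (simp add: U_covariance[OF assms])
qed

lemma centered_gaussian_space_combinations:
  "centered_gaussian_space M {V \<in> combinations. (\<integral>\<omega>. V \<omega> \<partial>M) = 0}"
proof
  fix V V' :: "'a \<Rightarrow> real" and r
  assume V: "V \<in> {V \<in> combinations. (\<integral>\<omega>. V \<omega> \<partial>M) = 0}"
  then show "gaussian_rv M V" "(\<integral>\<omega>. V \<omega> \<partial>M) = 0"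
    "(\<lambda>\<omega>. r * V \<omega>) \<in> {V \<in> combinations. (\<integral>\<omega>. V \<omega> \<partial>M) = 0}"
    by (auto intro: combinations_gaussian combinations_scale)
  assume "V' \<in> {V \<in> combinations. (\<integral>\<omega>. V \<omega> \<partial>M) = 0}"
  with V show "(\<lambda>\<omega>. V \<omega> + V' \<omega>) \<in> {V \<in> combinations. (\<integral>\<omega>. V \<omega> \<partial>M) = 0}"
    by (auto intro: combinations_add simp: combinations_integrable1)
qed

text \<open>For \<open>k = 1\<close> this controls the denominator, for \<open>k = 2\<close> the numerator.\<close>
lemma centered_sum_second_moment_le:
  assumes "0 < m" "finite S" "finite Q" "cell ` S \<subseteq> Q"
  shows "(\<integral>\<omega>. (\<Sum>s\<in>S. U h m 1 s \<omega> * U h m k s \<omega> - \<sigma> h m 1 k 0)\<^sup>2 \<partial>M) \<le> card Q *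
    (\<Sum>s\<in>S. \<Sum>t\<in>{t\<in>S. cell t = cell s}.
      \<bar>\<sigma> h m 1 1 (s - t) * \<sigma> h m k k (s - t)\<bar> + (\<sigma> h m 1 k (s - t))\<^sup>2)"
    and "integrable M (\<lambda>\<omega>. (\<Sum>s\<in>S. U h m 1 s \<omega> * U h m k s \<omega> - \<sigma> h m 1 k 0)\<^sup>2)"
    and "(\<lambda>\<omega>. \<Sum>s\<in>S. U h m 1 s \<omega> * U h m k s \<omega> - \<sigma> h m 1 k 0) \<in> borel_measurable M"
proof -
  interpret centered_gaussian_space M "{V \<in> combinations. (\<integral>\<omega>. V \<omega> \<partial>M) = 0}"
    by (rule centered_gaussian_space_combinations)
  let ?Z = "\<lambda>s \<omega>. U h m 1 s \<omega> * U h m k s \<omega> - \<sigma> h m 1 k 0"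
  have UG: "U h m k s \<in> {V \<in> combinations. (\<integral>\<omega>. V \<omega> \<partial>M) = 0}" for k s
    using U_combination U_mean[OF assms(1)] by simp
  have diag: "(\<integral>\<omega>. U h m 1 s \<omega> * U h m k s \<omega> \<partial>M) = \<sigma> h m 1 k 0" for s
    using U_covariance[OF assms(1), of h 1 s k s] by simp
  \<comment> \<open>Symmetry of the cross covariance turns the second pairing into a square.\<close>
  have k1: "\<sigma> h m k 1 = \<sigma> h m 1 k" using \<sigma>_sym exhaust_2[of k] by metis
  have int: "integrable M (\<lambda>\<omega>. ?Z s \<omega> * ?Z t \<omega>)" for s t
    by (rule product_covariance(1)[OF UG UG UG UG diag diag])
  have cov: "(\<integral>\<omega>. ?Z s \<omega> * ?Z t \<omega> \<partial>M) =
      \<sigma> h m 1 1 (s - t) * \<sigma> h m k k (s - t) + (\<sigma> h m 1 k (s - t))\<^sup>2" for s t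
    unfolding product_covariance(2)[OF UG UG UG UG diag diag] U_covariance[OF assms(1)] k1
    by (simp add: power2_eq_square)
  have "(\<integral>\<omega>. (\<Sum>s\<in>S. ?Z s \<omega>)\<^sup>2 \<partial>M) \<le>
      card Q * (\<Sum>s\<in>S. \<Sum>t\<in>{t\<in>S. cell t = cell s}. \<bar>\<integral>\<omega>. ?Z s \<omega> * ?Z t \<omega> \<partial>M\<bar>)"
    by (rule second_moment_cell_sum[OF assms(2-4) int])
  also have "\<dots> \<le> card Q * (\<Sum>s\<in>S. \<Sum>t\<in>{t\<in>S. cell t = cell s}.
      \<bar>\<sigma> h m 1 1 (s - t) * \<sigma> h m k k (s - t)\<bar> + (\<sigma> h m 1 k (s - t))\<^sup>2)"
    unfolding cov by (intro mult_left_mono sum_mono order_trans[OF abs_triangle_ineq]) auto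
  finally show "(\<integral>\<omega>. (\<Sum>s\<in>S. ?Z s \<omega>)\<^sup>2 \<partial>M) \<le> card Q *
    (\<Sum>s\<in>S. \<Sum>t\<in>{t\<in>S. cell t = cell s}.
      \<bar>\<sigma> h m 1 1 (s - t) * \<sigma> h m k k (s - t)\<bar> + (\<sigma> h m 1 k (s - t))\<^sup>2)" .
  have "(\<Sum>s\<in>S. ?Z s \<omega>)\<^sup>2 = (\<Sum>s\<in>S. \<Sum>t\<in>S. ?Z s \<omega> * ?Z t \<omega>)" for \<omega>
    by (simp add: power2_eq_square sum_product)
  then show "integrable M (\<lambda>\<omega>. (\<Sum>s\<in>S. ?Z s \<omega>)\<^sup>2)" using int by simp
  have "U h m k s \<in> borel_measurable M" for k s by (rule measurable_G[OF UG])
  then show "(\<lambda>\<omega>. \<Sum>s\<in>S. ?Z s \<omega>) \<in> borel_measurable M" by measurable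
qed

end

subsection \<open>Consistency\<close>

context bivariate_field
begin

context
  fixes L :: real and c \<alpha> :: "2 \<Rightarrow> 2 \<Rightarrow> real" and m :: nat
  assumes L: "0 < L" and Ad: "condition_Ad L c \<alpha> C" and \<alpha>m: "\<alpha> 1 1 < 4 * real m"
begin

lemma exponent: "0 < \<alpha> k l" "\<nexists>j::int. \<alpha> k l = 2 * of_int j"
proof -
  obtain K where "condition_A L (c k l) (\<alpha> k l) K"
    using Ad unfolding condition_Ad_def by blast
  then show "0 < \<alpha> k l" "\<nexists>j::int. \<alpha> k l = 2 * of_int j" unfolding condition_A_def by blast+
qed

lemma m_pos: "0 < m"
  using \<alpha>m exponent(1)[of 1 1] by (cases m) auto

lemma local_structure:
  obtains \<rho> p f where "0 < \<rho>"
    "\<And>u. norm u < \<rho> \<Longrightarrow> C u $ k $ l = (\<Sum>i<2*m. p i * norm u ^ (2 * i)) + f u"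
    "homogeneous_bounded (4 * m) \<rho> (min (\<alpha> k l) (4 * real m)) f" "f 0 = 0"
    "\<And>\<epsilon>. \<alpha> k l < 4 * real m \<Longrightarrow> 0 < \<epsilon> \<Longrightarrow>
      \<exists>\<delta>>0. \<forall>u. norm u < \<delta> \<longrightarrow> \<bar>f u - c k l * norm u powr \<alpha> k l\<bar> \<le> \<epsilon> * norm u powr \<alpha> k l"
proof -
  obtain K r where K: "condition_A L (c k l) (\<alpha> k l) K" "remainder_cond (\<alpha> k l) r"
    "\<And>u. C u $ k $ l = K (norm u) + r u"
    using Ad unfolding condition_Ad_def by blast
  show thesis
    by (rule covariance_local_structure[OF L K(1,2) m_pos, folded K(3)]) (rule that)
qed

lemma \<sigma>_decay:
  obtains \<rho> A where "0 < \<rho>" "0 \<le> A" "\<And>h u. 0 < h \<Longrightarrow> norm u + 2 * real m * h < \<rho> \<Longrightarrow>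
    \<bar>\<sigma> h m k l u\<bar> \<le> A * (h + norm u) powr (min (\<alpha> k l) (4 * real m) - 4 * real m)"
proof -
  obtain \<rho> p f where s: "0 < \<rho>"
    "\<And>u. norm u < \<rho> \<Longrightarrow> C u $ k $ l = (\<Sum>i<2*m. p i * norm u ^ (2 * i)) + f u"
    "homogeneous_bounded (4 * m) \<rho> (min (\<alpha> k l) (4 * real m)) f" "f 0 = 0"
    by (rule local_structure) (rule that)
  have "0 < min (\<alpha> k l) (4 * real m)" "min (\<alpha> k l) (4 * real m) \<le> 4 * real m"
    using exponent(1)[of k l] m_pos by auto
  from laplacian_power_decay[OF this m_pos s(2-4)] obtain A where "0 \<le> A"
    "\<And>h u. 0 < h \<Longrightarrow> norm u + 2 * real m * h < \<rho> \<Longrightarrow>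
      \<bar>\<sigma> h m k l u\<bar> \<le> A * (h + norm u) powr (min (\<alpha> k l) (4 * real m) - 4 * real m)"
    unfolding \<sigma>_def by metis
  with s(1) show thesis by (rule that)
qed

text \<open>If the limit were \<open>0\<close>, the Cauchy--Schwarz inequality would force \<open>\<Delta>\<^sup>2\<^sup>m |\<cdot>|\<^sup>\<alpha>\<close> to vanish
  identically.\<close>
lemma variance_scaling:
  obtains \<kappa> where "0 < \<kappa>" "((\<lambda>h. h powr (4 * real m - \<alpha> 1 1) * \<sigma> h m 1 1 0) \<longlongrightarrow> \<kappa>) (at_right 0)"
proof -
  obtain \<rho> p f where s: "0 < \<rho>"
    "\<And>u. norm u < \<rho> \<Longrightarrow> C u $ 1 $ 1 = (\<Sum>i<2*m. p i * norm u ^ (2 * i)) + f u"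
    and f: "\<And>\<epsilon>. 0 < \<epsilon> \<Longrightarrow>
      \<exists>\<delta>>0. \<forall>u. norm u < \<delta> \<longrightarrow> \<bar>f u - c 1 1 * norm u powr \<alpha> 1 1\<bar> \<le> \<epsilon> * norm u powr \<alpha> 1 1"
    by (rule local_structure[of 1 1]) (rule that, auto simp: \<alpha>m)
  define \<Psi> where "\<Psi> x = (laplacian 1 ^^ (2 * m)) (\<lambda>u. norm u powr \<alpha> 1 1) x" for x :: "real^'d"
  have lim: "((\<lambda>h. h powr (4 * real m - \<alpha> 1 1) * \<sigma> h m 1 1 (h *\<^sub>R x)) \<longlongrightarrow> c 1 1 * \<Psi> x) (at_right 0)" for x
    unfolding \<sigma>_def \<Psi>_def by (rule laplacian_power_scaling_limit[OF s(1) exponent(1) s(2) f])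
  have "\<bar>c 1 1 * \<Psi> x\<bar> \<le> c 1 1 * \<Psi> 0" for x
  proof (rule tendsto_le[OF _ lim[of 0] tendsto_rabs[OF lim[of x]]])
    show "\<forall>\<^sub>F h in at_right 0. \<bar>h powr (4 * real m - \<alpha> 1 1) * \<sigma> h m 1 1 (h *\<^sub>R x)\<bar>
        \<le> h powr (4 * real m - \<alpha> 1 1) * \<sigma> h m 1 1 (h *\<^sub>R 0)"
      using \<sigma>_le_variance[OF m_pos] by (auto simp: abs_mult intro!: always_eventually mult_left_mono)
  qed simp
  moreover obtain x where "\<Psi> x \<noteq> 0"
    using laplacian_power_norm_powr_not_0[OF exponent, of "2 * m"] unfolding \<Psi>_def by blast
  moreover have "c 1 1 \<noteq> 0" using Ad unfolding condition_Ad_def by blast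
  \<comment> \<open>A nonzero value at some \<open>x\<close> forces strict positivity at 0; this
    determines the sign of the product although \<open>c 1 1\<close> is only known to be
    nonzero.\<close>
  ultimately have "0 < c 1 1 * \<Psi> 0" by (smt (verit) mult_eq_0_iff)
  with lim[of 0] show thesis by (intro that) auto
qed

context
  assumes \<alpha>12: "\<alpha> 1 1 < \<alpha> 1 2" and \<alpha>22: "\<alpha> 1 1 < \<alpha> 2 2 + real CARD('d)"
begin

text \<open>The product of the two autocovariances is treated with the exponents
  \<open>\<alpha> 1 1\<close> and \<open>\<alpha> k k\<close>, the latter cut at 4m; the squared
  cross covariance is treated with \<open>\<alpha> 1 1\<close> in both places.\<close>

lemma normalized_second_moment_tendsto_0:
  "(\<lambda>n. (\<integral>\<omega>. (\<Sum>s\<in>igrid L n m. U (L / real n) m 1 s \<omega> * U (L / real n) m k s \<omega> - \<sigma> (L / real n) m 1 k 0)\<^sup>2 \<partial>M) /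
     (real (card (igrid L n m :: (real^'d) set)) * \<sigma> (L / real n) m 1 1 0)\<^sup>2) \<longlonglongrightarrow> 0"
proof -
  let ?h = "\<lambda>n. L / real n" and ?K = "4 * real m"
  let ?N = "\<lambda>n. real (card (igrid L n m :: (real^'d) set))" and ?G = "\<lambda>n. igrid L n m :: (real^'d) set"
  have hlim: "filterlim ?h (at_right 0) sequentially" using L by real_asymp
  obtain \<kappa> where \<kappa>: "0 < \<kappa>" "((\<lambda>h. h powr (?K - \<alpha> 1 1) * \<sigma> h m 1 1 0) \<longlongrightarrow> \<kappa>) (at_right 0)"
    by (rule variance_scaling) (rule that)
  have v: "(\<lambda>n. ?h n powr (?K - \<alpha> 1 1) * \<sigma> (?h n) m 1 1 0) \<longlonglongrightarrow> \<kappa>"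
    by (rule filterlim_compose[OF \<kappa>(2) hlim])
  obtain \<rho>1 A1 where 1: "0 < \<rho>1" "0 \<le> A1" "\<And>h u. 0 < h \<Longrightarrow> norm u + 2 * real m * h < \<rho>1 \<Longrightarrow>
    \<bar>\<sigma> h m 1 1 u\<bar> \<le> A1 * (h + norm u) powr (min (\<alpha> 1 1) ?K - ?K)" by (rule \<sigma>_decay) (rule that)
  obtain \<rho>2 A2 where 2: "0 < \<rho>2" "0 \<le> A2" "\<And>h u. 0 < h \<Longrightarrow> norm u + 2 * real m * h < \<rho>2 \<Longrightarrow>
    \<bar>\<sigma> h m 1 k u\<bar> \<le> A2 * (h + norm u) powr (min (\<alpha> 1 k) ?K - ?K)" by (rule \<sigma>_decay) (rule that)
  obtain \<rho>3 A3 where 3: "0 < \<rho>3" "0 \<le> A3" "\<And>h u. 0 < h \<Longrightarrow> norm u + 2 * real m * h < \<rho>3 \<Longrightarrow>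
    \<bar>\<sigma> h m k k u\<bar> \<le> A3 * (h + norm u) powr (min (\<alpha> k k) ?K - ?K)" by (rule \<sigma>_decay) (rule that)
  \<comment> \<open>The entry 1 keeps \<open>h + norm u\<close> below 1, where lowering the exponent
    enlarges the power.\<close>
  define \<rho> where "\<rho> = Min {\<rho>1, \<rho>2, \<rho>3, 1}"
  have \<rho>: "0 < \<rho>" "\<rho> \<le> \<rho>1" "\<rho> \<le> \<rho>2" "\<rho> \<le> \<rho>3" "\<rho> \<le> 1"
    using 1(1) 2(1) 3(1) by (auto simp: \<rho>_def)
  \<comment> \<open>Half of the radius is reserved for the reach \<open>2 * m * h\<close> of the
    stencil.\<close>
  define \<delta> where "\<delta> = \<rho> / 2"
  have \<delta>: "0 < \<delta>" using \<rho> by (simp add: \<delta>_def)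
  have "(\<lambda>n. 2 * real m * ?h n + ?h n) \<longlonglongrightarrow> 0" by real_asymp
  then have "\<forall>\<^sub>F n in sequentially. 2 * real m * ?h n + ?h n < \<delta>"
    by (rule order_tendstoD(2)) (rule \<delta>)
  with eventually_gt_at_top[of 0]
  have small: "\<forall>\<^sub>F n in sequentially. 0 < ?h n \<and> (\<forall>u::real^'d. norm u \<le> \<delta> \<longrightarrow>
      norm u + 2 * real m * ?h n < \<rho> \<and> ?h n + norm u < 1)"
  proof eventually_elim
    case (elim n)
    have "0 < ?h n" using L elim by simp
    moreover have "0 \<le> 2 * real m * ?h n" using L by simp
    ultimately show ?case using elim \<rho>(5) unfolding \<delta>_def by (intro conjI allI impI) linarith+
  qed
  have b1: "\<forall>\<^sub>F n in sequentially. \<forall>u. norm u \<le> \<delta> \<longrightarrow> \<bar>\<sigma> (?h n) m 1 1 u\<bar> \<le> A1 * (?h n + norm u) powr (\<alpha> 1 1 - ?K)"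
    using small
  proof eventually_elim
    case (elim n)
    then show ?case using 1(3)[of "?h n"] \<rho>(2) \<alpha>m by (fastforce simp: min_def)
  qed
  have b2: "\<forall>\<^sub>F n in sequentially. \<forall>u. norm u \<le> \<delta> \<longrightarrow> \<bar>\<sigma> (?h n) m 1 k u\<bar> \<le> A2 * (?h n + norm u) powr (\<alpha> 1 1 - ?K)"
    using small
  proof eventually_elim
    case (elim n)
    show ?case
    proof (intro allI impI)
      fix u :: "real^'d" assume u: "norm u \<le> \<delta>"
      have le: "\<alpha> 1 1 \<le> min (\<alpha> 1 k) ?K" using \<alpha>12 \<alpha>m exhaust_2[of k] by auto
      have "\<bar>\<sigma> (?h n) m 1 k u\<bar> \<le> A2 * (?h n + norm u) powr (min (\<alpha> 1 k) ?K - ?K)"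
        using elim u \<rho>(3) by (intro 2(3)) fastforce+
      also have "\<dots> \<le> A2 * (?h n + norm u) powr (\<alpha> 1 1 - ?K)"
        using elim u le 2(2) by (intro mult_left_mono powr_mono') (auto simp: less_imp_le add_nonneg_nonneg)
      finally show "\<bar>\<sigma> (?h n) m 1 k u\<bar> \<le> A2 * (?h n + norm u) powr (\<alpha> 1 1 - ?K)" .
    qed
  qed
  have b3: "\<forall>\<^sub>F n in sequentially. \<forall>u. norm u \<le> \<delta> \<longrightarrow> \<bar>\<sigma> (?h n) m k k u\<bar> \<le> A3 * (?h n + norm u) powr (min (\<alpha> k k) ?K - ?K)"
    using small
  proof eventually_elim
    case (elim n)
    then show ?case using 3(3)[of "?h n"] \<rho>(4) by fastforce
  qed
  obtain cell :: "real^'d \<Rightarrow> 'd \<Rightarrow> nat" and Q where Q: "finite Q" "\<And>n m. 0 < n \<Longrightarrow> cell ` igrid L n m \<subseteq> Q"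
    and cell: "\<And>n m s t. 0 < n \<Longrightarrow> s \<in> igrid L n m \<Longrightarrow> t \<in> igrid L n m \<Longrightarrow> cell t = cell s \<Longrightarrow> norm (s - t) \<le> \<delta>"
    by (rule cube_cells[OF L \<delta>]) (rule that)
  have d: "0 < real CARD('d)" by simp
  \<comment> \<open>For \<open>k = 1\<close> this is clear since \<open>d\<close> is positive; for
    \<open>k = 2\<close> it is the hypothesis on \<open>\<alpha> 2 2\<close>.\<close>
  have kk: "\<alpha> 1 1 < min (\<alpha> k k) ?K + real CARD('d)"
    using \<alpha>22 \<alpha>m d exhaust_2[of k] by (auto simp: min_def)
  let ?S = "\<lambda>f n. (\<Sum>s\<in>?G n. \<Sum>t\<in>{t\<in>?G n. cell t = cell s}. f n (s - t)) / (?N n * \<sigma> (?h n) m 1 1 0)\<^sup>2"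
  have A: "?S (\<lambda>n u. \<bar>\<sigma> (?h n) m 1 1 u * \<sigma> (?h n) m k k u\<bar>) \<longlonglongrightarrow> 0"
    by (rule normalized_cell_sum_tendsto_0[OF L \<alpha>m _ kk b1 b3 1(2) 3(2) v \<kappa>(1) cell]) auto
  have B: "?S (\<lambda>n u. \<bar>\<sigma> (?h n) m 1 k u * \<sigma> (?h n) m 1 k u\<bar>) \<longlonglongrightarrow> 0"
    by (rule normalized_cell_sum_tendsto_0[OF L \<alpha>m _ _ b2 b2 2(2) 2(2) v \<kappa>(1) cell]) (use \<alpha>m in auto)
  have AB: "(\<lambda>n. card Q * (?S (\<lambda>n u. \<bar>\<sigma> (?h n) m 1 1 u * \<sigma> (?h n) m k k u\<bar>) n +
      ?S (\<lambda>n u. \<bar>\<sigma> (?h n) m 1 k u * \<sigma> (?h n) m 1 k u\<bar>) n)) \<longlonglongrightarrow> 0"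
    using tendsto_mult[OF tendsto_const[of "real (card Q)"] tendsto_add[OF A B]] by simp
  show ?thesis
  proof (rule Lim_null_comparison[OF _ AB])
    show "\<forall>\<^sub>F n in sequentially. norm ((\<integral>\<omega>. (\<Sum>s\<in>?G n. U (?h n) m 1 s \<omega> * U (?h n) m k s \<omega> - \<sigma> (?h n) m 1 k 0)\<^sup>2 \<partial>M) /
        (?N n * \<sigma> (?h n) m 1 1 0)\<^sup>2) \<le> card Q * (?S (\<lambda>n u. \<bar>\<sigma> (?h n) m 1 1 u * \<sigma> (?h n) m k k u\<bar>) n +
      ?S (\<lambda>n u. \<bar>\<sigma> (?h n) m 1 k u * \<sigma> (?h n) m 1 k u\<bar>) n)"
      using eventually_gt_at_top[of 0]
    proof eventually_elim
      case (elim n)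
      have "(\<integral>\<omega>. (\<Sum>s\<in>?G n. U (?h n) m 1 s \<omega> * U (?h n) m k s \<omega> - \<sigma> (?h n) m 1 k 0)\<^sup>2 \<partial>M) \<le>
          card Q * (\<Sum>s\<in>?G n. \<Sum>t\<in>{t\<in>?G n. cell t = cell s}.
            \<bar>\<sigma> (?h n) m 1 1 (s - t) * \<sigma> (?h n) m k k (s - t)\<bar> + (\<sigma> (?h n) m 1 k (s - t))\<^sup>2)"
        by (rule centered_sum_second_moment_le(1)[OF m_pos finite_igrid[OF L elim] Q(1) Q(2)[OF elim]])
      also have "\<dots> = card Q * ((\<Sum>s\<in>?G n. \<Sum>t\<in>{t\<in>?G n. cell t = cell s}.
            \<bar>\<sigma> (?h n) m 1 1 (s - t) * \<sigma> (?h n) m k k (s - t)\<bar>) +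
          (\<Sum>s\<in>?G n. \<Sum>t\<in>{t\<in>?G n. cell t = cell s}. \<bar>\<sigma> (?h n) m 1 k (s - t) * \<sigma> (?h n) m 1 k (s - t)\<bar>))"
      proof -
        have sq: "\<bar>x * x\<bar> = x\<^sup>2" for x :: real by (simp add: power2_eq_square)
        show ?thesis by (simp only: sum.distrib sq)
      qed
      finally show ?case
        by (simp add: divide_right_mono flip: add_divide_distrib)
    qed
  qed
qed

text \<open>This ratio is the relative size of the means of numerator and denominator. It is of
  order h to the power \<open>min (\<alpha> 1 2) (4 * m) - \<alpha> 1 1\<close>, which is
  positive.\<close>

lemma cross_covariance_ratio_tendsto_0:
  "(\<lambda>n. \<sigma> (L / real n) m 1 2 0 / \<sigma> (L / real n) m 1 1 0) \<longlonglongrightarrow> 0"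
proof -
  let ?K = "4 * real m" and ?\<gamma> = "min (\<alpha> 1 2) (4 * real m)"
  have hlim: "filterlim (\<lambda>n. L / real n) (at_right 0) sequentially" using L by real_asymp
  obtain \<kappa> where \<kappa>: "0 < \<kappa>" "((\<lambda>h. h powr (?K - \<alpha> 1 1) * \<sigma> h m 1 1 0) \<longlongrightarrow> \<kappa>) (at_right 0)"
    by (rule variance_scaling) (rule that)
  obtain \<rho> A where A: "0 < \<rho>" "0 \<le> A" "\<And>h u. 0 < h \<Longrightarrow> norm u + 2 * real m * h < \<rho> \<Longrightarrow>
    \<bar>\<sigma> h m 1 2 u\<bar> \<le> A * (h + norm u) powr (?\<gamma> - ?K)" by (rule \<sigma>_decay) (rule that)
  have pos: "0 < ?\<gamma> - \<alpha> 1 1" using \<alpha>12 \<alpha>m by auto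
  have "((\<lambda>h. h powr (?K - \<alpha> 1 1) * \<sigma> h m 1 2 0) \<longlongrightarrow> 0) (at_right 0)"
  proof (rule Lim_null_comparison)
    show "((\<lambda>h. A * h powr (?\<gamma> - \<alpha> 1 1)) \<longlongrightarrow> 0) (at_right 0)" using pos by real_asymp
    have "\<forall>\<^sub>F h in at_right 0. 0 < h \<and> h < \<rho> / (2 * real m)"
      using A(1) m_pos by (auto simp: eventually_at_right_field intro!: exI[of _ "\<rho> / (2 * real m)"])
    then show "\<forall>\<^sub>F h in at_right 0. norm (h powr (?K - \<alpha> 1 1) * \<sigma> h m 1 2 0) \<le> A * h powr (?\<gamma> - \<alpha> 1 1)"
    proof eventually_elim
      case (elim h)
      have "\<bar>\<sigma> h m 1 2 0\<bar> \<le> A * (h + norm (0 :: real^'d)) powr (?\<gamma> - ?K)"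
        using elim m_pos by (intro A(3)) (auto simp: field_simps)
      then have "h powr (?K - \<alpha> 1 1) * \<bar>\<sigma> h m 1 2 0\<bar> \<le> h powr (?K - \<alpha> 1 1) * (A * h powr (?\<gamma> - ?K))"
        by (simp add: mult_left_mono)
      also have "\<dots> = A * (h powr (?K - \<alpha> 1 1) * h powr (?\<gamma> - ?K))" by simp
      also have "h powr (?K - \<alpha> 1 1) * h powr (?\<gamma> - ?K) = h powr (?\<gamma> - \<alpha> 1 1)"
        unfolding powr_add[symmetric] by simp
      finally show ?case by (simp add: abs_mult)
    qed
  qed
  from tendsto_divide[OF this \<kappa>(2)] \<kappa>(1)
  have "((\<lambda>h. (h powr (?K - \<alpha> 1 1) * \<sigma> h m 1 2 0) / (h powr (?K - \<alpha> 1 1) * \<sigma> h m 1 1 0)) \<longlongrightarrow> 0) (at_right 0)"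
    by simp
  then have "((\<lambda>h. \<sigma> h m 1 2 0 / \<sigma> h m 1 1 0) \<longlongrightarrow> 0) (at_right 0)"
    by (rule Lim_transform_eventually) (auto simp: eventually_at_right_field intro!: exI[of _ 1])
  from filterlim_compose[OF this hlim] show ?thesis .
qed

lemma variance_eventually_pos: "\<forall>\<^sub>F n in sequentially. 0 < \<sigma> (L / real n) m 1 1 0"
proof -
  have hlim: "filterlim (\<lambda>n. L / real n) (at_right 0) sequentially" using L by real_asymp
  obtain \<kappa> where \<kappa>: "0 < \<kappa>" "((\<lambda>h. h powr (4 * real m - \<alpha> 1 1) * \<sigma> h m 1 1 0) \<longlongrightarrow> \<kappa>) (at_right 0)"
    by (rule variance_scaling) (rule that)
  have "\<forall>\<^sub>F n in sequentially. 0 < (L / real n) powr (4 * real m - \<alpha> 1 1) * \<sigma> (L / real n) m 1 1 0"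
    by (rule order_tendstoD(1)[OF filterlim_compose[OF \<kappa>(2) hlim] \<kappa>(1)])
  then show ?thesis by eventually_elim (simp add: zero_less_mult_iff)
qed

text \<open>Outside the two exceptional events the denominator exceeds \<open>a / 2\<close>, while
  the numerator stays below \<open>\<epsilon> * a / 2\<close>: one half of this is allotted to its
  fluctuation and one half to its mean.\<close>

lemma LAP_error_subset:
  fixes n :: nat and \<epsilon> \<beta> :: real
  defines "h \<equiv> L / real n"
  defines "a \<equiv> real (card (igrid L n m :: (real^'d) set)) * \<sigma> h m 1 1 0"
  assumes "0 < \<epsilon>" "0 < a" "\<bar>\<sigma> h m 1 2 0 / \<sigma> h m 1 1 0\<bar> \<le> \<epsilon> / 4"
  shows "{\<omega> \<in> space M. \<epsilon> < \<bar>LAP L n m (\<lambda>s. X s \<omega>) (\<lambda>s. X s \<omega> * \<beta> + W s \<omega>) - \<beta>\<bar>} \<subseteq>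
    {\<omega> \<in> space M. a / 2 \<le> \<bar>\<Sum>s\<in>igrid L n m. U h m 1 s \<omega> * U h m 1 s \<omega> - \<sigma> h m 1 1 0\<bar>} \<union>
    {\<omega> \<in> space M. \<epsilon> * a / 4 \<le> \<bar>\<Sum>s\<in>igrid L n m. U h m 1 s \<omega> * U h m 2 s \<omega> - \<sigma> h m 1 2 0\<bar>}"
proof (rule subsetI, rule ccontr)
  fix \<omega>
  let ?G = "igrid L n m :: (real^'d) set" and ?N = "real (card (igrid L n m :: (real^'d) set))"
  let ?D = "\<Sum>s\<in>?G. U h m 1 s \<omega> * U h m 1 s \<omega>" and ?E = "\<Sum>s\<in>?G. U h m 1 s \<omega> * U h m 2 s \<omega>"
  assume \<omega>: "\<omega> \<in> {\<omega> \<in> space M. \<epsilon> < \<bar>LAP L n m (\<lambda>s. X s \<omega>) (\<lambda>s. X s \<omega> * \<beta> + W s \<omega>) - \<beta>\<bar>}"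
    and "\<omega> \<notin> {\<omega> \<in> space M. a / 2 \<le> \<bar>\<Sum>s\<in>igrid L n m. U h m 1 s \<omega> * U h m 1 s \<omega> - \<sigma> h m 1 1 0\<bar>} \<union>
    {\<omega> \<in> space M. \<epsilon> * a / 4 \<le> \<bar>\<Sum>s\<in>igrid L n m. U h m 1 s \<omega> * U h m 2 s \<omega> - \<sigma> h m 1 2 0\<bar>}"
  then have "\<bar>?D - a\<bar> < a / 2" and E: "\<bar>?E - ?N * \<sigma> h m 1 2 0\<bar> < \<epsilon> * a / 4"
    by (auto simp: sum_subtractf a_def)
  then have D: "a / 2 < ?D" by linarith
  then have D0: "0 < ?D" using assms(4) by linarith
  have v0: "\<sigma> h m 1 1 0 \<noteq> 0" using assms(4) by (auto simp: a_def)
  have "\<bar>?N * \<sigma> h m 1 2 0\<bar> = a * \<bar>\<sigma> h m 1 2 0 / \<sigma> h m 1 1 0\<bar>"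
    using v0 assms(4) unfolding a_def by (simp add: abs_mult zero_less_mult_iff)
  also have "\<dots> \<le> a * (\<epsilon> / 4)" using assms(4,5) by (intro mult_left_mono) auto
  finally have b: "\<bar>?N * \<sigma> h m 1 2 0\<bar> \<le> a * (\<epsilon> / 4)" .
  have "\<bar>?E\<bar> \<le> \<bar>?E - ?N * \<sigma> h m 1 2 0\<bar> + \<bar>?N * \<sigma> h m 1 2 0\<bar>"
    using abs_triangle_ineq[of "?E - ?N * \<sigma> h m 1 2 0" "?N * \<sigma> h m 1 2 0"] by simp
  also have "\<dots> < \<epsilon> * a / 4 + a * (\<epsilon> / 4)" by (rule add_less_le_mono[OF E b])
  also have "\<dots> = \<epsilon> * (a / 2)" by simp
  also have "\<dots> < \<epsilon> * ?D" using D assms(3) by simp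
  finally have ED: "\<bar>?E / ?D\<bar> < \<epsilon>" using D0 by (simp add: abs_divide pos_divide_less_eq)
  have X1: "(laplacian h ^^ m) (\<lambda>s. X s \<omega>) s = U h m 1 s \<omega>" for s by (simp add: U_def Z_def)
  have Y: "(laplacian h ^^ m) (\<lambda>s. X s \<omega> * \<beta> + W s \<omega>) s = \<beta> * U h m 1 s \<omega> + U h m 2 s \<omega>" for s
  proof -
    have "(\<lambda>s. X s \<omega> * \<beta> + W s \<omega>) = (\<lambda>s. \<beta> * Z 1 s \<omega> + Z 2 s \<omega>)" by (simp add: Z_def mult.commute)
    then show ?thesis unfolding U_def by (simp only: laplacian_power_add laplacian_power_cmult)
  qed
  have "LAP L n m (\<lambda>s. X s \<omega>) (\<lambda>s. X s \<omega> * \<beta> + W s \<omega>) = (\<beta> * ?D + ?E) / ?D"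
    unfolding LAP_def h_def[symmetric] X1 Y
    by (simp add: power2_eq_square distrib_left sum.distrib sum_distrib_left mult_ac)
  also have "\<dots> = \<beta> + ?E / ?D" using D0 by (simp add: add_divide_distrib)
  finally show False using \<omega> ED by simp
qed

lemma LAP_tendsto_in_prob:
  "tendsto_in_prob M (\<lambda>n \<omega>. LAP L n m (\<lambda>s. X s \<omega>) (\<lambda>s. X s \<omega> * \<beta> + W s \<omega>)) \<beta>"
  unfolding tendsto_in_prob_def
proof (intro allI impI)
  fix \<epsilon> :: real assume \<epsilon>: "0 < \<epsilon>"
  let ?h = "\<lambda>n. L / real n"
  define a where "a n = real (card (igrid L n m :: (real^'d) set)) * \<sigma> (?h n) m 1 1 0" for n
  define S where "S k n \<omega> = (\<Sum>s\<in>(igrid L n m :: (real^'d) set). U (?h n) m 1 s \<omega> * U (?h n) m k s \<omega> - \<sigma> (?h n) m 1 k 0)"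
    for k n \<omega>
  have lim: "(\<lambda>n. (\<integral>\<omega>. (S k n \<omega>)\<^sup>2 \<partial>M) / (a n)\<^sup>2) \<longlonglongrightarrow> 0" for k
    unfolding S_def a_def by (rule normalized_second_moment_tendsto_0)
  \<comment> \<open>The factors 4 and \<open>16 / \<epsilon>\<^sup>2\<close> are the squared
    reciprocals of the thresholds 1/2 and \<open>\<epsilon> / 4\<close> in Chebyshev's
    inequality.\<close>
  have lim2: "(\<lambda>n. 4 * ((\<integral>\<omega>. (S 1 n \<omega>)\<^sup>2 \<partial>M) / (a n)\<^sup>2) + 16 / \<epsilon>\<^sup>2 * ((\<integral>\<omega>. (S 2 n \<omega>)\<^sup>2 \<partial>M) / (a n)\<^sup>2)) \<longlonglongrightarrow> 0"
    using tendsto_add[OF tendsto_mult[OF tendsto_const[of 4] lim[of 1]] tendsto_mult[OF tendsto_const[of "16 / \<epsilon>\<^sup>2"] lim[of 2]]]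
    by simp
  have cross: "\<forall>\<^sub>F n in sequentially. \<bar>\<sigma> (?h n) m 1 2 0 / \<sigma> (?h n) m 1 1 0\<bar> < \<epsilon> / 4"
    using tendstoD[OF cross_covariance_ratio_tendsto_0, of "\<epsilon> / 4"] \<epsilon> by simp
  show "(\<lambda>n. measure M {\<omega> \<in> space M. \<epsilon> < \<bar>LAP L n m (\<lambda>s. X s \<omega>) (\<lambda>s. X s \<omega> * \<beta> + W s \<omega>) - \<beta>\<bar>}) \<longlonglongrightarrow> 0"
  proof (rule Lim_null_comparison[OF _ lim2])
    show "\<forall>\<^sub>F n in sequentially. norm (measure M {\<omega> \<in> space M. \<epsilon> < \<bar>LAP L n m (\<lambda>s. X s \<omega>) (\<lambda>s. X s \<omega> * \<beta> + W s \<omega>) - \<beta>\<bar>})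
        \<le> 4 * ((\<integral>\<omega>. (S 1 n \<omega>)\<^sup>2 \<partial>M) / (a n)\<^sup>2) + 16 / \<epsilon>\<^sup>2 * ((\<integral>\<omega>. (S 2 n \<omega>)\<^sup>2 \<partial>M) / (a n)\<^sup>2)"
      using cross variance_eventually_pos eventually_ge_at_top[of "4 * m + 1"]
    proof eventually_elim
      case (elim n)
      then have n: "0 < n" "4 * m \<le> n" by auto
      have "0 < (real n / 2) ^ CARD('d)" using n by simp
      then have "0 < real (card (igrid L n m :: (real^'d) set))"
        using card_igrid_ge[OF L n, where 'd = 'd] by linarith
      then have a: "0 < a n" using elim(2) by (simp add: a_def)
      note fin = finite_igrid[OF L n(1), of m, where 'd = 'd]
      \<comment> \<open>Integrability and measurability are taken from the trivial partition with a
        single cell.\<close>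
      have int: "integrable M (\<lambda>\<omega>. (S k n \<omega>)\<^sup>2)" for k
        unfolding S_def by (rule centered_sum_second_moment_le(2)[OF m_pos fin finite.emptyI[THEN finite.insertI], where cell = "\<lambda>_. ()"]) auto
      have meas[measurable]: "S k n \<in> borel_measurable M" for k
        unfolding S_def[abs_def] by (rule centered_sum_second_moment_le(3)[OF m_pos fin finite.emptyI[THEN finite.insertI], where cell = "\<lambda>_. ()"]) auto
      have "measure M {\<omega> \<in> space M. \<epsilon> < \<bar>LAP L n m (\<lambda>s. X s \<omega>) (\<lambda>s. X s \<omega> * \<beta> + W s \<omega>) - \<beta>\<bar>} \<le>
          measure M ({\<omega> \<in> space M. a n / 2 \<le> \<bar>S 1 n \<omega>\<bar>} \<union> {\<omega> \<in> space M. \<epsilon> * a n / 4 \<le> \<bar>S 2 n \<omega>\<bar>})"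
      proof (rule finite_measure_mono)
        show "{\<omega> \<in> space M. \<epsilon> < \<bar>LAP L n m (\<lambda>s. X s \<omega>) (\<lambda>s. X s \<omega> * \<beta> + W s \<omega>) - \<beta>\<bar>} \<subseteq>
            {\<omega> \<in> space M. a n / 2 \<le> \<bar>S 1 n \<omega>\<bar>} \<union> {\<omega> \<in> space M. \<epsilon> * a n / 4 \<le> \<bar>S 2 n \<omega>\<bar>}"
          unfolding S_def a_def
          by (rule LAP_error_subset[OF \<epsilon> a[unfolded a_def] less_imp_le[OF elim(1)]])
      qed measurable
      also have "\<dots> \<le> measure M {\<omega> \<in> space M. a n / 2 \<le> \<bar>S 1 n \<omega>\<bar>} + measure M {\<omega> \<in> space M. \<epsilon> * a n / 4 \<le> \<bar>S 2 n \<omega>\<bar>}"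
        by (rule measure_Un_le) measurable
      also have "\<dots> \<le> (\<integral>\<omega>. (S 1 n \<omega>)\<^sup>2 \<partial>M) / (a n / 2)\<^sup>2 + (\<integral>\<omega>. (S 2 n \<omega>)\<^sup>2 \<partial>M) / (\<epsilon> * a n / 4)\<^sup>2"
        using a \<epsilon> by (intro add_mono second_moment_method meas int) auto
      also have "\<dots> = 4 * ((\<integral>\<omega>. (S 1 n \<omega>)\<^sup>2 \<partial>M) / (a n)\<^sup>2) + 16 / \<epsilon>\<^sup>2 * ((\<integral>\<omega>. (S 2 n \<omega>)\<^sup>2 \<partial>M) / (a n)\<^sup>2)"
        by (simp add: power_divide power_mult_distrib mult.commute)
      finally show ?case by simp
    qed
  qed
qed

end

end

end

text \<open>Removing \<open>m\<close> layers matches the reach of \<open>m\<close> Laplacians, so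
  the ratio depends on observed values only.\<close>

lemma laplacian_power_cong_on_cube:
  fixes f g :: "real^'d \<Rightarrow> real"
  assumes "0 < L" "0 < n" "s \<in> igrid L n m" "\<And>t. t \<in> cube L \<Longrightarrow> f t = g t"
  shows "(laplacian (L / real n) ^^ m) f s = (laplacian (L / real n) ^^ m) g s"
proof (rule laplacian_power_cong)
  show "0 \<le> L / real n" using assms(1) by simp
  fix t assume t: "norm (t - s) \<le> real m * (L / real n)"
  have "0 \<le> t $ i \<and> t $ i \<le> L" for i
  proof -
    obtain k where k: "m \<le> k" "k + m \<le> n" "s $ i = real k * (L / real n)"
      using assms(3) unfolding igrid_explicit[OF assms(1,2)] by blast
    have "\<bar>t $ i - s $ i\<bar> \<le> real m * (L / real n)"
      using component_le_norm_cart[of "t - s" i] t by simp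
    moreover have "real m * (L / real n) \<le> s $ i"
      unfolding k(3) using k(1) assms(1) by (intro mult_right_mono) auto
    moreover have "s $ i + real m * (L / real n) \<le> L"
    proof -
      have "s $ i + real m * (L / real n) = real (k + m) * (L / real n)"
        unfolding k(3) of_nat_add by (rule distrib_right[symmetric])
      also have "\<dots> \<le> real n * (L / real n)" using k(2) assms(1) by (intro mult_right_mono) auto
      finally show ?thesis using assms(2) by simp
    qed
    ultimately show ?thesis by linarith
  qed
  then show "f t = g t" by (intro assms(4)) (simp add: cube_def mem_box_cart)
qed

section \<open>From the ratio to an estimator on the paths\<close>

lemma measurable_path_component:
  "(\<lambda>f. fst (f s)) \<in> borel_measurable (\<Pi>\<^sub>M s\<in>S. (borel :: (real \<times> real) measure))"
  "(\<lambda>f. snd (f s)) \<in> borel_measurable (\<Pi>\<^sub>M s\<in>S. (borel :: (real \<times> real) measure))"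
proof -
  have "(\<lambda>f. f s) \<in> measurable (\<Pi>\<^sub>M s\<in>S. borel) (borel :: (real \<times> real) measure)"
  proof (cases "s \<in> S")
    \<comment> \<open>Off \<open>S\<close> every element of the product space takes the value
      \<open>undefined\<close>, so the evaluation is constant there.\<close>
    case False
    have "(\<lambda>f. f s) \<in> measurable (\<Pi>\<^sub>M s\<in>S. borel) (borel :: (real \<times> real) measure) \<longleftrightarrow>
        (\<lambda>f. undefined) \<in> measurable (\<Pi>\<^sub>M s\<in>S. (borel :: (real \<times> real) measure)) (borel :: (real \<times> real) measure)"
      by (rule measurable_cong) (use False in \<open>auto simp: space_PiM PiE_def extensional_def\<close>)
    then show ?thesis by simp
  qed simp
  note path = this
  have "(fst :: real \<times> real \<Rightarrow> real) \<in> borel_measurable borel"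
    "(snd :: real \<times> real \<Rightarrow> real) \<in> borel_measurable borel"
    by (intro borel_measurable_continuous_onI continuous_intros)+
  from measurable_compose[OF path this(1)] measurable_compose[OF path this(2)]
  show "(\<lambda>f. fst (f s)) \<in> borel_measurable (\<Pi>\<^sub>M s\<in>S. (borel :: (real \<times> real) measure))"
    "(\<lambda>f. snd (f s)) \<in> borel_measurable (\<Pi>\<^sub>M s\<in>S. (borel :: (real \<times> real) measure))" .
qed

lemma laplacian_power_measurable:
  fixes F :: "'p \<Rightarrow> real^'d \<Rightarrow> real"
  assumes "\<And>s. (\<lambda>f. F f s) \<in> borel_measurable N"
  shows "(\<lambda>f. (laplacian h ^^ k) (F f) s) \<in> borel_measurable N"
proof -
  obtain J :: "(real^'d) set" and a
    where J: "finite J" "\<And>v. v \<in> J \<Longrightarrow> norm v \<le> real k" "\<And>v i. v \<in> J \<Longrightarrow> v $ i \<in> \<int>"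
    and eq: "\<And>h f u. (laplacian h ^^ k) f u = (\<Sum>v\<in>J. a v * f (u + h *\<^sub>R v)) / h ^ (2 * k)"
    by (rule laplacian_power_stencil) (rule that)
  show ?thesis unfolding eq using assms by simp
qed

lemma consistently_estimable_by_LAP:
  fixes X :: "real^'d \<Rightarrow> 'a \<Rightarrow> real"
  assumes "0 < L" "\<And>b. tendsto_in_prob M (\<lambda>n \<omega>. LAP L n m (\<lambda>s. X s \<omega>) (\<lambda>s. Y b s \<omega>)) b"
  shows "consistently_estimable_on_paths M (cube L) X Y"
  unfolding consistently_estimable_on_paths_def
proof (intro exI[of _ "\<lambda>n f. LAP L n m (\<lambda>s. fst (f s)) (\<lambda>s. snd (f s))"] conjI allI)
  show "(\<lambda>f. LAP L n m (\<lambda>s. fst (f s)) (\<lambda>s. snd (f s))) \<in> borel_measurable (\<Pi>\<^sub>M s\<in>cube L. borel)" for n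
    unfolding LAP_def
    by (intro borel_measurable_divide borel_measurable_sum borel_measurable_times borel_measurable_power
        laplacian_power_measurable measurable_path_component)
  fix b
  \<comment> \<open>The restricted path is \<open>undefined\<close> outside the cube, which the
    ratio never reads. The value \<open>n = 0\<close> is excluded because \<open>L / real 0\<close>
    is 0; it does not affect the limit.\<close>
  have "LAP L n m (\<lambda>s. fst ((\<lambda>s\<in>cube L. (X s \<omega>, Y b s \<omega>)) s)) (\<lambda>s. snd ((\<lambda>s\<in>cube L. (X s \<omega>, Y b s \<omega>)) s)) =
      LAP L n m (\<lambda>s. X s \<omega>) (\<lambda>s. Y b s \<omega>)" if n: "0 < n" for n \<omega>
  proof -
    have "(laplacian (L / real n) ^^ m) (\<lambda>s. fst ((\<lambda>s\<in>cube L. (X s \<omega>, Y b s \<omega>)) s)) s =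
        (laplacian (L / real n) ^^ m) (\<lambda>s. X s \<omega>) s"
      "(laplacian (L / real n) ^^ m) (\<lambda>s. snd ((\<lambda>s\<in>cube L. (X s \<omega>, Y b s \<omega>)) s)) s =
        (laplacian (L / real n) ^^ m) (\<lambda>s. Y b s \<omega>) s" if "s \<in> igrid L n m" for s
      by (intro laplacian_power_cong_on_cube[OF assms(1) n that], simp)+
    then show ?thesis unfolding LAP_def by (simp cong: sum.cong)
  qed
  note eq = this
  show "tendsto_in_prob M (\<lambda>n \<omega>. LAP L n m (\<lambda>s. fst ((\<lambda>s\<in>cube L. (X s \<omega>, Y b s \<omega>)) s))
      (\<lambda>s. snd ((\<lambda>s\<in>cube L. (X s \<omega>, Y b s \<omega>)) s))) b"
    unfolding tendsto_in_prob_def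
  proof (intro allI impI)
    fix \<epsilon> :: real assume "0 < \<epsilon>"
    then have "(\<lambda>n. measure M {\<omega> \<in> space M. \<epsilon> < \<bar>LAP L n m (\<lambda>s. X s \<omega>) (\<lambda>s. Y b s \<omega>) - b\<bar>}) \<longlonglongrightarrow> 0"
      using assms(2)[of b] unfolding tendsto_in_prob_def by blast
    then show "(\<lambda>n. measure M {\<omega> \<in> space M. \<epsilon> < \<bar>LAP L n m (\<lambda>s. fst ((\<lambda>s\<in>cube L. (X s \<omega>, Y b s \<omega>)) s))
        (\<lambda>s. snd ((\<lambda>s\<in>cube L. (X s \<omega>, Y b s \<omega>)) s)) - b\<bar>}) \<longlonglongrightarrow> 0"
      by (rule Lim_transform_eventually)
        (use eventually_gt_at_top[of 0] in eventually_elim, simp only: eq)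
  qed
qed

theorem theorem3:
  fixes M :: "'a measure"
    and X W :: "real^'d \<Rightarrow> 'a \<Rightarrow> real"
    and C :: "real^'d \<Rightarrow> real^2^2"
    and L :: real
    and c \<alpha> :: "2 \<Rightarrow> 2 \<Rightarrow> real"
  assumes "prob_space M"
    and "stationary_gaussian_field M (\<lambda>s \<omega>. vector [X s \<omega>, W s \<omega>] :: real^2) C"
    and "0 < L"
    and "condition_Ad L c \<alpha> C"
    and "\<alpha> 1 1 < \<alpha> 1 2"
    and "\<alpha> 1 1 < \<alpha> 2 2 + real CARD('d)"
  shows "consistently_estimable_on_paths M (cube L) X (\<lambda>\<beta> s \<omega>. X s \<omega> * \<beta> + W s \<omega>) \<and>
    (\<forall>\<beta> m. \<alpha> 1 1 < 4 * real m \<longrightarrow>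
       tendsto_in_prob M
         (\<lambda>n \<omega>. LAP L n m (\<lambda>s. X s \<omega>) (\<lambda>s. X s \<omega> * \<beta> + W s \<omega>)) \<beta>)"
proof -
  interpret prob_space M by fact
  interpret bivariate_field M X W C
    by unfold_locales (use assms in \<open>auto simp: condition_Ad_def\<close>)
  have LAP: "tendsto_in_prob M (\<lambda>n \<omega>. LAP L n m (\<lambda>s. X s \<omega>) (\<lambda>s. X s \<omega> * \<beta> + W s \<omega>)) \<beta>"
    if "\<alpha> 1 1 < 4 * real m" for \<beta> m
    by (rule LAP_tendsto_in_prob[OF assms(3,4) that assms(5,6)])
  \<comment> \<open>Estimability requires one admissible order of differencing, and every
    sufficiently large one is admissible.\<close>
  obtain m where "\<alpha> 1 1 / 4 < real m" using reals_Archimedean2 by blast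
  then have "\<alpha> 1 1 < 4 * real m" by simp
  then have "consistently_estimable_on_paths M (cube L) X (\<lambda>\<beta> s \<omega>. X s \<omega> * \<beta> + W s \<omega>)"
    by (intro consistently_estimable_by_LAP[OF assms(3), where m = m] LAP)
  with LAP show ?thesis by blast
qed

end
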